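(* Let $f: [q]^k \to \{0,1\}$ be any predicate. Let $\Phi_0$ be a $(c,s)$ integrality gap instance for the basic LP relaxation of MAX k-CSP($f$). Then for every $\varepsilon > 0$, there exists $c_{\varepsilon} > 0$ such that for infinitely many $N \in \mathbb{N}$, there exist $(c-\varepsilon, s+\varepsilon)$ integrality gap instances of size $N$ for the LP relaxation given by $c_{\varepsilon} \cdot \frac{\log N}{\log \log N}$ levels of the Sherali-Adams hierarchy.
   Context: Let $[q]=\{0,\ldots,q-1\}$. For a predicate $f:[q]^k\to\{0,1\}$, an instance $\Phi$ of MAX k-CSP($f$) consists of variables $x_1,\ldots,x_n$ taking values in $[q]$ and constraints $C_1,\ldots,C_m$, each of the form $f(x_{i_1}+b_{i_1},\ldots,x_{i_k}+b_{i_k})$ for some $k$-tuple of variables and $b_{i_1},\ldots,b_{i_k}\in[q]$ (addition modulo $q$); write it as $f(x_C+b_C)$ and let $S_C$ be the set of indices of its variables. $\mathrm{opt}(\Phi)$ is the maximum over assignments $\sigma:\{x_1,\ldots,x_n\}\to[q]$ of the fraction of constraints satisfied. The size of an instance is its number of variables. The level-$t$ Sherali-Adams LP has variables $x_{(S,\alpha)}\ge 0$ for all $S\subseteq[n]$ with $|S|\le t$ and $\alpha\in[q]^S$, with $x_{(\emptyset,\emptyset)}=1$ and $\sum_{\alpha\in[q]^S,\,\alpha|_T=\beta} x_{(S,\alpha)} = x_{(T,\beta)}$ for all $T\subseteq S$, $|S|\le t$, $\beta\in[q]^T$; it maximizes $\mathbb{E}_{C\in\Phi}\big[\sum_{\alpha\in[q]^k}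 f(\alpha+b_C)\, x_{(S_C,\alpha)}\big]$. The basic LP has the same objective but only variables $x_{(S_C,\alpha)}\ge 0$ for constraints $C$ and $x_{(i,b)}$ for single variables, with constraints $\sum_{b\in[q]} x_{(i,b)}=1$ for all $i$ and $\sum_{\alpha\in[q]^{S_C},\,\alpha(i)=b} x_{(S_C,\alpha)} = x_{(i,b)}$ for all $C$, $i\in S_C$, $b\in[q]$. For a relaxation, an instance $\Phi$ is a $(c,s)$ integrality gap instance if the relaxation's optimum value on $\Phi$ is at least $c$ while $\mathrm{opt}(\Phi) < s$. *)

theory Defs
  imports Complex_Main "HOL-Library.FuncSet"
begin

text \<open>
  Variables are the indices \<open>0, \<dots>, n - 1\<close>. A constraint is a pair \<open>(vs, bs)\<close> consisting of a
  \<open>k\<close>-tuple of variables and a \<open>k\<close>-tuple of shifts. Constraints form a list, so a constraint may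
  occur several times and is then counted with multiplicity.
\<close>

type_synonym csp_constraint = "nat list \<times> nat list"

record csp =
  nvars :: nat
  constrs :: "csp_constraint list"

definition csp_instance :: "nat \<Rightarrow> nat \<Rightarrow> csp \<Rightarrow> bool" where
  "csp_instance k q \<Phi> \<longleftrightarrow>
     constrs \<Phi> \<noteq> [] \<and>
     (\<forall>(vs, bs) \<in> set (constrs \<Phi>).
        length vs = k \<and> length bs = k \<and> set vs \<subseteq> {..<nvars \<Phi>} \<and> set bs \<subseteq> {..<q})"

definition satisfies :: "(nat list \<Rightarrow> bool) \<Rightarrow> nat \<Rightarrow> (nat \<Rightarrow> nat) \<Rightarrow> csp_constraint \<Rightarrow> bool" where
  "satisfies f q \<alpha> C = f (map2 (\<lambda>i b. (\<alpha> i + b) mod q) (fst C) (snd C))"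

definition scope :: "csp_constraint \<Rightarrow> nat set" where
  "scope C = set (fst C)"

abbreviation assigns :: "nat \<Rightarrow> nat set \<Rightarrow> (nat \<Rightarrow> nat) set" where
  "assigns q S \<equiv> S \<rightarrow>\<^sub>E {..<q}"

definition avg_constrs :: "csp \<Rightarrow> (csp_constraint \<Rightarrow> real) \<Rightarrow> real" where
  "avg_constrs \<Phi> g = (\<Sum>C\<leftarrow>constrs \<Phi>. g C) / real (length (constrs \<Phi>))"

definition csp_opt :: "(nat list \<Rightarrow> bool) \<Rightarrow> nat \<Rightarrow> csp \<Rightarrow> real" where
  "csp_opt f q \<Phi> =
     Max ((\<lambda>\<sigma>. avg_constrs \<Phi> (\<lambda>C. of_bool (satisfies f q \<sigma> C))) ` assigns q {..<nvars \<Phi>})"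

text \<open>
  The LP variable \<open>x\<^bsub>(S,\<alpha>)\<^esub>\<close> is \<open>x S \<alpha>\<close>. The sum in the objective ranges over assignments to the
  set of variables of \<open>C\<close>; if these variables are distinct, such assignments correspond
  to the elements of \<open>[q]\<^sup>k\<close>. This form also makes sense for tuples with repeated entries.
\<close>

definition lp_objective ::
  "(nat list \<Rightarrow> bool) \<Rightarrow> nat \<Rightarrow> csp \<Rightarrow> (nat set \<Rightarrow> (nat \<Rightarrow> nat) \<Rightarrow> real) \<Rightarrow> real" where
  "lp_objective f q \<Phi> x =
     avg_constrs \<Phi>
       (\<lambda>C. \<Sum>\<alpha>\<in>assigns q (scope C). of_bool (satisfies f q \<alpha> C) * x (scope C) \<alpha>)"

definition basic_feasible ::
  "nat \<Rightarrow> csp \<Rightarrow> (nat set \<Rightarrow> (nat \<Rightarrow> nat) \<Rightarrow> real) \<Rightarrow> (nat \<Rightarrow> nat \<Rightarrow> real) \<Rightarrow> bool" where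
  "basic_feasible q \<Phi> x y \<longleftrightarrow>
     (\<forall>C\<in>set (constrs \<Phi>). \<forall>\<alpha>\<in>assigns q (scope C). x (scope C) \<alpha> \<ge> 0) \<and>
     (\<forall>i<nvars \<Phi>. (\<Sum>b<q. y i b) = 1) \<and>
     (\<forall>C\<in>set (constrs \<Phi>). \<forall>i\<in>scope C. \<forall>b<q.
        (\<Sum>\<alpha> | \<alpha> \<in> assigns q (scope C) \<and> \<alpha> i = b. x (scope C) \<alpha>) = y i b)"

definition basic_lp_opt :: "(nat list \<Rightarrow> bool) \<Rightarrow> nat \<Rightarrow> csp \<Rightarrow> real" where
  "basic_lp_opt f q \<Phi> = Sup {lp_objective f q \<Phi> x |x y. basic_feasible q \<Phi> x y}"

text \<open>
  At level \<open>t\<close> there are no variables for sets with more than \<open>t\<close> elements. As \<open>x\<close> is a total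
  function, it is required to vanish there; otherwise the objective could be unbounded when \<open>t\<close>
  is smaller than the size of a constraint.
\<close>

definition sa_feasible ::
  "nat \<Rightarrow> nat \<Rightarrow> csp \<Rightarrow> (nat set \<Rightarrow> (nat \<Rightarrow> nat) \<Rightarrow> real) \<Rightarrow> bool" where
  "sa_feasible q t \<Phi> x \<longleftrightarrow>
     (\<forall>S\<subseteq>{..<nvars \<Phi>}. card S \<le> t \<longrightarrow> (\<forall>\<alpha>\<in>assigns q S. x S \<alpha> \<ge> 0)) \<and>
     (\<forall>S \<alpha>. card S > t \<longrightarrow> x S \<alpha> = 0) \<and>
     x {} (\<lambda>_. undefined) = 1 \<and>
     (\<forall>S\<subseteq>{..<nvars \<Phi>}. card S \<le> t \<longrightarrow>
        (\<forall>T\<subseteq>S. \<forall>\<beta>\<in>assigns q T.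
           (\<Sum>\<alpha> | \<alpha> \<in> assigns q S \<and> restrict \<alpha> T = \<beta>. x S \<alpha>) = x T \<beta>))"

definition sa_lp_opt :: "(nat list \<Rightarrow> bool) \<Rightarrow> nat \<Rightarrow> nat \<Rightarrow> csp \<Rightarrow> real" where
  "sa_lp_opt f q t \<Phi> = Sup {lp_objective f q \<Phi> x |x. sa_feasible q t \<Phi> x}"

text \<open>A relaxation is given by the function \<open>R\<close> mapping an instance to its optimum value.\<close>

definition gap_instance ::
  "(csp \<Rightarrow> real) \<Rightarrow> (nat list \<Rightarrow> bool) \<Rightarrow> nat \<Rightarrow> nat \<Rightarrow> real \<Rightarrow> real \<Rightarrow> csp \<Rightarrow> bool" where
  "gap_instance R f k q c s \<Phi> \<longleftrightarrow> csp_instance k q \<Phi> \<and> R \<Phi> \<ge> c \<and> csp_opt f q \<Phi> < s"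

end

(*
  Random lifting: replace every variable by n copies and put, for each constraint, linearly many
  copies of it on random copies of its variables. Chernoff and a union bound over assignments keep
  the optimum at most s + \<epsilon>, and deleting few constraints makes the girth logarithmic in n.

  The Sherali-Adams solution: for a set S of variables let H be the set of constraints on short
  trails between points of S. Keep each constraint of H independently with probability 1 - \<epsilon>. Unless
  a long trail survives, the surviving constraints form a forest, on which the local distributions
  of the basic LP solution glue to a global one; take its marginal on S. Since short trails are
  determined by their end points, long trails survive only with probability polynomial in |S| times
  (1 - \<epsilon>) to the power of the girth, so these marginals are consistent up to an error that is
  exponentially small in the level. Combining the Efron-Stein components of the marginals makes them
  exactly consistent, and mixing with a product distribution restores nonnegativity.
*)

theory Submission
  imports Defs "HOL-Real_Asymp.Real_Asymp"
begin

section \<open>Trails in hypergraphs of high girth\<close>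

text \<open>The obstacle is that the percolated hypergraph depends on \<open>S\<close>, and with it
  the event that a long trail survives, so marginals for different \<open>S\<close> agree only up to
  that event. Its probability is at most polynomial in \<open>card S\<close> and \<open>R\<close>
  times \<open>(1 - \<epsilon>) ^ R\<close>, with \<open>R\<close> of order \<open>ln n\<close>,
  whereas densities and the repair of consistency cost \<open>(4 * M) ^ card S\<close>. Levels of
  order \<open>ln n\<close> are therefore affordable; the level in the theorem stays below that once
  \<open>ln (ln N) \<ge> 1\<close>.

  Distributions are handled as densities against the product of the one-variable marginals.

  Girth is stated through cores because a core of \<open>s\<close> constraints forces
  \<open>s\<close> coincidences among random copies, each of probability at most
  \<open>s / n\<close>. Summed over the \<open>m choose s\<close> index sets and the choices of
  coincidences this leaves \<open>K ^ s\<close> with \<open>K\<close> constant, affordable for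
  \<open>s\<close> up to a small multiple of \<open>ln n\<close>.

  One \<open>\<epsilon>\<close> measures all losses: sampling deviation, deleted constraints,
  percolation, and both mixings.\<close>

fun trail :: "'v \<Rightarrow> ('v set \<times> 'v) list \<Rightarrow> 'v \<Rightarrow> bool" where
  "trail u [] v \<longleftrightarrow> u = v"
| "trail u ((e, w) # p) v \<longleftrightarrow> u \<in> e \<and> w \<in> e \<and> u \<noteq> w \<and> trail w p v"

abbreviation edges :: "('v set \<times> 'v) list \<Rightarrow> 'v set set" where
  "edges p \<equiv> fst ` set p"

text \<open>The trail as a set of edges of the bipartite incidence graph of vertices and hyperedges;
  comparing two trails becomes a parity argument on degrees there.\<close>

fun incs :: "'v \<Rightarrow> ('v set \<times> 'v) list \<Rightarrow> ('v \<times> 'v set) set" where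
  "incs u [] = {}"
| "incs u ((e, w) # p) = {(u, e), (w, e)} \<union> incs w p"

text \<open>
  What remains of a hypergraph after repeatedly removing edges that meet \<open>T\<close> and the other edges
  in at most one vertex. High girth means that small sets of edges have empty \<open>{}\<close>-core.
\<close>

definition core :: "'v set \<Rightarrow> 'v set set \<Rightarrow> bool" where
  "core T B \<longleftrightarrow> (\<forall>e\<in>B. \<exists>a\<in>e. \<exists>b\<in>e. a \<noteq> b \<and> a \<in> T \<union> \<Union>(B - {e}) \<and> b \<in> T \<union> \<Union>(B - {e}))"

lemma finite_incs: "finite (incs u p)"
  by (induction u p rule: incs.induct) auto

lemma incs_edges: "(x, e) \<in> incs u p \<Longrightarrow> e \<in> edges p"
  by (induction u p rule: incs.induct) auto

lemma snd_incs: "snd ` incs u p = edges p"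
  by (induction u p rule: incs.induct) auto

lemma incs_mem: "trail u p v \<Longrightarrow> (x, e) \<in> incs u p \<Longrightarrow> x \<in> e"
  by (induction u p v rule: trail.induct) auto

text \<open>An edge is traversed at most once, with distinct entry and exit, so it carries 0 or 2
  incidences.\<close>

lemma even_incs_edge:
  "trail u p v \<Longrightarrow> distinct (map fst p) \<Longrightarrow> even (card {x. (x, e) \<in> incs u p})"
proof (induction u p v rule: trail.induct)
  case (2 u e' w p v)
  show ?case
  proof (cases "e = e'")
    case True
    then have "(x, e) \<notin> incs w p" for x
      using 2 incs_edges[of x e w p] by auto
    then have "{x. (x, e) \<in> incs u ((e', w) # p)} = {u, w}"
      using True by auto
    then show ?thesis using 2 by simp
  next
    case False
    then have "{x. (x, e) \<in> incs u ((e', w) # p)} = {x. (x, e) \<in> incs w p}"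
      by auto
    then show ?thesis using 2 by simp
  qed
qed simp

lemma finite_incs_vertex: "finite {e. (x, e) \<in> incs u p}"
  by (rule finite_subset[OF _ finite_imageI[OF finite_incs[of u p], of snd]]) force

lemma finite_incs_edge: "finite {x. (x, e) \<in> incs u p}"
  by (rule finite_subset[OF _ finite_imageI[OF finite_incs[of u p], of fst]]) force

text \<open>A visit to \<open>x\<close> inside the trail contributes an incoming and an outgoing
  incidence; only the two ends are unpaired. Distinctness of the edges keeps these incidences from
  coinciding.\<close>

lemma even_incs_vertex:
  "trail u p v \<Longrightarrow> distinct (map fst p) \<Longrightarrow>
    even (card {e. (x, e) \<in> incs u p} + of_bool (x = u) + of_bool (x = v))"
proof (induction u p v rule: trail.induct)
  case (2 u e w p v)
  let ?X = "{e. (x, e) \<in> incs w p}"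
  have e: "e \<notin> ?X" using 2 incs_edges[of x e w p] by auto
  have IH: "even (card ?X + of_bool (x = w) + of_bool (x = v))"
    using 2 by simp
  have *: "{e'. (x, e') \<in> incs u ((e, w) # p)} = (if x = u \<or> x = w then insert e ?X else ?X)"
    by auto
  have "card (insert e ?X) = Suc (card ?X)"
    using e finite_incs_vertex by (metis card_insert_disjoint)
  then show ?case using IH 2(2) unfolding * by (auto simp: of_bool_def split: if_splits)
qed simp

lemma even_card_symdiff:
  assumes "finite A" "finite B" "even (card A + card B)"
  shows "even (card ((A - B) \<union> (B - A)))"
proof -
  have "card ((A - B) \<union> (B - A)) = card (A - B) + card (B - A)"
    using assms by (intro card_Un_disjoint) auto
  moreover have "card A = card (A - B) + card (A \<inter> B)"
    using assms by (subst card_Un_disjoint[symmetric]) (auto intro: arg_cong[where f = card])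
  moreover have "card B = card (B - A) + card (A \<inter> B)"
    using assms by (subst card_Un_disjoint[symmetric]) (auto intro: arg_cong[where f = card])
  ultimately show ?thesis using assms(3) by presburger
qed

lemma even_card_other:
  assumes "finite A" "even (card A)" "a \<in> A"
  obtains b where "b \<in> A" "b \<noteq> a"
proof -
  have "A \<noteq> {a}" using assms by auto
  then show thesis using that assms(3) by blast
qed

lemma trail_append: "trail u (p @ p') v \<longleftrightarrow> (\<exists>w. trail u p w \<and> trail w p' v)"
  by (induction u p v rule: trail.induct) auto

definition short_trails :: "'v set set \<Rightarrow> nat \<Rightarrow> 'v \<Rightarrow> 'v \<Rightarrow> ('v set \<times> 'v) list set" where
  "short_trails E r u v = {p. trail u p v \<and> distinct (map fst p) \<and> edges p \<subseteq> E \<and> length p \<le> r}"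

text \<open>Ruling out length exactly \<open>R\<close> is enough: a longer trail has a prefix of
  that length.\<close>

definition no_long_trail :: "nat \<Rightarrow> 'v set set \<Rightarrow> bool" where
  "no_long_trail R A \<longleftrightarrow> (\<forall>u v. \<forall>p\<in>short_trails A R u v. length p \<noteq> R)"

definition span :: "'v set set \<Rightarrow> nat \<Rightarrow> 'v set \<Rightarrow> 'v set set" where
  "span E R T = (\<Union>u\<in>T. \<Union>v\<in>T. \<Union>p\<in>short_trails E R u v. edges p)"

text \<open>The bound \<open>2 * R\<close> is the number of edges that two trails of length at most
  \<open>R\<close> can have together.\<close>

locale high_girth =
  fixes E :: "'v set set" and R :: nat
  assumes finite_E: "finite E"
    and girth: "B \<subseteq> E \<Longrightarrow> B \<noteq> {} \<Longrightarrow> card B \<le> 2 * R \<Longrightarrow> \<not> core {} B"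
    and R_ge_2: "R \<ge> 2"
begin

text \<open>
  All degrees in the symmetric difference of the two incidence sets are even, so the edges
  occurring in it form a \<open>{}\<close>-core.
\<close>

lemma trail_unique:
  assumes p: "p \<in> short_trails E r u v" and p': "p' \<in> short_trails E r' u v"
    and r: "r + r' \<le> 2 * R"
  shows "edges p = edges p'"
proof -
  note t = p[unfolded short_trails_def] p'[unfolded short_trails_def]
  define D where "D = (incs u p - incs u p') \<union> (incs u p' - incs u p)"
  define F where "F = {e. \<exists>x. (x, e) \<in> D}"
  have De: "even (card {x. (x, e) \<in> D})" for e
  proof -
    have "{x. (x, e) \<in> D} = ({x. (x, e) \<in> incs u p} - {x. (x, e) \<in> incs u p'}) \<union>
        ({x. (x, e) \<in> incs u p'} - {x. (x, e) \<in> incs u p})"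
      unfolding D_def by auto
    then show ?thesis
      using t even_incs_edge by (auto intro!: even_card_symdiff finite_incs_edge)
  qed
  have Dx: "even (card {e. (x, e) \<in> D})" for x
  proof -
    have "{e. (x, e) \<in> D} = ({e. (x, e) \<in> incs u p} - {e. (x, e) \<in> incs u p'}) \<union>
        ({e. (x, e) \<in> incs u p'} - {e. (x, e) \<in> incs u p})"
      unfolding D_def by auto
    moreover have "even (card {e. (x, e) \<in> incs u p} + card {e. (x, e) \<in> incs u p'})"
      using even_incs_vertex[of u p v x] even_incs_vertex[of u p' v x] t by auto
    ultimately show ?thesis
      by (simp only:) (intro even_card_symdiff finite_incs_vertex)
  qed
  have fin: "finite D" unfolding D_def by (simp add: finite_incs)
  have finx: "finite {x. (x, e) \<in> D}" for e
    by (rule finite_subset[OF _ finite_imageI[OF fin, of fst]]) force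
  have fine: "finite {e. (x, e) \<in> D}" for x
    by (rule finite_subset[OF _ finite_imageI[OF fin, of snd]]) force
  have mem: "x \<in> e" if "(x, e) \<in> D" for x e
    using that incs_mem[of u p v x e] incs_mem[of u p' v x e] t unfolding D_def by auto
  have FU: "F \<subseteq> edges p \<union> edges p'"
    unfolding F_def D_def using incs_edges[of _ _ u p] incs_edges[of _ _ u p'] by blast
  have "core {} F"
    unfolding core_def
  proof
    fix e assume "e \<in> F"
    then obtain a where a: "(a, e) \<in> D" unfolding F_def by auto
    obtain b where b: "(b, e) \<in> D" "b \<noteq> a"
      using even_card_other[OF finx De, of a e] a by auto
    have other: "x \<in> \<Union>(F - {e})" if x: "(x, e) \<in> D" for x
    proof -
      obtain e' where "(x, e') \<in> D" "e' \<noteq> e"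
        using even_card_other[OF fine Dx, of e x] x by auto
      then show ?thesis using mem unfolding F_def by blast
    qed
    show "\<exists>a\<in>e. \<exists>b\<in>e. a \<noteq> b \<and> a \<in> {} \<union> \<Union> (F - {e}) \<and> b \<in> {} \<union> \<Union> (F - {e})"
      using other[OF a] other[OF b(1)] mem[OF a] mem[OF b(1)] b(2) by blast
  qed
  moreover have "card F \<le> 2 * R"
  proof -
    have "card F \<le> card (edges p \<union> edges p')"
      using FU by (intro card_mono) auto
    also have "\<dots> \<le> card (edges p) + card (edges p')" by (rule card_Un_le)
    also have "\<dots> \<le> length p + length p'"
      by (intro add_mono order_trans[OF card_image_le[OF finite_set] card_length])
    finally show ?thesis using t r by simp
  qed
  moreover have "F \<subseteq> E"
    using t by (intro order_trans[OF FU]) simp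
  ultimately have "F = {}" using girth by blast
  then have "incs u p = incs u p'" unfolding F_def D_def by auto
  then show ?thesis
    by (metis snd_incs)
qed

lemma closed_trail:
  assumes "p \<in> short_trails E (2 * R) u u" shows "p = []"
  using trail_unique[OF assms, of "[]" 0] by (simp add: short_trails_def)

text \<open>If \<open>x \<noteq> y\<close>, then \<open>e\<close> alone is a trail from
  \<open>x\<close> to \<open>y\<close>, and uniqueness would make it the only edge of
  \<open>p\<close>. If \<open>x = y\<close>, then \<open>p\<close> is closed.\<close>

lemma chord:
  assumes p: "p \<in> short_trails E R x y" and e: "e \<in> E" "x \<in> e" "y \<in> e" "e \<notin> edges p"
  shows "p = []"
proof (cases "x = y")
  case True
  then show ?thesis using p closed_trail[of p x] by (auto simp: short_trails_def)
next
  case False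
  have "[(e, y)] \<in> short_trails E 1 x y"
    using e False by (auto simp: short_trails_def)
  from trail_unique[OF p this] R_ge_2 have "edges p = {e}" by simp
  then show ?thesis using e(4) by auto
qed

text \<open>Take a longest trail in \<open>B\<close> through \<open>e\<close> whose ends are
  attached, that is, each lies in \<open>T\<close> or in an edge of \<open>B\<close> other than the
  end edge of the trail. An end outside \<open>T\<close> lies in such an edge \<open>e'\<close>. If
  \<open>e'\<close> is new, the trail extends through it, because the core provides a second
  attached vertex of \<open>e'\<close>; if \<open>e'\<close> is already on the trail, it is a chord
  of a part of it. Both are impossible, so the trail joins two points of \<open>T\<close>.\<close>

lemma core_subset_span:
  assumes A: "A \<subseteq> E" "no_long_trail R A" and B: "core T B" "B \<subseteq> A"
  shows "B \<subseteq> span E R T"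
proof
  fix e assume e: "e \<in> B"
  define att where "att x e' \<longleftrightarrow> x \<in> T \<or> (\<exists>e''\<in>B. e'' \<noteq> e' \<and> x \<in> e'')" for x e'
  define Q where "Q p \<longleftrightarrow> (\<exists>x y. p \<in> short_trails B R x y \<and> e \<in> edges p \<and>
     att x (fst (hd p)) \<and> att y (fst (last p)))" for p
  have two: "\<exists>a\<in>e'. \<exists>b\<in>e'. a \<noteq> b \<and> att a e' \<and> att b e'" if "e' \<in> B" for e'
  proof -
    have "att x e' \<longleftrightarrow> x \<in> T \<union> \<Union>(B - {e'})" for x unfolding att_def by auto
    then show ?thesis using B(1) that unfolding core_def by simp
  qed
  have other: "\<exists>a\<in>e'. a \<noteq> x \<and> att a e'" if "e' \<in> B" for e' x
    using two[OF that] by metis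
  obtain a b where ab: "a \<in> e" "b \<in> e" "a \<noteq> b" "att a e" "att b e" using two[OF e] by blast
  have "Q [(e, b)]"
    unfolding Q_def using ab e R_ge_2 by (intro exI[of _ a] exI[of _ b]) (auto simp: short_trails_def)
  moreover have bound: "length p \<le> R" if "Q p" for p
    using that by (auto simp: Q_def short_trails_def)
  ultimately obtain p where p: "Q p" and mx: "\<And>p'. Q p' \<Longrightarrow> length p' \<le> length p"
    using ex_has_greatest_nat[of Q "[(e, b)]" length "Suc R"] by (metis less_Suc_eq_le)
  from p obtain x y where xy: "p \<in> short_trails B R x y" "e \<in> edges p"
     "att x (fst (hd p))" "att y (fst (last p))" unfolding Q_def by blast
  have BE: "B \<subseteq> E" using A B by auto
  have ne: "p \<noteq> []" using xy by auto
  \<comment> \<open>Strictness leaves room for one more edge within the length bound in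
    \<open>Q\<close>.\<close>
  have lt: "length p < R"
    using xy(1) A(2) B(2) unfolding no_long_trail_def short_trails_def by force
  have "x \<in> T"
  proof (rule ccontr)
    assume "x \<notin> T"
    then obtain e' where e': "e' \<in> B" "e' \<noteq> fst (hd p)" "x \<in> e'" using xy(3) att_def by auto
    show False
    proof (cases "e' \<in> edges p")
      case False
      obtain w where w: "w \<in> e'" "w \<noteq> x" "att w e'" using other e'(1) by blast
      have "Q ((e', x) # p)"
        unfolding Q_def using xy e' w lt ne False
        by (intro exI[of _ w] exI[of _ y]) (auto simp: short_trails_def)
      then show False using mx[of "(e', x) # p"] by simp
    next
      case True
      then obtain p1 z p2 where sp: "p = p1 @ (e', z) # p2"
        by (metis (no_types, lifting) imageE prod.collapse split_list)
      have "p1 \<noteq> []" using e'(2) sp by auto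
      obtain a where a: "trail x p1 a" "a \<in> e'" "a \<noteq> z"
        using xy(1) unfolding sp short_trails_def by (auto simp: trail_append)
      have "p1 \<in> short_trails E R x a" "e' \<notin> edges p1"
        using xy(1) a BE unfolding sp short_trails_def by auto
      then show False using chord[of p1 x a e'] e' a BE \<open>p1 \<noteq> []\<close> by auto
    qed
  qed
  moreover have "y \<in> T"
  proof (rule ccontr)
    assume "y \<notin> T"
    then obtain e' where e': "e' \<in> B" "e' \<noteq> fst (last p)" "y \<in> e'" using xy(4) att_def by auto
    show False
    proof (cases "e' \<in> edges p")
      case False
      obtain w where w: "w \<in> e'" "w \<noteq> y" "att w e'" using other e'(1) by blast
      have "Q (p @ [(e', w)])"
        unfolding Q_def using xy e' w lt ne False
        by (intro exI[of _ x] exI[of _ w]) (auto simp: short_trails_def trail_append)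
      then show False using mx[of "p @ [(e', w)]"] by simp
    next
      case True
      then obtain p1 z p2 where sp: "p = p1 @ (e', z) # p2"
        by (metis (no_types, lifting) imageE prod.collapse split_list)
      have "p2 \<noteq> []" using e'(2) sp by auto
      have a: "trail z p2 y" "z \<in> e'"
        using xy(1) unfolding sp short_trails_def by (auto simp: trail_append)
      have "p2 \<in> short_trails E R z y" "e' \<notin> edges p2"
        using xy(1) a BE unfolding sp short_trails_def by auto
      then show False using chord[of p2 z y e'] e' a BE \<open>p2 \<noteq> []\<close> by auto
    qed
  qed
  moreover have "p \<in> short_trails E R x y"
    using xy(1) BE by (auto simp: short_trails_def)
  ultimately show "e \<in> span E R T"
    using xy(2) unfolding span_def by blast
qed

lemma span_empty: "span E R {} = {}"
  by (simp add: span_def)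

lemma span_mono: "S \<subseteq> T \<Longrightarrow> span E R S \<subseteq> span E R T"
  unfolding span_def by (intro UN_mono order_refl)

lemma span_subset: "span E R T \<subseteq> E"
  unfolding span_def by (intro UN_least) (simp add: short_trails_def)

text \<open>Two vertices of \<open>e\<close> are joined by \<open>e\<close> itself, hence by
  uniqueness through no other edge.\<close>

lemma span_edge:
  assumes "e \<in> E" shows "span E R e \<subseteq> {e}"
proof
  fix e' assume "e' \<in> span E R e"
  then obtain u v p where p: "u \<in> e" "v \<in> e" "p \<in> short_trails E R u v" "e' \<in> edges p"
    unfolding span_def by blast
  show "e' \<in> {e}"
  proof (cases "u = v")
    case True
    then show ?thesis using p closed_trail[of p u] by (auto simp: short_trails_def)
  next
    case False
    have "[(e, v)] \<in> short_trails E 1 u v"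
      using p False assms by (auto simp: short_trails_def)
    from trail_unique[OF p(3) this] R_ge_2 have "edges p = {e}" by simp
    then show ?thesis using p by auto
  qed
qed

lemma card_edges_le: "p \<in> short_trails E r u v \<Longrightarrow> card (edges p) \<le> r"
  using order_trans[OF card_image_le[of "set p" fst] card_length[of p]] by (simp add: short_trails_def)

text \<open>By uniqueness all short trails between a given pair of ends use the same set of at most
  \<open>R\<close> edges.\<close>

lemma card_span:
  assumes "finite T" shows "card (span E R T) \<le> card T ^ 2 * R"
proof -
  have *: "card (\<Union>p\<in>short_trails E R u v. edges p) \<le> R" for u v
  proof (cases "short_trails E R u v = {}")
    case False
    then obtain p where p: "p \<in> short_trails E R u v" by auto
    have "edges p' = edges p" if "p' \<in> short_trails E R u v" for p'
      using trail_unique[OF that p] by simp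
    then have "(\<Union>p\<in>short_trails E R u v. edges p) = edges p"
      using p by blast
    then show ?thesis using card_edges_le[OF p] by simp
  qed simp
  have "card (span E R T) \<le> (\<Sum>u\<in>T. \<Sum>v\<in>T. card (\<Union>p\<in>short_trails E R u v. edges p))"
    unfolding span_def
    by (rule order_trans[OF card_UN_le[OF assms]], rule sum_mono, rule card_UN_le[OF assms])
  also have "\<dots> \<le> (\<Sum>u\<in>T. \<Sum>v\<in>T. R)" by (intro sum_mono *)
  finally show ?thesis by (simp add: power2_eq_square)
qed

definition long_paths :: "'v set set \<Rightarrow> 'v set set set" where
  "long_paths H = {edges p | u v p. p \<in> short_trails H R u v \<and> length p = R}"

lemma no_long_trail_iff:
  assumes "A \<subseteq> H"
  shows "no_long_trail R A \<longleftrightarrow> (\<forall>P\<in>long_paths H. \<not> P \<subseteq> A)"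
proof
  assume A: "no_long_trail R A"
  show "\<forall>P\<in>long_paths H. \<not> P \<subseteq> A"
  proof (intro ballI notI)
    fix P assume "P \<in> long_paths H" "P \<subseteq> A"
    then obtain u v p where "P = edges p" "p \<in> short_trails H R u v" "length p = R"
      unfolding long_paths_def by blast
    then have "p \<in> short_trails A R u v"
      using \<open>P \<subseteq> A\<close> unfolding short_trails_def by simp
    then show False
      using A \<open>length p = R\<close> unfolding no_long_trail_def by simp
  qed
next
  assume A: "\<forall>P\<in>long_paths H. \<not> P \<subseteq> A"
  show "no_long_trail R A"
    unfolding no_long_trail_def
  proof (intro allI ballI notI)
    fix u v p assume p: "p \<in> short_trails A R u v" "length p = R"
    then have "p \<in> short_trails H R u v"
      using assms unfolding short_trails_def by auto
    then have "edges p \<in> long_paths H" using p unfolding long_paths_def by blast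
    moreover have "edges p \<subseteq> A" using p unfolding short_trails_def by simp
    ultimately show False using A by simp
  qed
qed

lemma long_paths_subset:
  assumes "P \<in> long_paths H" shows "P \<subseteq> H" "card P = R"
proof -
  obtain u v p where p: "P = edges p" "p \<in> short_trails H R u v" "length p = R"
    using assms unfolding long_paths_def by blast
  show "P \<subseteq> H" using p unfolding short_trails_def by simp
  have "card (set (map fst p)) = length (map fst p)"
    using p unfolding short_trails_def by (intro distinct_card) simp
  then show "card P = R" using p by simp
qed

text \<open>By uniqueness the ends of a trail of length \<open>R\<close> determine its edge set, and
  the ends are among the at most \<open>k * card H\<close> vertices covered by
  \<open>H\<close>.\<close>

lemma card_long_paths:
  assumes H: "H \<subseteq> E" and k: "\<And>e. e \<in> H \<Longrightarrow> finite e \<and> card e \<le> k"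
  shows "finite (long_paths H)" "card (long_paths H) \<le> (k * card H) ^ 2"
proof -
  have fH: "finite H" using H finite_E finite_subset by blast
  have fU: "finite (\<Union>H)" using k fH by auto
  define g where "g P = (SOME uv. \<exists>p. p \<in> short_trails H R (fst uv) (snd uv) \<and> length p = R \<and> P = edges p)" for P
  have g: "\<exists>p. p \<in> short_trails H R (fst (g P)) (snd (g P)) \<and> length p = R \<and> P = edges p"
    if "P \<in> long_paths H" for P
    unfolding g_def by (rule someI_ex) (use that in \<open>auto simp: long_paths_def\<close>)
  have inj: "inj_on g (long_paths H)"
  proof (rule inj_onI)
    fix P P' assume PP: "P \<in> long_paths H" "P' \<in> long_paths H" "g P = g P'"
    obtain p where p: "p \<in> short_trails H R (fst (g P)) (snd (g P))" "P = edges p"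
      using g[OF PP(1)] by blast
    obtain p' where p': "p' \<in> short_trails H R (fst (g P)) (snd (g P))" "P' = edges p'"
      using g[OF PP(2)] PP(3) by auto
    have sub: "short_trails H R a b \<subseteq> short_trails E R a b" for a b
      using H by (auto simp: short_trails_def)
    show "P = P'"
      using trail_unique[OF subsetD[OF sub p(1)] subsetD[OF sub p'(1)]] p(2) p'(2) by simp
  qed
  have ends: "u \<in> \<Union>H \<and> v \<in> \<Union>H" if "p \<in> short_trails H R u v" "length p = R" for u v p
  proof -
    have "p \<noteq> []" using that R_ge_2 by auto
    then obtain e w p2 where c: "p = (e, w) # p2" by (cases p) auto
    obtain p1 e' w' where s: "p = p1 @ [(e', w')]" using \<open>p \<noteq> []\<close> by (metis prod.collapse rev_exhaust)
    have "u \<in> e" "e \<in> H" using that(1) unfolding c short_trails_def by auto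
    moreover have "v \<in> e'" "e' \<in> H" using that(1) unfolding s short_trails_def by (auto simp: trail_append)
    ultimately show ?thesis by blast
  qed
  have im: "g ` long_paths H \<subseteq> \<Union>H \<times> \<Union>H"
  proof
    fix z assume "z \<in> g ` long_paths H"
    then obtain P where "P \<in> long_paths H" "z = g P" by auto
    then show "z \<in> \<Union>H \<times> \<Union>H" using g ends by (metis mem_Times_iff)
  qed
  then show "finite (long_paths H)"
    using inj fU by (metis finite_SigmaI finite_imageD finite_subset)
  have "card (long_paths H) \<le> card (\<Union>H \<times> \<Union>H)"
    using card_inj_on_le[OF inj im] fU by simp
  also have "\<dots> = card (\<Union>H) ^ 2" by (simp add: card_cartesian_product power2_eq_square)
  also have "card (\<Union>H) \<le> k * card H"
  proof -
    have "card (\<Union>H) \<le> (\<Sum>e\<in>H. card e)" using card_Union_le_sum_card by blast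
    also have "\<dots> \<le> (\<Sum>e\<in>H. k)" by (intro sum_mono) (use k in auto)
    finally show ?thesis by (simp add: mult.commute)
  qed
  finally show "card (long_paths H) \<le> (k * card H) ^ 2" by (simp add: power_mono)
qed

end

section \<open>Averaging over coordinates\<close>

lemma sum_Pow_insert:
  fixes g :: "'a set \<Rightarrow> 'b::comm_monoid_add"
  assumes "finite A" "x \<notin> A"
  shows "sum g (Pow (insert x A)) = (\<Sum>B\<in>Pow A. g B + g (insert x B))"
proof -
  have "inj_on (insert x) (Pow A)" using assms by (intro inj_onI) (auto simp: insert_ident)
  moreover have "Pow A \<inter> insert x ` Pow A = {}" using assms by auto
  ultimately show ?thesis
    using assms by (simp add: Pow_insert sum.union_disjoint sum.reindex sum.distrib)
qed

lemma sum_Sigma_Pow_insert: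
  fixes g :: "'a set \<Rightarrow> 'a set \<Rightarrow> 'b::comm_monoid_add"
  assumes "finite A" "x \<notin> A"
  shows "(\<Sum>T\<in>Pow (insert x A). \<Sum>W\<in>Pow T. g T W) =
    (\<Sum>T\<in>Pow A. \<Sum>W\<in>Pow T. g T W + (g (insert x T) W + g (insert x T) (insert x W)))"
proof -
  have "(\<Sum>W\<in>Pow (insert x T). g (insert x T) W) =
      (\<Sum>W\<in>Pow T. g (insert x T) W + g (insert x T) (insert x W))" if "T \<in> Pow A" for T
    using that assms by (intro sum_Pow_insert) (auto intro: finite_subset)
  then show ?thesis
    unfolding sum_Pow_insert[OF assms] by (intro sum.cong refl) (simp add: sum.distrib)
qed

section \<open>Functions of few coordinates and averages under a product measure\<close>

definition depends_on :: "((nat \<Rightarrow> nat) \<Rightarrow> real) \<Rightarrow> nat set \<Rightarrow> bool" where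
  "depends_on F S \<longleftrightarrow> (\<forall>\<alpha> \<alpha>'. (\<forall>i\<in>S. \<alpha> i = \<alpha>' i) \<longrightarrow> F \<alpha> = F \<alpha>')"

lemma depends_onD: "depends_on F S \<Longrightarrow> (\<And>i. i \<in> S \<Longrightarrow> \<alpha> i = \<alpha>' i) \<Longrightarrow> F \<alpha> = F \<alpha>'"
  unfolding depends_on_def by blast

lemma depends_on_mono: "depends_on F S \<Longrightarrow> S \<subseteq> S' \<Longrightarrow> depends_on F S'"
  unfolding depends_on_def by blast

lemma depends_on_prod:
  assumes "\<And>e. e \<in> A \<Longrightarrow> depends_on (F e) (g e)"
  shows "depends_on (\<lambda>\<alpha>. \<Prod>e\<in>A. F e \<alpha>) (\<Union>e\<in>A. g e)"
  unfolding depends_on_def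
proof (intro allI impI prod.cong refl)
  fix \<alpha> \<alpha>' :: "nat \<Rightarrow> nat" and e assume "\<forall>i\<in>\<Union>(g ` A). \<alpha> i = \<alpha>' i" "e \<in> A"
  then show "F e \<alpha> = F e \<alpha>'" using assms by (intro depends_onD[of "F e" "g e"]) auto
qed

lemma depends_on_sum:
  assumes "\<And>e. e \<in> A \<Longrightarrow> depends_on (F e) S"
  shows "depends_on (\<lambda>\<alpha>. \<Sum>e\<in>A. c e * F e \<alpha>) S"
  unfolding depends_on_def
proof (intro allI impI sum.cong refl)
  fix \<alpha> \<alpha>' :: "nat \<Rightarrow> nat" and e assume h: "\<forall>i\<in>S. \<alpha> i = \<alpha>' i" "e \<in> A"
  have "F e \<alpha> = F e \<alpha>'" by (rule depends_onD[OF assms[OF h(2)]]) (use h in auto)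
  then show "c e * F e \<alpha> = c e * F e \<alpha>'" by simp
qed

locale product_measure =
  fixes q :: nat and m :: "nat \<Rightarrow> nat \<Rightarrow> real"
  assumes m_pos: "b < q \<Longrightarrow> m i b > 0"
    and m_sum: "(\<Sum>b<q. m i b) = 1"
begin

text \<open>Conditional expectation given the coordinates outside \<open>U\<close>. It is again a
  function of total assignments, so averages over different sets compose and densities with
  different scopes multiply.\<close>

definition integ :: "nat set \<Rightarrow> ((nat \<Rightarrow> nat) \<Rightarrow> real) \<Rightarrow> (nat \<Rightarrow> nat) \<Rightarrow> real" where
  "integ U F \<alpha> = (\<Sum>\<beta>\<in>assigns q U. (\<Prod>i\<in>U. m i (\<beta> i)) * F (override_on \<alpha> \<beta> U))"

lemma integ_empty [simp]: "integ {} F = F"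
  by (rule ext) (simp add: integ_def)

lemma integ_insert:
  assumes "finite U" "i \<notin> U"
  shows "integ (insert i U) F \<alpha> = (\<Sum>b<q. m i b * integ U F (\<alpha>(i := b)))"
proof -
  have "integ (insert i U) F \<alpha> = (\<Sum>(b, \<beta>)\<in>{..<q} \<times> assigns q U.
     (\<Prod>j\<in>insert i U. m j ((\<beta>(i := b)) j)) * F (override_on \<alpha> (\<beta>(i := b)) (insert i U)))"
    unfolding integ_def PiE_insert_eq
    by (subst sum.reindex[OF inj_combinator[OF assms(2)]]) (simp add: case_prod_beta)
  also have "\<dots> = (\<Sum>(b, \<beta>)\<in>{..<q} \<times> assigns q U.
     m i b * ((\<Prod>j\<in>U. m j (\<beta> j)) * F (override_on (\<alpha>(i := b)) \<beta> U)))"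
  proof (intro sum.cong refl, clarify)
    fix b \<beta>
    have "override_on \<alpha> (\<beta>(i := b)) (insert i U) = override_on (\<alpha>(i := b)) \<beta> U"
      using assms(2) by (auto simp: override_on_def)
    moreover have "(\<Prod>j\<in>U. m j ((\<beta>(i := b)) j)) = (\<Prod>j\<in>U. m j (\<beta> j))"
      using assms(2) by (intro prod.cong) auto
    ultimately show "(\<Prod>j\<in>insert i U. m j ((\<beta>(i := b)) j)) * F (override_on \<alpha> (\<beta>(i := b)) (insert i U))
      = m i b * ((\<Prod>j\<in>U. m j (\<beta> j)) * F (override_on (\<alpha>(i := b)) \<beta> U))"
      using assms by simp
  qed
  finally show ?thesis
    by (simp add: sum.cartesian_product[symmetric] integ_def sum_distrib_left)
qed

lemma integ_Un:
  assumes "finite U" "finite W" "U \<inter> W = {}"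
  shows "integ (U \<union> W) F = integ U (integ W F)"
  using assms
proof (induction U)
  case (insert i U)
  then have "integ (U \<union> W) F = integ U (integ W F)" by auto
  then show ?case
    using insert by (intro ext) (simp add: integ_insert)
qed simp

lemma integ_const: "finite U \<Longrightarrow> integ U (\<lambda>_. c) = (\<lambda>_. c)"
  by (induction U rule: finite_induct)
     (auto simp: integ_insert fun_eq_iff m_sum simp flip: sum_distrib_right)

lemma depends_on_integ:
  assumes "depends_on F S" shows "depends_on (integ U F) (S - U)"
  unfolding depends_on_def integ_def
proof (intro allI impI sum.cong refl)
  fix \<alpha> \<alpha>' \<beta> :: "nat \<Rightarrow> nat" assume "\<forall>i\<in>S - U. \<alpha> i = \<alpha>' i"
  then have "F (override_on \<alpha> \<beta> U) = F (override_on \<alpha>' \<beta> U)"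
    by (intro depends_onD[OF assms]) (auto simp: override_on_def)
  then show "(\<Prod>i\<in>U. m i (\<beta> i)) * F (override_on \<alpha> \<beta> U) =
      (\<Prod>i\<in>U. m i (\<beta> i)) * F (override_on \<alpha>' \<beta> U)" by simp
qed

lemma integ_mult:
  assumes "depends_on G S" "S \<inter> U = {}"
  shows "integ U (\<lambda>\<alpha>. G \<alpha> * F \<alpha>) = (\<lambda>\<alpha>. G \<alpha> * integ U F \<alpha>)"
proof
  fix \<alpha>
  have "G (override_on \<alpha> \<beta> U) = G \<alpha>" for \<beta>
    using assms(2) by (intro depends_onD[OF assms(1)]) (auto simp: override_on_def)
  then show "integ U (\<lambda>\<alpha>. G \<alpha> * F \<alpha>) \<alpha> = G \<alpha> * integ U F \<alpha>"
    by (simp add: integ_def sum_distrib_left mult.left_commute)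
qed

lemma integ_indep:
  assumes "depends_on F S" "S \<inter> U = {}" "finite U" shows "integ U F = F"
  using integ_mult[OF assms(1,2), of "\<lambda>_. 1"] integ_const[OF assms(3), of 1] by simp

text \<open>After the inner average nothing depends on \<open>W\<close>, so averaging once more over
  \<open>U \<inter> W\<close> changes nothing.\<close>

lemma integ_integ:
  assumes "finite U" "finite W" shows "integ U (integ W F) = integ (U \<union> W) F"
proof -
  have "depends_on F UNIV" by (simp add: depends_on_def fun_eq_iff[symmetric])
  then have dep: "depends_on (integ W F) (- W)"
    using depends_on_integ[of F UNIV W] by (simp add: Compl_eq_Diff_UNIV)
  have "integ U (integ W F) = integ ((U - W) \<union> (U \<inter> W)) (integ W F)"
    by (simp add: Un_Diff_Int)
  also have "\<dots> = integ (U - W) (integ (U \<inter> W) (integ W F))"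
    using assms by (intro integ_Un) auto
  also have "integ (U \<inter> W) (integ W F) = integ W F"
    using assms by (intro integ_indep[OF dep]) auto
  also have "integ (U - W) (integ W F) = integ ((U - W) \<union> W) F"
    using assms by (intro integ_Un[symmetric]) auto
  finally show ?thesis by simp
qed

lemma integ_sum:
  "integ U (\<lambda>\<alpha>. \<Sum>x\<in>X. c x * F x \<alpha>) = (\<lambda>\<alpha>. \<Sum>x\<in>X. c x * integ U (F x) \<alpha>)"
proof
  fix \<alpha>
  have "integ U (\<lambda>\<alpha>. \<Sum>x\<in>X. c x * F x \<alpha>) \<alpha> =
     (\<Sum>\<beta>\<in>assigns q U. \<Sum>x\<in>X. c x * ((\<Prod>i\<in>U. m i (\<beta> i)) * F x (override_on \<alpha> \<beta> U)))"
    unfolding integ_def by (simp add: sum_distrib_left mult.left_commute)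
  also have "\<dots> = (\<Sum>x\<in>X. c x * integ U (F x) \<alpha>)"
    unfolding integ_def by (subst sum.swap) (simp add: sum_distrib_left)
  finally show "integ U (\<lambda>\<alpha>. \<Sum>x\<in>X. c x * F x \<alpha>) \<alpha> = (\<Sum>x\<in>X. c x * integ U (F x) \<alpha>)" .
qed

lemma integ_affine:
  assumes "finite U" shows "integ U (\<lambda>\<alpha>. a * F \<alpha> + b) = (\<lambda>\<alpha>. a * integ U F \<alpha> + b)"
proof
  fix \<alpha>
  have "integ U (\<lambda>\<alpha>. a * F \<alpha> + b) \<alpha> = a * integ U F \<alpha> + integ U (\<lambda>_. b) \<alpha>"
    unfolding integ_def by (simp add: sum.distrib sum_distrib_left ring_distribs mult.left_commute)
  then show "integ U (\<lambda>\<alpha>. a * F \<alpha> + b) \<alpha> = a * integ U F \<alpha> + b"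
    using integ_const[OF assms, of b] by simp
qed

lemma integ_diff: "integ U F \<alpha> - integ U G \<alpha> = integ U (\<lambda>\<alpha>. F \<alpha> - G \<alpha>) \<alpha>"
  unfolding integ_def by (simp add: sum_subtractf right_diff_distrib)

lemma weight_pos: "\<beta> \<in> assigns q U \<Longrightarrow> (\<Prod>i\<in>U. m i (\<beta> i)) > 0"
  by (intro prod_pos) (auto intro!: m_pos)

lemma integ_mono:
  assumes "\<And>\<alpha>'. (\<And>i. i \<in> U \<Longrightarrow> \<alpha>' i < q) \<Longrightarrow> (\<And>i. i \<notin> U \<Longrightarrow> \<alpha>' i = \<alpha> i) \<Longrightarrow> F \<alpha>' \<le> G \<alpha>'"
  shows "integ U F \<alpha> \<le> integ U G \<alpha>"
  unfolding integ_def
proof (intro sum_mono mult_left_mono)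
  fix \<beta> assume b: "\<beta> \<in> assigns q U"
  then show "F (override_on \<alpha> \<beta> U) \<le> G (override_on \<alpha> \<beta> U)"
    by (intro assms) (auto simp: override_on_def)
  show "0 \<le> (\<Prod>i\<in>U. m i (\<beta> i))" using weight_pos[OF b] by simp
qed

lemma integ_nonneg: "(\<And>\<alpha>. F \<alpha> \<ge> 0) \<Longrightarrow> integ U F \<alpha> \<ge> 0"
  unfolding integ_def by (intro sum_nonneg mult_nonneg_nonneg) (auto dest: weight_pos)

lemma integ_abs_le:
  assumes "finite U"
    and "\<And>\<alpha>'. (\<And>i. i \<in> U \<Longrightarrow> \<alpha>' i < q) \<Longrightarrow> (\<And>i. i \<notin> U \<Longrightarrow> \<alpha>' i = \<alpha> i) \<Longrightarrow> \<bar>F \<alpha>'\<bar> \<le> c"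
  shows "\<bar>integ U F \<alpha>\<bar> \<le> c"
proof -
  have "integ U F \<alpha> \<le> integ U (\<lambda>_. c) \<alpha>"
    by (rule integ_mono) (use assms(2) abs_le_D1 in blast)
  moreover have "integ U (\<lambda>_. - c) \<alpha> \<le> integ U F \<alpha>"
  proof (rule integ_mono)
    fix \<alpha>' assume "\<And>i. i \<in> U \<Longrightarrow> \<alpha>' i < q" "\<And>i. i \<notin> U \<Longrightarrow> \<alpha>' i = \<alpha> i"
    from assms(2)[OF this] show "- c \<le> F \<alpha>'" by linarith
  qed
  ultimately show ?thesis using assms(1) by (simp add: integ_const abs_le_iff)
qed

lemma point_le_integ:
  assumes "finite U" "\<And>\<alpha>. F \<alpha> \<ge> 0" "\<And>i. i \<in> U \<Longrightarrow> \<alpha> i < q"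
  shows "(\<Prod>i\<in>U. m i (\<alpha> i)) * F \<alpha> \<le> integ U F \<alpha>"
proof -
  have r: "restrict \<alpha> U \<in> assigns q U" using assms(3) by auto
  have o: "override_on \<alpha> (restrict \<alpha> U) U = \<alpha>" by (auto simp: override_on_def)
  have "(\<Prod>i\<in>U. m i (restrict \<alpha> U i)) * F (override_on \<alpha> (restrict \<alpha> U) U) \<le> integ U F \<alpha>"
    unfolding integ_def
    by (rule member_le_sum[OF r, of "\<lambda>\<beta>. (\<Prod>i\<in>U. m i (\<beta> i)) * F (override_on \<alpha> \<beta> U)"])
       (use assms weight_pos in \<open>auto intro!: mult_nonneg_nonneg finite_PiE intro: less_imp_le\<close>)
  then show ?thesis unfolding o by simp
qed

text \<open>The bridge to Sherali-Adams constraints: if LP variables are weight times density, their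
  sum over extensions is the weight times an average of the density.\<close>

lemma sum_extensions:
  assumes TS: "T \<subseteq> S" "finite S" and \<beta>: "\<beta> \<in> assigns q T"
  shows "(\<Sum>\<alpha> | \<alpha> \<in> assigns q S \<and> restrict \<alpha> T = \<beta>. (\<Prod>i\<in>S. m i (\<alpha> i)) * F \<alpha>) =
    (\<Prod>i\<in>T. m i (\<beta> i)) * integ (S - T) F \<beta>"
proof -
  have "(\<Sum>\<alpha> | \<alpha> \<in> assigns q S \<and> restrict \<alpha> T = \<beta>. (\<Prod>i\<in>S. m i (\<alpha> i)) * F \<alpha>) =
     (\<Sum>\<gamma>\<in>assigns q (S - T). (\<Prod>i\<in>T. m i (\<beta> i)) *
        ((\<Prod>i\<in>S - T. m i (\<gamma> i)) * F (override_on \<beta> \<gamma> (S - T))))"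
  proof (rule sum.reindex_bij_witness[where i = "\<lambda>\<gamma>. override_on \<beta> \<gamma> (S - T)" and j = "\<lambda>\<alpha>. restrict \<alpha> (S - T)"])
    fix \<alpha> assume "\<alpha> \<in> {\<alpha> \<in> assigns q S. restrict \<alpha> T = \<beta>}"
    then have \<alpha>: "\<alpha> \<in> assigns q S" "\<beta> = restrict \<alpha> T" by auto
    show "override_on \<beta> (restrict \<alpha> (S - T)) (S - T) = \<alpha>"
      using \<alpha> TS PiE_arb[OF \<alpha>(1)] by (auto simp: override_on_def fun_eq_iff)
    then show "(\<Prod>i\<in>T. m i (\<beta> i)) * ((\<Prod>i\<in>S - T. m i (restrict \<alpha> (S - T) i)) *
        F (override_on \<beta> (restrict \<alpha> (S - T)) (S - T))) = (\<Prod>i\<in>S. m i (\<alpha> i)) * F \<alpha>"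
      using TS \<alpha>(2) by (simp add: prod.subset_diff[of T S] mult.commute mult.left_commute)
    show "restrict \<alpha> (S - T) \<in> assigns q (S - T)" using \<alpha> by auto
  next
    fix \<gamma> assume \<gamma>: "\<gamma> \<in> assigns q (S - T)"
    show "restrict (override_on \<beta> \<gamma> (S - T)) (S - T) = \<gamma>"
      using PiE_arb[OF \<gamma>] by (auto simp: override_on_def fun_eq_iff)
    show "override_on \<beta> \<gamma> (S - T) \<in> {\<alpha> \<in> assigns q S. restrict \<alpha> T = \<beta>}"
      using \<gamma> \<beta> TS PiE_arb[OF \<beta>]
      by (auto simp: override_on_def fun_eq_iff PiE_iff extensional_def)
  qed
  then show ?thesis by (simp add: integ_def sum_distrib_left)
qed

section \<open>Efron-Stein components and exact consistency\<close>

text \<open>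
  The Efron-Stein component of \<open>D T\<close> that is orthogonal to everything depending on fewer coordinates.
\<close>

definition comp :: "(nat set \<Rightarrow> (nat \<Rightarrow> nat) \<Rightarrow> real) \<Rightarrow> nat set \<Rightarrow> (nat \<Rightarrow> nat) \<Rightarrow> real" where
  "comp D T \<alpha> = (\<Sum>W\<in>Pow T. (-1) ^ card W * integ W (D T) \<alpha>)"

text \<open>In the Efron-Stein expansion of \<open>D S\<close> the component at \<open>T\<close>
  comes from the marginal of \<open>D S\<close> on \<open>T\<close>. Here it comes from
  \<open>D T\<close>, hence does not depend on \<open>S\<close>.\<close>

definition correction :: "(nat set \<Rightarrow> (nat \<Rightarrow> nat) \<Rightarrow> real) \<Rightarrow> nat set \<Rightarrow> (nat \<Rightarrow> nat) \<Rightarrow> real" where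
  "correction D S \<alpha> = (\<Sum>T\<in>Pow S. comp D T \<alpha>)"

text \<open>Once \<open>i\<close> is averaged out, \<open>W\<close> and \<open>insert i W\<close>
  give the same average, with opposite signs.\<close>

lemma integ_comp_mem:
  assumes "finite T" "i \<in> T" shows "integ {i} (comp D T) \<alpha> = 0"
proof -
  obtain T' where T': "T = insert i T'" "i \<notin> T'" using assms(2) by (meson Set.set_insert)
  then have fin: "finite T'" using assms(1) by simp
  have sub: "finite W" "i \<notin> W" if "W \<in> Pow T'" for W
    using that fin T' finite_subset by auto
  have "integ {i} (comp D T) \<alpha> = (\<Sum>W\<in>Pow T. (-1) ^ card W * integ (insert i W) (D T) \<alpha>)"
  proof -
    have "integ {i} (integ W (D T)) = integ (insert i W) (D T)" if "W \<in> Pow T" for W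
      using that assms(1) finite_subset by (subst integ_integ) auto
    moreover have "integ {i} (comp D T) = integ {i} (\<lambda>\<alpha>. \<Sum>W\<in>Pow T. (-1) ^ card W * integ W (D T) \<alpha>)"
      by (simp add: comp_def[abs_def])
    ultimately show ?thesis by (simp add: integ_sum)
  qed
  also have "\<dots> = 0"
    unfolding T'(1) sum_Pow_insert[OF fin T'(2)] by (intro sum.neutral ballI) (simp add: sub)
  finally show ?thesis .
qed

lemma depends_on_comp:
  assumes "depends_on (D T) T" shows "depends_on (comp D T) T"
  unfolding comp_def[abs_def]
  by (intro depends_on_sum depends_on_mono[OF depends_on_integ[OF assms]]) auto

text \<open>Averaging over \<open>i\<close> annihilates the components whose set contains
  \<open>i\<close> and fixes all others.\<close>

lemma integ_correction_insert:
  assumes D: "\<And>T. T \<subseteq> insert i S \<Longrightarrow> depends_on (D T) T" and S: "finite S" "i \<notin> S"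
  shows "integ {i} (correction D (insert i S)) = correction D S"
proof
  fix \<alpha>
  have "integ {i} (correction D (insert i S)) \<alpha> = (\<Sum>T\<in>Pow (insert i S). integ {i} (comp D T) \<alpha>)"
    using integ_sum[of "{i}" "\<lambda>_. 1" "comp D" "Pow (insert i S)"]
    by (simp add: correction_def[abs_def])
  also have "\<dots> = (\<Sum>T\<in>Pow S. integ {i} (comp D T) \<alpha> + integ {i} (comp D (insert i T)) \<alpha>)"
    using S by (rule sum_Pow_insert)
  also have "\<dots> = (\<Sum>T\<in>Pow S. comp D T \<alpha>)"
  proof (intro sum.cong refl)
    fix T assume T: "T \<in> Pow S"
    then have "integ {i} (comp D T) = comp D T"
      using S by (intro integ_indep[OF depends_on_comp[of D T]] D) auto
    moreover have "integ {i} (comp D (insert i T)) \<alpha> = 0"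
      using T S finite_subset by (intro integ_comp_mem) auto
    ultimately show "integ {i} (comp D T) \<alpha> + integ {i} (comp D (insert i T)) \<alpha> = comp D T \<alpha>"
      by simp
  qed
  finally show "integ {i} (correction D (insert i S)) \<alpha> = correction D S \<alpha>"
    by (simp add: correction_def)
qed

lemma integ_correction:
  assumes "finite U" "finite S" "S \<inter> U = {}" "\<And>T. T \<subseteq> S \<union> U \<Longrightarrow> depends_on (D T) T"
  shows "integ U (correction D (S \<union> U)) = correction D S"
  using assms
proof (induction U)
  case (insert i U)
  have "integ (insert i U) (correction D (S \<union> insert i U)) =
      integ (U \<union> {i}) (correction D (insert i (S \<union> U)))" by simp
  also have "\<dots> = integ U (integ {i} (correction D (insert i (S \<union> U))))"
    using insert by (intro integ_Un) auto
  also have "integ {i} (correction D (insert i (S \<union> U))) = correction D (S \<union> U)"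
    using insert by (intro integ_correction_insert) auto
  also have "integ U \<dots> = correction D S"
    using insert by auto
  finally show ?case .
qed simp

text \<open>The expansion of \<open>\<Prod>\<^bsub>i\<in>S\<^esub> ((1 - I\<^sub>i) + I\<^sub>i) = 1\<close>, where \<open>I\<^sub>i\<close> averages over coordinate \<open>i\<close>.\<close>

lemma efron_stein:
  assumes "finite S"
  shows "(\<Sum>T\<in>Pow S. \<Sum>W\<in>Pow T. (-1) ^ card W * integ (W \<union> (S - T)) F \<alpha>) = F \<alpha>"
  using assms
proof (induction S)
  case (insert i S)
  have "(\<Sum>T\<in>Pow (insert i S). \<Sum>W\<in>Pow T. (-1) ^ card W * integ (W \<union> (insert i S - T)) F \<alpha>) =
    (\<Sum>T\<in>Pow S. \<Sum>W\<in>Pow T. (-1) ^ card W * integ (W \<union> (insert i S - T)) F \<alpha> +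
      ((-1) ^ card W * integ (W \<union> (insert i S - insert i T)) F \<alpha> +
       (-1) ^ card (insert i W) * integ (insert i W \<union> (insert i S - insert i T)) F \<alpha>))"
    using insert(1,2) by (rule sum_Sigma_Pow_insert)
  also have "\<dots> = (\<Sum>T\<in>Pow S. \<Sum>W\<in>Pow T. (-1) ^ card W * integ (W \<union> (S - T)) F \<alpha>)"
  proof (intro sum.cong refl)
    fix T W assume TW: "T \<in> Pow S" "W \<in> Pow T"
    then have iT: "i \<notin> T" "i \<notin> W" "finite W"
      using insert(1,2) by (auto intro: finite_subset)
    have "insert i S - T = insert i (S - T)" "insert i S - insert i T = S - T"
      using iT insert(2) by auto
    then show "(-1) ^ card W * integ (W \<union> (insert i S - T)) F \<alpha> +
      ((-1) ^ card W * integ (W \<union> (insert i S - insert i T)) F \<alpha> +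
       (-1) ^ card (insert i W) * integ (insert i W \<union> (insert i S - insert i T)) F \<alpha>) =
       (-1) ^ card W * integ (W \<union> (S - T)) F \<alpha>"
      using iT by simp
  qed
  finally show ?case using insert by simp
qed simp

text \<open>Expand \<open>D S\<close> by \<open>efron_stein\<close> and compare term by term: each
  pair \<open>W \<subseteq> T \<subseteq> S\<close> costs at most \<open>\<eta>\<close>. There are
  \<open>3 ^ card S\<close> such pairs; the cruder \<open>4 ^ card S\<close> suffices.\<close>

lemma correction_approx:
  assumes S: "finite S"
    and D: "\<And>T \<alpha>. T \<subseteq> S \<Longrightarrow> (\<And>i. i \<in> T \<Longrightarrow> \<alpha> i < q) \<Longrightarrow> \<bar>D T \<alpha> - integ (S - T) (D S) \<alpha>\<bar> \<le> \<eta>"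
    and \<alpha>: "\<And>i. i \<in> S \<Longrightarrow> \<alpha> i < q"
  shows "\<bar>correction D S \<alpha> - D S \<alpha>\<bar> \<le> 4 ^ card S * \<eta>"
proof -
  have \<eta>: "\<eta> \<ge> 0" using D[of S \<alpha>] \<alpha> by fastforce
  have summand: "\<bar>(-1) ^ card W * integ W (D T) \<alpha> - (-1) ^ card W * integ (W \<union> (S - T)) (D S) \<alpha>\<bar> \<le> \<eta>"
    if TW: "T \<in> Pow S" "W \<in> Pow T" for T W
  proof -
    have fin: "finite W" "finite (S - T)" using TW S by (auto intro: finite_subset)
    have "(-1) ^ card W * integ W (D T) \<alpha> - (-1) ^ card W * integ (W \<union> (S - T)) (D S) \<alpha> =
        (-1) ^ card W * integ W (\<lambda>\<alpha>. D T \<alpha> - integ (S - T) (D S) \<alpha>) \<alpha>"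
      by (simp add: integ_integ[OF fin, symmetric] integ_diff[symmetric] right_diff_distrib)
    moreover have "\<bar>integ W (\<lambda>\<alpha>. D T \<alpha> - integ (S - T) (D S) \<alpha>) \<alpha>\<bar> \<le> \<eta>"
      using TW \<alpha> by (intro integ_abs_le fin D) (auto, metis subsetD)
    ultimately show ?thesis by (simp add: abs_mult power_abs)
  qed
  have "correction D S \<alpha> - D S \<alpha> = (\<Sum>T\<in>Pow S. \<Sum>W\<in>Pow T.
      (-1) ^ card W * integ W (D T) \<alpha> - (-1) ^ card W * integ (W \<union> (S - T)) (D S) \<alpha>)"
    unfolding correction_def comp_def sum_subtractf efron_stein[OF S] ..
  also have "\<bar>\<dots>\<bar> \<le> (\<Sum>T\<in>Pow S. \<Sum>W\<in>Pow T. \<eta>)"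
    by (intro order_trans[OF sum_abs] sum_mono order_trans[OF sum_abs[of _ "Pow _"]] summand)
  also have "\<dots> \<le> (\<Sum>T\<in>Pow S. 2 ^ card S * \<eta>)"
  proof (rule sum_mono)
    fix T assume T: "T \<in> Pow S"
    then have "finite T" "card T \<le> card S" using S by (auto intro: finite_subset card_mono)
    then show "(\<Sum>W\<in>Pow T. \<eta>) \<le> 2 ^ card S * \<eta>"
      using \<eta> by (auto simp: card_Pow intro!: mult_right_mono power_increasing)
  qed
  also have "\<dots> = 4 ^ card S * \<eta>"
    using S by (simp add: card_Pow power_mult_distrib[symmetric])
  finally show ?thesis .
qed

end

section \<open>Percolation\<close>

definition perc_weight :: "real \<Rightarrow> 'a set \<Rightarrow> 'a set \<Rightarrow> real" where
  "perc_weight \<epsilon> H A = (1 - \<epsilon>) ^ card A * \<epsilon> ^ card (H - A)"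

lemma perc_weight_nonneg: "0 \<le> \<epsilon> \<Longrightarrow> \<epsilon> \<le> 1 \<Longrightarrow> perc_weight \<epsilon> H A \<ge> 0"
  by (simp add: perc_weight_def)

text \<open>Elements outside \<open>K\<close> are summed out one at a time, the two outcomes of each
  having total weight \<open>(1 - \<epsilon>) + \<epsilon> = 1\<close>. This couples percolations on
  nested sets.\<close>

lemma perc_marginal:
  assumes "finite H" "K \<subseteq> H"
  shows "(\<Sum>A\<in>Pow H. perc_weight \<epsilon> H A * G (A \<inter> K)) = (\<Sum>A\<in>Pow K. perc_weight \<epsilon> K A * G A)"
proof -
  have fK: "finite K" using assms finite_subset by blast
  have "(\<Sum>A\<in>Pow (K \<union> L). perc_weight \<epsilon> (K \<union> L) A * G (A \<inter> K)) = (\<Sum>A\<in>Pow K. perc_weight \<epsilon> K A * G A)"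
    if "finite L" "K \<inter> L = {}" for L
    using that
  proof (induction L)
    case empty
    show ?case by (intro sum.cong) (auto simp: Int_absorb2)
  next
    case (insert x L)
    then have fin: "finite (K \<union> L)" "x \<notin> K \<union> L" using fK by auto
    have "(\<Sum>A\<in>Pow (K \<union> insert x L). perc_weight \<epsilon> (K \<union> insert x L) A * G (A \<inter> K)) =
       (\<Sum>A\<in>Pow (K \<union> L). perc_weight \<epsilon> (insert x (K \<union> L)) A * G (A \<inter> K) +
          perc_weight \<epsilon> (insert x (K \<union> L)) (insert x A) * G (insert x A \<inter> K))"
      using sum_Pow_insert[OF fin, of "\<lambda>A. perc_weight \<epsilon> (insert x (K \<union> L)) A * G (A \<inter> K)"]
      by simp
    also have "\<dots> = (\<Sum>A\<in>Pow (K \<union> L). perc_weight \<epsilon> (K \<union> L) A * G (A \<inter> K))"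
    proof (intro sum.cong refl)
      fix A assume A: "A \<in> Pow (K \<union> L)"
      then have x: "x \<notin> A" "finite A" using fin finite_subset by auto
      have "insert x (K \<union> L) - A = insert x (K \<union> L - A)"
        "insert x (K \<union> L) - insert x A = K \<union> L - A" "insert x A \<inter> K = A \<inter> K"
        using x fin by auto
      then show "perc_weight \<epsilon> (insert x (K \<union> L)) A * G (A \<inter> K) +
          perc_weight \<epsilon> (insert x (K \<union> L)) (insert x A) * G (insert x A \<inter> K) =
          perc_weight \<epsilon> (K \<union> L) A * G (A \<inter> K)"
        using x fin by (simp add: perc_weight_def algebra_simps)
    qed
    finally show ?case using insert by simp
  qed
  from this[of "H - K"] show ?thesis
    using assms by (simp add: Un_absorb1)
qed

lemma perc_superset:
  assumes "finite H" "P \<subseteq> H"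
  shows "(\<Sum>A\<in>{A\<in>Pow H. P \<subseteq> A}. perc_weight \<epsilon> H A) = (1 - \<epsilon>) ^ card P"
proof -
  have fP: "finite P" using assms finite_subset by blast
  have "(\<Sum>A\<in>{A\<in>Pow H. P \<subseteq> A}. perc_weight \<epsilon> H A) =
      (\<Sum>A\<in>Pow H. perc_weight \<epsilon> H A * of_bool (A \<inter> P = P))"
    using assms(1) by (intro sum.mono_neutral_cong_left) auto
  also have "\<dots> = (\<Sum>A\<in>Pow P. perc_weight \<epsilon> P A * of_bool (A = P))"
    using assms by (rule perc_marginal)
  also have "\<dots> = (\<Sum>A\<in>{P}. perc_weight \<epsilon> P A)"
    using fP by (intro sum.mono_neutral_cong_right) auto
  finally show ?thesis by (simp add: perc_weight_def)
qed

text \<open>\<open>\<rho> e\<close> is the density of the local distribution on \<open>e\<close>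
  against the product of the \<open>m i\<close>. The marginal assumption says that all local
  distributions have the \<open>m i\<close> as one-variable marginals, which is what allows gluing
  at a single shared variable. \<open>M\<close> bounds the reciprocals of the point weights and
  thereby densities at points.\<close>

locale csp_densities = product_measure q m + high_girth E R
  for q m and E :: "nat set set" and R +
  fixes V :: "nat set" and \<rho> :: "nat set \<Rightarrow> (nat \<Rightarrow> nat) \<Rightarrow> real" and k :: nat and \<epsilon> M :: real
  assumes finite_V: "finite V"
    and E_sub: "e \<in> E \<Longrightarrow> e \<subseteq> V" and E_ne: "e \<in> E \<Longrightarrow> e \<noteq> {}" and E_card: "e \<in> E \<Longrightarrow> card e \<le> k"
    and \<rho>_nonneg: "e \<in> E \<Longrightarrow> \<rho> e \<alpha> \<ge> 0"
    and \<rho>_depends: "e \<in> E \<Longrightarrow> depends_on (\<rho> e) e"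
    and \<rho>_marginal: "e \<in> E \<Longrightarrow> i \<in> e \<Longrightarrow> integ (e - {i}) (\<rho> e) = (\<lambda>_. 1)"
    and \<epsilon>: "0 < \<epsilon>" "\<epsilon> < 1"
    and M: "b < q \<Longrightarrow> 1 \<le> M * m i b" and M_ge_1: "1 \<le> M"
begin

definition density :: "nat set set \<Rightarrow> (nat \<Rightarrow> nat) \<Rightarrow> real" where
  "density A \<alpha> = (\<Prod>e\<in>A. \<rho> e \<alpha>)"

lemma finite_edge: "e \<in> E \<Longrightarrow> finite e"
  using E_sub finite_V finite_subset by blast

lemma finite_sub_E: "A \<subseteq> E \<Longrightarrow> finite A"
  using finite_E finite_subset by blast

lemma density_nonneg: "A \<subseteq> E \<Longrightarrow> density A \<alpha> \<ge> 0"
  unfolding density_def by (intro prod_nonneg) (auto intro: \<rho>_nonneg)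

lemma depends_on_density: "A \<subseteq> E \<Longrightarrow> depends_on (density A) (\<Union>A)"
  using depends_on_prod[of A \<rho> "\<lambda>e. e"] \<rho>_depends by (auto simp: density_def[abs_def])

text \<open>A leaf shares at most one vertex with \<open>T\<close> and the other edges. Averaging
  over its remaining vertices touches no other factor and turns \<open>\<rho> e\<close> into
  1.\<close>

lemma integ_density_remove:
  assumes A: "A \<subseteq> E" "e \<in> A" and T: "T \<subseteq> V"
    and leaf: "\<not> (\<exists>a\<in>e. \<exists>b\<in>e. a \<noteq> b \<and> a \<in> T \<union> \<Union>(A - {e}) \<and> b \<in> T \<union> \<Union>(A - {e}))"
  shows "integ (V - T) (density A) = integ (V - T) (density (A - {e}))"
proof -
  define W where "W = e - (T \<union> \<Union>(A - {e}))"
  have e: "e \<in> E" using A by blast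
  note e = e finite_edge[OF e] E_ne[OF e] E_sub[OF e]
  \<comment> \<open>\<open>i\<close> is the shared vertex if there is one and arbitrary
    otherwise.\<close>
  obtain i where i: "i \<in> e" "e - {i} \<subseteq> W"
  proof (cases "e \<inter> (T \<union> \<Union>(A - {e})) = {}")
    case True
    then show ?thesis using that e(3) unfolding W_def by blast
  next
    case False
    then obtain a where "a \<in> e" "a \<in> T \<union> \<Union>(A - {e})" by blast
    then show ?thesis using that[of a] leaf unfolding W_def by blast
  qed
  have fW: "finite W" "W \<subseteq> V - T" using e unfolding W_def by auto
  have "integ W (\<rho> e) = integ (W \<union> (e - {i})) (\<rho> e)"
    using i(2) by (simp add: Un_absorb2)
  also have "\<dots> = integ W (integ (e - {i}) (\<rho> e))"
    using fW e by (intro integ_integ[symmetric]) auto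
  also have "\<dots> = (\<lambda>_. 1)"
    using e i fW by (simp add: \<rho>_marginal integ_const)
  finally have one: "integ W (\<rho> e) = (\<lambda>_. 1)" .
  have "density A = (\<lambda>\<alpha>. density (A - {e}) \<alpha> * \<rho> e \<alpha>)"
    using A finite_sub_E by (auto simp: density_def fun_eq_iff prod.remove[of A e] mult.commute)
  moreover have "\<Union>(A - {e}) \<inter> W = {}" unfolding W_def by blast
  ultimately have "integ W (density A) = density (A - {e})"
    using A by (simp add: integ_mult[OF depends_on_density[of "A - {e}"]] one)
      (subst integ_mult[OF depends_on_density[of "A - {e}"]], auto simp: one)
  then have "integ (V - T) (density (A - {e})) = integ (V - T) (integ W (density A))" by simp
  also have "\<dots> = integ (V - T) (density A)"
    using fW finite_V by (simp add: integ_integ Un_absorb2)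
  finally show ?thesis by simp
qed

text \<open>Leaves of \<open>A\<close> are removed from both sets until \<open>A\<close> is a
  \<open>T\<close>-core; what remains of \<open>A\<close> then lies in what remains of
  \<open>K\<close>, so the two are equal.\<close>

lemma integ_density_prune:
  assumes "A \<subseteq> E" "K \<subseteq> A" "T \<subseteq> V" "\<And>B. core T B \<Longrightarrow> B \<subseteq> A \<Longrightarrow> B \<subseteq> K"
  shows "integ (V - T) (density A) = integ (V - T) (density K)"
proof -
  have "finite A" using assms(1) finite_sub_E by blast
  then show ?thesis using assms
  proof (induction "card A" arbitrary: A K rule: less_induct)
    case less
    show ?case
    proof (cases "core T A")
      case True
      then show ?thesis using less.prems by (metis subset_antisym order_refl)
    next
      case False
      then obtain e where e: "e \<in> A"
        "\<not> (\<exists>a\<in>e. \<exists>b\<in>e. a \<noteq> b \<and> a \<in> T \<union> \<Union>(A - {e}) \<and> b \<in> T \<union> \<Union>(A - {e}))"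
        unfolding core_def by blast
      have "integ (V - T) (density A) = integ (V - T) (density (A - {e}))"
        using less.prems e by (intro integ_density_remove) auto
      also have "\<dots> = integ (V - T) (density (K - {e}))"
      proof (rule less.hyps)
        show "card (A - {e}) < card A" using e(1) less.prems(1) by (intro card_Diff1_less)
        fix B assume "core T B" "B \<subseteq> A - {e}"
        then show "B \<subseteq> K - {e}" using less.prems(5)[of B] by blast
      qed (use less.prems in auto)
      \<comment> \<open>A leaf of \<open>A\<close> that belongs to the smaller set \<open>K\<close>
        is also a leaf there.\<close>
      also have "\<dots> = integ (V - T) (density K)"
      proof (cases "e \<in> K")
        case True
        have "T \<union> \<Union>(K - {e}) \<subseteq> T \<union> \<Union>(A - {e})" using less.prems(3) by blast
        then have leaf: "\<not> (\<exists>a\<in>e. \<exists>b\<in>e. a \<noteq> b \<and> a \<in> T \<union> \<Union>(K - {e}) \<and> b \<in> T \<union> \<Union>(K - {e}))"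
          using e(2) by (meson subsetD)
        have "K \<subseteq> E" using less.prems by simp
        then show ?thesis
          using integ_density_remove[OF _ True less.prems(4) leaf] by simp
      qed simp
      finally show ?thesis .
    qed
  qed
qed

text \<open>Outcomes with a long trail are dropped and not conditioned away. The total mass may fall
  below 1; the later correction absorbs this.\<close>

definition local_density :: "nat set \<Rightarrow> (nat \<Rightarrow> nat) \<Rightarrow> real" where
  "local_density T \<alpha> = (\<Sum>A\<in>Pow (span E R T).
     perc_weight \<epsilon> (span E R T) A * of_bool (no_long_trail R A) * integ (V - T) (density A) \<alpha>)"

lemma no_long_trail_mono: "no_long_trail R A \<Longrightarrow> B \<subseteq> A \<Longrightarrow> no_long_trail R B"
  unfolding no_long_trail_def short_trails_def by (metis (no_types, lifting) mem_Collect_eq order_trans)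

lemma no_long_trail_small:
  fixes A :: "nat set set"
  assumes "card A < R" "finite A" shows "no_long_trail R A"
  unfolding no_long_trail_iff[OF order_refl]
proof (intro ballI notI)
  fix P assume "P \<in> long_paths A" "P \<subseteq> A"
  then show False using long_paths_subset(2)[of P A] card_mono[of A P] assms by simp
qed

text \<open>Without long trails every \<open>T\<close>-core inside \<open>A\<close> lies in the span
  of \<open>T\<close>, so pruning leaves only the edges there to influence the marginal on
  \<open>T\<close>.\<close>

lemma integ_density_span:
  assumes A: "A \<subseteq> E" "no_long_trail R A" and T: "T \<subseteq> V"
  shows "integ (V - T) (density A) = integ (V - T) (density (A \<inter> span E R T))"
  using A T by (intro integ_density_prune) (auto dest: core_subset_span)

lemma depends_on_local_density:
  assumes "T \<subseteq> V" shows "depends_on (local_density T) T"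
  unfolding local_density_def[abs_def]
proof (rule depends_on_sum)
  fix A assume "A \<in> Pow (span E R T)"
  then have "A \<subseteq> E" using span_subset by blast
  then have "depends_on (density A) V"
    using E_sub by (intro depends_on_mono[OF depends_on_density]) auto
  then have "depends_on (integ (V - T) (density A)) (V - (V - T))" by (rule depends_on_integ)
  then show "depends_on (integ (V - T) (density A)) T" using assms by (simp add: double_diff)
qed

text \<open>The span of the empty set is empty, so the total mass is that of the empty product,
  namely 1. A single point therefore has probability at most 1; dividing by its weight gives the
  bound.\<close>

lemma integ_density_bound:
  assumes A: "A \<subseteq> E" "no_long_trail R A" and T: "T \<subseteq> V" "\<And>i. i \<in> T \<Longrightarrow> \<alpha> i < q"
  shows "integ (V - T) (density A) \<alpha> \<le> M ^ card T"
proof -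
  let ?F = "integ (V - T) (density A)"
  have fT: "finite T" using T finite_V finite_subset by blast
  have "integ T ?F = integ (V - {}) (density A)"
    using T fT finite_V by (simp add: integ_integ Un_absorb1)
  also have "\<dots> = integ (V - {}) (density {})"
    using integ_density_span[OF A, of "{}"] by (simp add: span_empty)
  also have "\<dots> = (\<lambda>_. 1)" using finite_V by (simp add: density_def[abs_def] integ_const)
  finally have one: "integ T ?F \<alpha> = 1" by simp
  have nn: "?F \<alpha> \<ge> 0" for \<alpha> using A by (intro integ_nonneg density_nonneg)
  have "(\<Prod>i\<in>T. m i (\<alpha> i)) * ?F \<alpha> \<le> 1"
    using point_le_integ[of T ?F \<alpha>, OF fT nn T(2)] one by simp
  then have "M ^ card T * ((\<Prod>i\<in>T. m i (\<alpha> i)) * ?F \<alpha>) \<le> M ^ card T"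
    using M_ge_1 by (intro mult_left_le) auto
  moreover have "1 * ?F \<alpha> \<le> (M ^ card T * (\<Prod>i\<in>T. m i (\<alpha> i))) * ?F \<alpha>"
  proof (intro mult_right_mono nn)
    have "1 \<le> (\<Prod>i\<in>T. M * m i (\<alpha> i))" using M T(2) by (intro prod_ge_1) auto
    then show "1 \<le> M ^ card T * (\<Prod>i\<in>T. m i (\<alpha> i))" by (simp add: prod.distrib)
  qed
  ultimately show ?thesis by (simp add: mult.assoc)
qed

text \<open>Union bound over the edge sets of trails of length \<open>R\<close>, each surviving with
  probability \<open>(1 - \<epsilon>) ^ R\<close>.\<close>

lemma perc_long_trail:
  assumes H: "H \<subseteq> E"
  shows "(\<Sum>A\<in>Pow H. perc_weight \<epsilon> H A * of_bool (\<not> no_long_trail R A)) \<le>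
    (real k * real (card H)) ^ 2 * (1 - \<epsilon>) ^ R"
proof -
  have fH: "finite H" using H finite_sub_E by blast
  have lp: "finite (long_paths H)" "card (long_paths H) \<le> (k * card H) ^ 2"
    using card_long_paths[OF H, of k] H E_card finite_edge by (meson subsetD)+
  have w: "perc_weight \<epsilon> H A \<ge> 0" for A using \<epsilon> by (simp add: perc_weight_nonneg)
  have "(\<Sum>A\<in>Pow H. perc_weight \<epsilon> H A * of_bool (\<not> no_long_trail R A)) \<le>
      (\<Sum>A\<in>Pow H. \<Sum>P\<in>long_paths H. perc_weight \<epsilon> H A * of_bool (P \<subseteq> A))"
  proof (rule sum_mono)
    fix A assume "A \<in> Pow H"
    then have iff: "no_long_trail R A \<longleftrightarrow> (\<forall>P\<in>long_paths H. \<not> P \<subseteq> A)"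
      by (intro no_long_trail_iff) auto
    show "perc_weight \<epsilon> H A * of_bool (\<not> no_long_trail R A) \<le>
        (\<Sum>P\<in>long_paths H. perc_weight \<epsilon> H A * of_bool (P \<subseteq> A))"
    proof (cases "no_long_trail R A")
      case True
      then show ?thesis by (auto intro!: sum_nonneg w)
    next
      case False
      then obtain P where P: "P \<in> long_paths H" "P \<subseteq> A" using iff by blast
      have "perc_weight \<epsilon> H A * of_bool (P \<subseteq> A) \<le>
          (\<Sum>P\<in>long_paths H. perc_weight \<epsilon> H A * of_bool (P \<subseteq> A))"
        by (rule member_le_sum[OF P(1)]) (use w lp in auto)
      then show ?thesis using P False by simp
    qed
  qed
  also have "\<dots> = (\<Sum>P\<in>long_paths H. \<Sum>A\<in>Pow H. perc_weight \<epsilon> H A * of_bool (P \<subseteq> A))"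
    by (rule sum.swap)
  also have "\<dots> = (\<Sum>P\<in>long_paths H. (1 - \<epsilon>) ^ R)"
  proof (rule sum.cong[OF refl])
    fix P assume P: "P \<in> long_paths H"
    have "(\<Sum>A\<in>Pow H. perc_weight \<epsilon> H A * of_bool (P \<subseteq> A)) =
        (\<Sum>A\<in>{A\<in>Pow H. P \<subseteq> A}. perc_weight \<epsilon> H A)"
      using fH by (intro sum.mono_neutral_cong_right) auto
    then show "(\<Sum>A\<in>Pow H. perc_weight \<epsilon> H A * of_bool (P \<subseteq> A)) = (1 - \<epsilon>) ^ R"
      using perc_superset[OF fH long_paths_subset(1)[OF P], of \<epsilon>] long_paths_subset(2)[OF P] by simp
  qed
  also have "\<dots> \<le> real ((k * card H) ^ 2) * (1 - \<epsilon>) ^ R"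
    using \<epsilon> lp(2) by (simp del: of_nat_power add: mult_right_mono)
  finally show ?thesis by simp
qed

text \<open>Both sides are read on one percolation of the span of \<open>S\<close>. If no long trail
  survives, \<open>integ_density_span\<close> makes them agree. Otherwise only the \<open>T\<close>
  side can contribute, since the restriction to the smaller span may still be free of long
  trails.\<close>

lemma local_density_consistent:
  assumes TS: "T \<subseteq> S" "S \<subseteq> V" and \<alpha>: "\<And>i. i \<in> T \<Longrightarrow> \<alpha> i < q"
  shows "\<bar>local_density T \<alpha> - integ (S - T) (local_density S) \<alpha>\<bar> \<le>
    (real k * real (card S ^ 2 * R)) ^ 2 * (1 - \<epsilon>) ^ R * M ^ card S"
proof -
  let ?HS = "span E R S" and ?HT = "span E R T"
  define g where "g B = of_bool (no_long_trail R B) * integ (V - T) (density B) \<alpha>" for B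
  have fin: "finite S" "finite (S - T)" "finite (V - S)" "finite (V - T)"
    using TS finite_V finite_subset[OF TS(2)] by auto
  have HS: "?HS \<subseteq> E" "?HT \<subseteq> ?HS" using span_subset span_mono[OF TS(1)] by auto
  have fHS: "finite ?HS" using HS(1) finite_sub_E by blast
  have w: "perc_weight \<epsilon> H A \<ge> 0" for H A :: "nat set set" using \<epsilon> by (simp add: perc_weight_nonneg)
  have "local_density T \<alpha> = (\<Sum>A\<in>Pow ?HT. perc_weight \<epsilon> ?HT A * g A)"
    unfolding local_density_def g_def by (simp add: mult.assoc)
  also have "\<dots> = (\<Sum>A\<in>Pow ?HS. perc_weight \<epsilon> ?HS A * g (A \<inter> ?HT))"
    using fHS HS(2) by (rule perc_marginal[symmetric])
  finally have DT: "local_density T \<alpha> = (\<Sum>A\<in>Pow ?HS. perc_weight \<epsilon> ?HS A * g (A \<inter> ?HT))" .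
  have Un: "S - T \<union> (V - S) = V - T" using TS by blast
  have "integ (S - T) (local_density S) \<alpha> = (\<Sum>A\<in>Pow ?HS.
      perc_weight \<epsilon> ?HS A * of_bool (no_long_trail R A) * integ (S - T) (integ (V - S) (density A)) \<alpha>)"
    unfolding local_density_def[abs_def] by (simp add: integ_sum)
  also have "\<dots> = (\<Sum>A\<in>Pow ?HS. perc_weight \<epsilon> ?HS A * (of_bool (no_long_trail R A) * g (A \<inter> ?HT)))"
  proof (intro sum.cong refl)
    fix A assume "A \<in> Pow ?HS"
    then have A: "A \<subseteq> E" using HS by auto
    show "perc_weight \<epsilon> ?HS A * of_bool (no_long_trail R A) * integ (S - T) (integ (V - S) (density A)) \<alpha>
        = perc_weight \<epsilon> ?HS A * (of_bool (no_long_trail R A) * g (A \<inter> ?HT))"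
    proof (cases "no_long_trail R A")
      case True
      then have "integ (V - T) (density A) = integ (V - T) (density (A \<inter> ?HT))"
        using A TS by (intro integ_density_span) auto
      then show ?thesis
        using True no_long_trail_mono[OF True, of "A \<inter> ?HT"] by (simp add: g_def integ_integ fin Un)
    qed simp
  qed
  finally have DS: "integ (S - T) (local_density S) \<alpha> = \<dots>" .
  have "local_density T \<alpha> - integ (S - T) (local_density S) \<alpha> =
      (\<Sum>A\<in>Pow ?HS. perc_weight \<epsilon> ?HS A * of_bool (\<not> no_long_trail R A) * g (A \<inter> ?HT))"
    unfolding DT DS sum_subtractf[symmetric] by (intro sum.cong refl) auto
  moreover have g0: "0 \<le> g (A \<inter> ?HT)" and gM: "g (A \<inter> ?HT) \<le> M ^ card S" if "A \<in> Pow ?HS" for A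
  proof -
    have AE: "A \<inter> ?HT \<subseteq> E" using that HS by auto
    then show "0 \<le> g (A \<inter> ?HT)" unfolding g_def by (simp add: integ_nonneg density_nonneg)
    have "M ^ card T \<le> M ^ card S" using M_ge_1 TS fin by (intro power_increasing card_mono) auto
    moreover have "g (A \<inter> ?HT) \<le> M ^ card T"
      using integ_density_bound[OF AE _ order_trans[OF TS] \<alpha>] M_ge_1 by (simp add: g_def)
    ultimately show "g (A \<inter> ?HT) \<le> M ^ card S" by linarith
  qed
  moreover have "0 \<le> (\<Sum>A\<in>Pow ?HS. perc_weight \<epsilon> ?HS A * of_bool (\<not> no_long_trail R A) * g (A \<inter> ?HT))"
    using g0 w by (intro sum_nonneg mult_nonneg_nonneg) auto
  moreover have "(\<Sum>A\<in>Pow ?HS. perc_weight \<epsilon> ?HS A * of_bool (\<not> no_long_trail R A) * g (A \<inter> ?HT)) \<le>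
      (\<Sum>A\<in>Pow ?HS. perc_weight \<epsilon> ?HS A * of_bool (\<not> no_long_trail R A)) * M ^ card S"
    unfolding sum_distrib_right using gM w by (intro sum_mono mult_left_mono) auto
  moreover have "\<dots> \<le> (real k * real (card S ^ 2 * R)) ^ 2 * (1 - \<epsilon>) ^ R * M ^ card S"
  proof (intro mult_right_mono)
    have "real (card ?HS) \<le> real (card S ^ 2 * R)" using card_span[OF fin(1)] by linarith
    then have "(real k * real (card ?HS)) ^ 2 \<le> (real k * real (card S ^ 2 * R)) ^ 2"
      by (intro power_mono mult_left_mono) auto
    then have "(real k * real (card ?HS)) ^ 2 * (1 - \<epsilon>) ^ R \<le> (real k * real (card S ^ 2 * R)) ^ 2 * (1 - \<epsilon>) ^ R"
      using \<epsilon> by (intro mult_right_mono) auto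
    then show "(\<Sum>A\<in>Pow ?HS. perc_weight \<epsilon> ?HS A * of_bool (\<not> no_long_trail R A)) \<le>
        (real k * real (card S ^ 2 * R)) ^ 2 * (1 - \<epsilon>) ^ R"
      using perc_long_trail[OF HS(1)] by linarith
  qed (use M_ge_1 in auto)
  ultimately show ?thesis by linarith
qed

lemma local_density_nonneg: "local_density T \<alpha> \<ge> 0"
  unfolding local_density_def
proof (intro sum_nonneg mult_nonneg_nonneg)
  fix A assume "A \<in> Pow (span E R T)"
  then have "A \<subseteq> E" using span_subset by blast
  then show "0 \<le> integ (V - T) (density A) \<alpha>" by (intro integ_nonneg density_nonneg)
qed (use \<epsilon> in \<open>auto simp: perc_weight_nonneg\<close>)

lemma local_density_empty: "local_density {} \<alpha> = 1"
proof -
  have "no_long_trail R ({} :: nat set set)" using R_ge_2 by (intro no_long_trail_small) auto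
  then show ?thesis
    using finite_V by (simp add: local_density_def span_empty perc_weight_def density_def[abs_def] integ_const)
qed

text \<open>The span of \<open>e\<close> contains at most \<open>e\<close> itself, which is kept
  with probability \<open>1 - \<epsilon>\<close>; as \<open>R \<ge> 2\<close>, a single edge never
  makes a long trail.\<close>

lemma local_density_edge:
  assumes e: "e \<in> E" shows "local_density e \<alpha> \<ge> (1 - \<epsilon>) * \<rho> e \<alpha>"
proof -
  have good: "no_long_trail R ({} :: nat set set)" "no_long_trail R {e}"
    using R_ge_2 by (auto intro: no_long_trail_small)
  have id: "integ (V - e) (density {e}) = \<rho> e"
    using finite_V \<rho>_depends[OF e] by (simp add: density_def[abs_def]) (intro integ_indep, auto)
  consider "span E R e = {e}" | "span E R e = {}" using span_edge[OF e] by blast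
  then show ?thesis
  proof cases
    case 1
    have "local_density e \<alpha> = \<epsilon> + (1 - \<epsilon>) * \<rho> e \<alpha>"
      unfolding local_density_def 1 using good id finite_V
      by (simp add: Pow_insert perc_weight_def) (simp add: density_def[abs_def] integ_const)
    then show ?thesis using \<epsilon> by simp
  next
    case 2
    have "local_density e \<alpha> = 1"
      unfolding local_density_def 2 using good finite_V
      by (simp add: perc_weight_def density_def[abs_def] integ_const)
    \<comment> \<open>Two vertices of \<open>e\<close> would be joined by a one-edge trail and put
      \<open>e\<close> into its span. For a singleton the marginal condition forces
      \<open>\<rho> e\<close> to be 1.\<close>
    moreover have "\<exists>i. e = {i}"
    proof (rule ccontr)
      assume ne: "\<nexists>i. e = {i}"
      obtain u where u: "u \<in> e" using E_ne[OF e] by blast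
      then obtain v where v: "v \<in> e" "v \<noteq> u" using ne by blast
      have "[(e, v)] \<in> short_trails E R u v"
        using u v e R_ge_2 by (auto simp: short_trails_def)
      then have "e \<in> span E R e" using u v unfolding span_def by force
      then show False using 2 by simp
    qed
    then have "\<rho> e = (\<lambda>_. 1)" using \<rho>_marginal[OF e] by force
    ultimately show ?thesis using \<epsilon> by simp
  qed
qed

end

section \<open>The Sherali-Adams solution\<close>

text \<open>The factors, in order: the number of Efron-Stein terms, the number of long trails in a
  span of at most \<open>t ^ 2 * R\<close> edges, the survival probability of one of them, and the
  bound on a density at a point.\<close>

definition sa_error :: "nat \<Rightarrow> real \<Rightarrow> real \<Rightarrow> nat \<Rightarrow> nat \<Rightarrow> real" where
  "sa_error k \<epsilon> M R t = 4 ^ t * ((real k * real (t ^ 2 * R)) ^ 2 * (1 - \<epsilon>) ^ R * M ^ t)"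

context csp_densities
begin

definition sa_density :: "nat set \<Rightarrow> (nat \<Rightarrow> nat) \<Rightarrow> real" where
  "sa_density S \<alpha> = (1 - \<epsilon>) * correction local_density S \<alpha> + \<epsilon>"

text \<open>The correction errs by at most \<open>\<epsilon>\<close>. Scaled by
  \<open>1 - \<epsilon>\<close>, this is outweighed by the added \<open>\<epsilon>\<close>, with
  \<open>\<epsilon> * \<epsilon>\<close> to spare.\<close>

lemma sa_density_ge:
  assumes S: "S \<subseteq> V" "card S \<le> t" and \<alpha>: "\<And>i. i \<in> S \<Longrightarrow> \<alpha> i < q" and t: "sa_error k \<epsilon> M R t \<le> \<epsilon>"
  shows "sa_density S \<alpha> \<ge> (1 - \<epsilon>) * local_density S \<alpha>"
proof -
  have fS: "finite S" using S finite_V finite_subset by blast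
  let ?\<eta> = "(real k * real (card S ^ 2 * R)) ^ 2 * (1 - \<epsilon>) ^ R * M ^ card S"
  have "\<bar>correction local_density S \<alpha> - local_density S \<alpha>\<bar> \<le> 4 ^ card S * ?\<eta>"
  proof (rule correction_approx[OF fS _ \<alpha>])
    fix T and \<alpha> :: "nat \<Rightarrow> nat" assume "T \<subseteq> S" "\<And>i. i \<in> T \<Longrightarrow> \<alpha> i < q"
    then show "\<bar>local_density T \<alpha> - integ (S - T) (local_density S) \<alpha>\<bar> \<le> ?\<eta>"
      using S(1) by (intro local_density_consistent)
  qed
  also have "\<dots> \<le> sa_error k \<epsilon> M R t"
    unfolding sa_error_def
  proof (intro mult_mono)
    show "(real k * real (card S ^ 2 * R)) ^ 2 \<le> (real k * real (t ^ 2 * R)) ^ 2"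
      using S(2) by (intro power_mono mult_left_mono of_nat_mono mult_right_mono) auto
    show "M ^ card S \<le> M ^ t" using M_ge_1 S(2) by (intro power_increasing) auto
    show "(4::real) ^ card S \<le> 4 ^ t" using S(2) by (intro power_increasing) auto
  qed (use \<epsilon> M_ge_1 in auto)
  finally have "correction local_density S \<alpha> \<ge> local_density S \<alpha> - \<epsilon>" using t by linarith
  then have "(1 - \<epsilon>) * correction local_density S \<alpha> \<ge> (1 - \<epsilon>) * (local_density S \<alpha> - \<epsilon>)"
    using \<epsilon> by (intro mult_left_mono) auto
  moreover have "(1 - \<epsilon>) * (local_density S \<alpha> - \<epsilon>) = (1 - \<epsilon>) * local_density S \<alpha> - \<epsilon> + \<epsilon> * \<epsilon>"
    by (simp add: algebra_simps)
  moreover have "\<epsilon> * \<epsilon> \<ge> 0" by simp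
  ultimately show ?thesis unfolding sa_density_def by linarith
qed

lemma integ_sa_density:
  assumes "T \<subseteq> S" "S \<subseteq> V" shows "integ (S - T) (sa_density S) = sa_density T"
proof -
  have fin: "finite T" "finite (S - T)" using assms finite_V finite_subset by (meson finite_Diff)+
  have S: "S = T \<union> (S - T)" using assms by auto
  have "integ (S - T) (correction local_density (T \<union> (S - T))) = correction local_density T"
    using assms fin by (intro integ_correction depends_on_local_density) auto
  then have "integ (S - T) (correction local_density S) = correction local_density T"
    using S by simp
  then show ?thesis
    unfolding sa_density_def[abs_def] by (simp add: integ_affine[OF fin(2)])
qed

lemma sa_density_empty: "sa_density {} \<alpha> = 1"
  by (simp add: sa_density_def correction_def comp_def local_density_empty)

definition sa_solution :: "nat \<Rightarrow> nat set \<Rightarrow> (nat \<Rightarrow> nat) \<Rightarrow> real" where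
  "sa_solution t S \<alpha> = (if card S > t then 0 else (\<Prod>i\<in>S. m i (\<alpha> i)) * sa_density S \<alpha>)"

lemma sa_feasible_sa_solution:
  assumes V: "V = {..<nvars \<Phi>}" and t: "sa_error k \<epsilon> M R t \<le> \<epsilon>"
  shows "sa_feasible q t \<Phi> (sa_solution t)"
  unfolding sa_feasible_def
proof (intro conjI allI impI ballI)
  fix S \<alpha> assume S: "S \<subseteq> {..<nvars \<Phi>}" "card S \<le> t" "\<alpha> \<in> assigns q S"
  have "sa_density S \<alpha> \<ge> (1 - \<epsilon>) * local_density S \<alpha>"
    using S V t by (intro sa_density_ge) auto
  then have "sa_density S \<alpha> \<ge> 0"
    using local_density_nonneg[of S \<alpha>] \<epsilon> by (meson diff_ge_0_iff_ge less_imp_le mult_nonneg_nonneg order_trans)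
  then show "0 \<le> sa_solution t S \<alpha>"
    using weight_pos[OF S(3)] by (simp add: sa_solution_def)
next
  fix S :: "nat set" and \<alpha> :: "nat \<Rightarrow> nat" assume "t < card S" then show "sa_solution t S \<alpha> = 0" by (simp add: sa_solution_def)
next
  show "sa_solution t {} (\<lambda>_. undefined) = 1" by (simp add: sa_solution_def sa_density_empty)
next
  fix S T \<beta> assume S: "S \<subseteq> {..<nvars \<Phi>}" "card S \<le> t" and T: "T \<subseteq> S" "\<beta> \<in> assigns q T"
  have fS: "finite S" using S finite_subset by blast
  have "card T \<le> t" using card_mono[OF fS T(1)] S(2) by simp
  moreover have "S \<subseteq> V" using S(1) V by simp
  ultimately show "(\<Sum>\<alpha> | \<alpha> \<in> assigns q S \<and> restrict \<alpha> T = \<beta>. sa_solution t S \<alpha>) = sa_solution t T \<beta>"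
    using S(2) sum_extensions[OF T(1) fS T(2), of "sa_density S"] integ_sa_density[OF T(1)]
    by (simp add: sa_solution_def)
qed

text \<open>One factor \<open>1 - \<epsilon>\<close> is the chance that the edge is kept, the other
  the weight left by mixing with the product measure.\<close>

lemma sa_solution_edge:
  assumes e: "e \<in> E" "card e \<le> t" and \<alpha>: "\<alpha> \<in> assigns q e" and t: "sa_error k \<epsilon> M R t \<le> \<epsilon>"
  shows "sa_solution t e \<alpha> \<ge> (1 - \<epsilon>) ^ 2 * ((\<Prod>i\<in>e. m i (\<alpha> i)) * \<rho> e \<alpha>)"
proof -
  have "(1 - \<epsilon>) * ((1 - \<epsilon>) * \<rho> e \<alpha>) \<le> (1 - \<epsilon>) * local_density e \<alpha>"
    using \<epsilon> by (intro mult_left_mono local_density_edge e) auto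
  also have "\<dots> \<le> sa_density e \<alpha>"
    using E_sub e \<alpha> t by (intro sa_density_ge) auto
  finally have "(\<Prod>i\<in>e. m i (\<alpha> i)) * ((1 - \<epsilon>) * ((1 - \<epsilon>) * \<rho> e \<alpha>)) \<le> (\<Prod>i\<in>e. m i (\<alpha> i)) * sa_density e \<alpha>"
    using weight_pos[OF \<alpha>] by (intro mult_left_mono) auto
  then show ?thesis using e(2) by (simp add: sa_solution_def power2_eq_square mult_ac)
qed

end

lemma avg_constrs_mono:
  assumes "\<And>C. C \<in> set (constrs \<Phi>) \<Longrightarrow> g C \<le> h C"
  shows "avg_constrs \<Phi> g \<le> avg_constrs \<Phi> h"
  unfolding avg_constrs_def using assms by (intro divide_right_mono sum_list_mono) auto

lemma avg_constrs_const: "constrs \<Phi> \<noteq> [] \<Longrightarrow> avg_constrs \<Phi> (\<lambda>_. c) = c"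
  by (simp add: avg_constrs_def sum_list_triv)

lemma avg_constrs_cmult: "avg_constrs \<Phi> (\<lambda>C. c * g C) = c * avg_constrs \<Phi> g"
  by (simp add: avg_constrs_def sum_list_const_mult)

lemma scope_bounds:
  assumes "csp_instance k q \<Phi>" "C \<in> set (constrs \<Phi>)"
  shows "scope C \<subseteq> {..<nvars \<Phi>}" "finite (scope C)" "card (scope C) \<le> k"
  using assms card_length[of "fst C"] by (force simp: csp_instance_def scope_def)+

lemma q_pos:
  assumes "csp_instance k q \<Phi>" "k \<ge> 1" shows "q > 0"
proof -
  obtain C where C: "C \<in> set (constrs \<Phi>)" 
    using assms(1) unfolding csp_instance_def by (metis last_in_set)
  then have "length (snd C) = k" "set (snd C) \<subseteq> {..<q}" using assms by (force simp: csp_instance_def)+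
  then have "snd C ! 0 < q" using assms(2) by (metis lessThan_iff less_eq_Suc_le nth_mem One_nat_def subsetD)
  then show ?thesis by simp
qed

text \<open>Consistency with the empty set makes the LP variables on a scope sum to 1, as
  \<open>k \<le> t\<close>. The bound is needed for the supremum \<open>sa_lp_opt\<close> to
  dominate each feasible value.\<close>

lemma sa_objective_le_1:
  assumes \<Phi>: "csp_instance k q \<Phi>" and x: "sa_feasible q t \<Phi> x" and kt: "k \<le> t"
  shows "lp_objective f q \<Phi> x \<le> 1"
proof -
  have ne: "constrs \<Phi> \<noteq> []" using \<Phi> by (simp add: csp_instance_def)
  have "lp_objective f q \<Phi> x \<le> avg_constrs \<Phi> (\<lambda>_. 1)"
    unfolding lp_objective_def
  proof (rule avg_constrs_mono)
    fix C assume C: "C \<in> set (constrs \<Phi>)"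
    note S = scope_bounds[OF \<Phi> C]
    have nn: "x (scope C) \<alpha> \<ge> 0" if "\<alpha> \<in> assigns q (scope C)" for \<alpha>
      using x S kt that unfolding sa_feasible_def by auto
    have "(\<Sum>\<alpha> | \<alpha> \<in> assigns q (scope C) \<and> restrict \<alpha> {} = (\<lambda>_. undefined). x (scope C) \<alpha>) =
        x {} (\<lambda>_. undefined)"
      using x S kt unfolding sa_feasible_def by auto
    then have "(\<Sum>\<alpha>\<in>assigns q (scope C). x (scope C) \<alpha>) = 1"
      using x by (simp add: sa_feasible_def restrict_def)
    moreover have "(\<Sum>\<alpha>\<in>assigns q (scope C). of_bool (satisfies f q \<alpha> C) * x (scope C) \<alpha>) \<le>
        (\<Sum>\<alpha>\<in>assigns q (scope C). x (scope C) \<alpha>)"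
      using nn by (intro sum_mono) auto
    ultimately show "(\<Sum>\<alpha>\<in>assigns q (scope C). of_bool (satisfies f q \<alpha> C) * x (scope C) \<alpha>) \<le> 1"
      by simp
  qed
  then show ?thesis using avg_constrs_const[OF ne] by simp
qed

lemma sa_lp_opt_ge:
  assumes "csp_instance k q \<Phi>" "sa_feasible q t \<Phi> x" "k \<le> t"
  shows "sa_lp_opt f q t \<Phi> \<ge> lp_objective f q \<Phi> x"
  unfolding sa_lp_opt_def
  using assms sa_objective_le_1[OF assms(1) _ assms(3)]
  by (intro cSup_upper bdd_aboveI[of _ 1]) auto

section \<open>Lifts of an instance\<close>

text \<open>Copy \<open>a\<close> of variable \<open>v\<close> has number \<open>a * n0 + v\<close>,
  so that reduction modulo \<open>n0\<close> recovers \<open>v\<close>.\<close>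

definition lift_constraint :: "nat \<Rightarrow> (nat \<Rightarrow> nat) \<Rightarrow> csp_constraint \<Rightarrow> csp_constraint" where
  "lift_constraint n0 h C = (map (\<lambda>v. h v * n0 + v) (fst C), snd C)"

lemma scope_lift_constraint: "scope (lift_constraint n0 h C) = (\<lambda>v. h v * n0 + v) ` scope C"
  by (simp add: scope_def lift_constraint_def)

lemma satisfies_lift_constraint:
  "satisfies f q \<alpha> (lift_constraint n0 h C) = satisfies f q (\<lambda>v. \<alpha> (h v * n0 + v)) C"
  by (simp add: satisfies_def lift_constraint_def zip_map1 comp_def case_prod_unfold)

lemma satisfies_cong:
  assumes "\<And>i. i \<in> scope C \<Longrightarrow> \<alpha> i = \<alpha>' i"
  shows "satisfies f q \<alpha> C = satisfies f q \<alpha>' C"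
proof -
  have "map2 (\<lambda>i b. (\<alpha> i + b) mod q) (fst C) (snd C) = map2 (\<lambda>i b. (\<alpha>' i + b) mod q) (fst C) (snd C)"
    using assms by (intro map_cong[OF refl]) (auto simp: scope_def dest: set_zip_leftD)
  then show ?thesis by (simp only: satisfies_def)
qed

text \<open>Used with reduction modulo \<open>n0\<close>, which is injective on a lifted scope: it
  carries assignments of the lifted scope to the original one.\<close>

definition transport :: "(nat \<Rightarrow> nat) \<Rightarrow> nat set \<Rightarrow> (nat \<Rightarrow> nat) \<Rightarrow> nat \<Rightarrow> nat" where
  "transport \<pi> e \<alpha> = restrict (\<lambda>v. \<alpha> (the_inv_into e \<pi> v)) (\<pi> ` e)"

lemma transport_apply: "inj_on \<pi> e \<Longrightarrow> i \<in> e \<Longrightarrow> transport \<pi> e \<alpha> (\<pi> i) = \<alpha> i"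
  by (simp add: transport_def the_inv_into_f_f)

lemma sum_transport:
  assumes inj: "inj_on \<pi> e"
  shows "(\<Sum>\<alpha>\<in>assigns q e. G (transport \<pi> e \<alpha>)) = (\<Sum>\<gamma>\<in>assigns q (\<pi> ` e). G \<gamma>)"
proof (rule sum.reindex_bij_witness[where i = "\<lambda>\<gamma>. restrict (\<lambda>i. \<gamma> (\<pi> i)) e" and j = "transport \<pi> e"])
  fix \<alpha> assume \<alpha>: "\<alpha> \<in> assigns q e"
  show "restrict (\<lambda>i. transport \<pi> e \<alpha> (\<pi> i)) e = \<alpha>"
    using PiE_arb[OF \<alpha>] by (auto simp: fun_eq_iff transport_apply[OF inj])
  show "transport \<pi> e \<alpha> \<in> assigns q (\<pi> ` e)"
    using \<alpha> inj by (auto simp: transport_def the_inv_into_f_f)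
next
  fix \<gamma> assume \<gamma>: "\<gamma> \<in> assigns q (\<pi> ` e)"
  show "transport \<pi> e (restrict (\<lambda>i. \<gamma> (\<pi> i)) e) = \<gamma>"
    using PiE_arb[OF \<gamma>] inj by (auto simp: fun_eq_iff transport_def the_inv_into_f_f)
  show "restrict (\<lambda>i. \<gamma> (\<pi> i)) e \<in> assigns q e" using \<gamma> by auto
qed simp

lemma card_assigns_fixed:
  assumes "finite S" "i \<in> S" "b < q"
  shows "card {\<alpha>. \<alpha> \<in> assigns q S \<and> \<alpha> i = b} = q ^ (card S - 1)"
proof -
  have "{\<alpha>. \<alpha> \<in> assigns q S \<and> \<alpha> i = b} = PiE S (\<lambda>j. if j = i then {b} else {..<q})"
    using assms by (auto simp: PiE_iff extensional_def split: if_splits)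
  then have "card {\<alpha>. \<alpha> \<in> assigns q S \<and> \<alpha> i = b} = (\<Prod>j\<in>S. card (if j = i then {b} else {..<q}))"
    using assms by (simp add: card_PiE)
  also have "\<dots> = (\<Prod>j\<in>S - {i}. card (if j = i then {b} else {..<q}))"
    using assms by (subst prod.remove[of S i]) auto
  also have "\<dots> = (\<Prod>j\<in>S - {i}. q)" by (intro prod.cong) auto
  finally show ?thesis using assms by simp
qed

section \<open>Pulling a basic LP solution back to a lift\<close>

locale basic_solution =
  fixes f :: "nat list \<Rightarrow> bool" and k q :: nat and \<Phi>\<^sub>0 :: csp
    and x :: "nat set \<Rightarrow> (nat \<Rightarrow> nat) \<Rightarrow> real" and y :: "nat \<Rightarrow> nat \<Rightarrow> real" and \<epsilon> :: real
  assumes inst: "csp_instance k q \<Phi>\<^sub>0" and k: "k \<ge> 1"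
    and feas: "basic_feasible q \<Phi>\<^sub>0 x y" and \<epsilon>: "0 < \<epsilon>" "\<epsilon> < 1"
begin

abbreviation "n0 \<equiv> nvars \<Phi>\<^sub>0"

lemma q: "q > 0" using q_pos inst k by blast

definition val :: "csp_constraint \<Rightarrow> real" where
  "val C = (\<Sum>\<alpha>\<in>assigns q (scope C). of_bool (satisfies f q \<alpha> C) * x (scope C) \<alpha>)"

text \<open>Adding the uniform distribution keeps one-variable probabilities at least
  \<open>\<epsilon> / q\<close>; densities are then well defined, and \<open>M\<close> can be
  \<open>q / \<epsilon>\<close>.\<close>

definition mix :: "nat set \<Rightarrow> (nat \<Rightarrow> nat) \<Rightarrow> real" where
  "mix S \<alpha> = (1 - \<epsilon>) * x S \<alpha> + \<epsilon> / real q ^ card S"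

text \<open>Variables outside all scopes are unconstrained in the basic LP: \<open>y\<close> may be negative there.\<close>

definition mix1 :: "nat \<Rightarrow> nat \<Rightarrow> real" where
  "mix1 i b = (if \<exists>C\<in>set (constrs \<Phi>\<^sub>0). i \<in> scope C then (1 - \<epsilon>) * y i b + \<epsilon> / real q else 1 / real q)"

lemma x_nonneg: "C \<in> set (constrs \<Phi>\<^sub>0) \<Longrightarrow> \<alpha> \<in> assigns q (scope C) \<Longrightarrow> x (scope C) \<alpha> \<ge> 0"
  using feas by (auto simp: basic_feasible_def)

lemma x_marginal: "C \<in> set (constrs \<Phi>\<^sub>0) \<Longrightarrow> i \<in> scope C \<Longrightarrow> b < q \<Longrightarrow>
    (\<Sum>\<alpha> | \<alpha> \<in> assigns q (scope C) \<and> \<alpha> i = b. x (scope C) \<alpha>) = y i b"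
  using feas unfolding basic_feasible_def by blast

lemma mix_nonneg: "C \<in> set (constrs \<Phi>\<^sub>0) \<Longrightarrow> \<alpha> \<in> assigns q (scope C) \<Longrightarrow> mix (scope C) \<alpha> \<ge> 0"
  using x_nonneg[of C \<alpha>] \<epsilon> by (simp add: mix_def)

lemma mix_marginal:
  assumes C: "C \<in> set (constrs \<Phi>\<^sub>0)" "i \<in> scope C" "b < q"
  shows "(\<Sum>\<alpha> | \<alpha> \<in> assigns q (scope C) \<and> \<alpha> i = b. mix (scope C) \<alpha>) = mix1 i b"
proof -
  have fin: "finite (scope C)" using scope_bounds[OF inst C(1)] by blast
  then have "card (scope C) > 0" using C(2) by (auto simp: card_gt_0_iff)
  then have "real q ^ card (scope C) = real q * real q ^ (card (scope C) - 1)"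
    by (metis power_eq_if less_numeral_extra(3))
  then have "real q ^ (card (scope C) - 1) * (\<epsilon> / real q ^ card (scope C)) = \<epsilon> / real q"
    using q by simp
  moreover have "(\<Sum>\<alpha> | \<alpha> \<in> assigns q (scope C) \<and> \<alpha> i = b. mix (scope C) \<alpha>) =
      (1 - \<epsilon>) * y i b + real q ^ (card (scope C) - 1) * (\<epsilon> / real q ^ card (scope C))"
    using x_marginal[OF C] card_assigns_fixed[OF fin C(2,3)]
    by (simp add: mix_def sum.distrib flip: sum_distrib_left)
  ultimately show ?thesis using C by (auto simp: mix1_def)
qed

lemma mix1_ge: assumes "b < q" shows "mix1 i b \<ge> \<epsilon> / real q"
proof (cases "\<exists>C\<in>set (constrs \<Phi>\<^sub>0). i \<in> scope C")
  case True
  then obtain C where C: "C \<in> set (constrs \<Phi>\<^sub>0)" "i \<in> scope C" by blast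
  have "y i b \<ge> 0"
    unfolding x_marginal[OF C assms, symmetric] by (intro sum_nonneg) (auto intro: x_nonneg C)
  then show ?thesis using True \<epsilon> by (simp add: mix1_def)
qed (use \<epsilon> q in \<open>simp add: mix1_def divide_right_mono\<close>)

lemma mix1_sum: "(\<Sum>b<q. mix1 i b) = 1"
proof (cases "\<exists>C\<in>set (constrs \<Phi>\<^sub>0). i \<in> scope C")
  case True
  then obtain C where "C \<in> set (constrs \<Phi>\<^sub>0)" "i \<in> scope C" by blast
  then have "i < n0" using scope_bounds[OF inst] by blast
  then have "(\<Sum>b<q. y i b) = 1" using feas by (simp add: basic_feasible_def)
  then show ?thesis
    using True q by (simp add: mix1_def sum.distrib flip: sum_distrib_left)
qed (use q in \<open>simp add: mix1_def\<close>)

definition base :: "nat \<Rightarrow> nat \<Rightarrow> real" where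
  "base i = mix1 (i mod n0)"

text \<open>The value 1 outside \<open>[q]\<close> makes the marginal identities hold for all arguments.\<close>

definition edge_density :: "nat set \<Rightarrow> (nat \<Rightarrow> nat) \<Rightarrow> real" where
  "edge_density e \<alpha> = (if \<forall>i\<in>e. \<alpha> i < q then
     mix ((\<lambda>i. i mod n0) ` e) (transport (\<lambda>i. i mod n0) e \<alpha>) / (\<Prod>i\<in>e. base i (\<alpha> i)) else 1)"

sublocale product_measure q base
proof
  fix b i assume "b < q"
  then have "mix1 (i mod n0) b \<ge> \<epsilon> / real q" by (rule mix1_ge)
  moreover have "\<epsilon> / real q > 0" using \<epsilon> q by simp
  ultimately show "0 < base i b" unfolding base_def by linarith
qed (simp add: base_def mix1_sum)

lemma edge_density_depends:
  assumes inj: "inj_on (\<lambda>i. i mod n0) e"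
  shows "depends_on (edge_density e) e"
  unfolding depends_on_def
proof (intro allI impI)
  fix \<alpha> \<alpha>' :: "nat \<Rightarrow> nat" assume eq: "\<forall>i\<in>e. \<alpha> i = \<alpha>' i"
  have "(\<Prod>i\<in>e. base i (\<alpha> i)) = (\<Prod>i\<in>e. base i (\<alpha>' i))" using eq by (intro prod.cong) auto
  moreover have "transport (\<lambda>i. i mod n0) e \<alpha> = transport (\<lambda>i. i mod n0) e \<alpha>'"
    using eq by (auto simp: transport_def the_inv_into_f_f[OF inj] fun_eq_iff)
  ultimately show "edge_density e \<alpha> = edge_density e \<alpha>'"
    using eq by (auto simp: edge_density_def)
qed

lemma lift_scope:
  fixes h :: "nat \<Rightarrow> nat"
  assumes "C \<in> set (constrs \<Phi>\<^sub>0)"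
  defines "e \<equiv> scope (lift_constraint n0 h C)"
  shows "inj_on (\<lambda>i. i mod n0) e" "(\<lambda>i. i mod n0) ` e = scope C" "finite e" "e \<noteq> {}" "card e \<le> k"
proof -
  have lt: "v < n0" if "v \<in> scope C" for v using scope_bounds[OF inst assms(1)] that by auto
  show "inj_on (\<lambda>i. i mod n0) e"
    unfolding e_def scope_lift_constraint by (intro inj_onI) (auto simp: lt)
  show "(\<lambda>i. i mod n0) ` e = scope C"
    unfolding e_def scope_lift_constraint image_image by (simp add: lt)
  show "finite e" using scope_bounds[OF inst assms(1)] by (simp add: e_def scope_lift_constraint)
  have "fst C \<noteq> []" using inst assms(1) k by (force simp: csp_instance_def)
  then show "e \<noteq> {}" by (simp add: e_def scope_lift_constraint) (simp add: scope_def)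
  show "card e \<le> k"
    using scope_bounds[OF inst assms(1)] unfolding e_def scope_lift_constraint
    by (meson card_image_le order_trans)
qed

lemma edge_weight:
  assumes "\<alpha> \<in> assigns q e"
  shows "(\<Prod>i\<in>e. base i (\<alpha> i)) * edge_density e \<alpha> =
    mix ((\<lambda>i. i mod n0) ` e) (transport (\<lambda>i. i mod n0) e \<alpha>)"
  using weight_pos[OF assms] assms by (auto simp: edge_density_def)

lemma transport_assigns:
  assumes "inj_on \<pi> e" "\<alpha> \<in> e \<rightarrow> {..<q}" shows "transport \<pi> e \<alpha> \<in> assigns q (\<pi> ` e)"
  using assms by (auto simp: transport_def the_inv_into_f_f)

lemma edge_density_nonneg:
  assumes "C \<in> set (constrs \<Phi>\<^sub>0)"
  shows "edge_density (scope (lift_constraint n0 h C)) \<alpha> \<ge> 0"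
proof -
  let ?e = "scope (lift_constraint n0 h C)"
  show ?thesis
  proof (cases "\<forall>i\<in>?e. \<alpha> i < q")
    case True
    have "transport (\<lambda>i. i mod n0) ?e \<alpha> \<in> assigns q (scope C)"
      using transport_assigns[OF lift_scope(1)[OF assms, of h], of \<alpha>] lift_scope(2)[OF assms, of h] True
      by auto
    then have "mix ((\<lambda>i. i mod n0) ` ?e) (transport (\<lambda>i. i mod n0) ?e \<alpha>) \<ge> 0"
      using lift_scope(2)[OF assms] mix_nonneg[OF assms] by simp
    moreover have "(\<Prod>i\<in>?e. base i (\<alpha> i)) > 0"
      using True by (intro prod_pos) (auto intro: m_pos)
    ultimately show ?thesis using True by (simp add: edge_density_def)
  qed (auto simp: edge_density_def)
qed

text \<open>Weight times density is the mixed distribution on the original scope, read through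
  reduction modulo \<open>n0\<close>; its one-variable marginals are those of
  \<open>mix1\<close>.\<close>

lemma edge_density_marginal:
  assumes C: "C \<in> set (constrs \<Phi>\<^sub>0)" and i: "i \<in> scope (lift_constraint n0 h C)"
  shows "integ (scope (lift_constraint n0 h C) - {i}) (edge_density (scope (lift_constraint n0 h C))) = (\<lambda>_. 1)"
proof
  fix \<alpha>
  define e where "e = scope (lift_constraint n0 h C)"
  let ?\<pi> = "\<lambda>i. i mod n0"
  have inj: "inj_on ?\<pi> e" and im: "?\<pi> ` e = scope C" and fin: "finite e"
    unfolding e_def using lift_scope[OF C] by auto
  have ie: "i \<in> e" using i by (simp add: e_def)
  have "integ (e - {i}) (edge_density e) \<alpha> = 1"
  proof (cases "\<alpha> i < q")
    case False
    have "edge_density e (override_on \<alpha> \<beta> (e - {i})) = 1" for \<beta>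
      using False ie by (auto simp: edge_density_def override_on_def)
    then have "integ (e - {i}) (edge_density e) \<alpha> = integ (e - {i}) (\<lambda>_. 1) \<alpha>"
      by (simp add: integ_def)
    then show ?thesis using fin by (simp add: integ_const)
  next
    case True
    \<comment> \<open>\<open>sum_extensions\<close> expects an assignment that is undefined off
      \<open>{i}\<close>. The average depends on coordinate \<open>i\<close> alone, so
      \<open>\<alpha>\<close> may be replaced by \<open>\<beta>\<close>.\<close>
    define \<beta> where "\<beta> = restrict \<alpha> {i}"
    have \<beta>: "\<beta> \<in> assigns q {i}" using True by (auto simp: \<beta>_def)
    have "(\<Prod>j\<in>{i}. base j (\<beta> j)) * integ (e - {i}) (edge_density e) \<beta> =
        (\<Sum>\<alpha>' | \<alpha>' \<in> assigns q e \<and> restrict \<alpha>' {i} = \<beta>. (\<Prod>j\<in>e. base j (\<alpha>' j)) * edge_density e \<alpha>')"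
      using sum_extensions[of "{i}" e \<beta> "edge_density e"] ie fin \<beta> by simp
    also have "\<dots> = (\<Sum>\<alpha>' | \<alpha>' \<in> assigns q e \<and> \<alpha>' i = \<alpha> i. mix (scope C) (transport ?\<pi> e \<alpha>'))"
    proof (rule sum.cong)
      show "{\<alpha>'. \<alpha>' \<in> assigns q e \<and> restrict \<alpha>' {i} = \<beta>} = {\<alpha>'. \<alpha>' \<in> assigns q e \<and> \<alpha>' i = \<alpha> i}"
        by (auto simp: \<beta>_def fun_eq_iff)
    qed (use edge_weight im in auto)
    also have "\<dots> = (\<Sum>\<alpha>'\<in>assigns q e. of_bool (transport ?\<pi> e \<alpha>' (?\<pi> i) = \<alpha> i) * mix (scope C) (transport ?\<pi> e \<alpha>'))"
      using fin transport_apply[OF inj ie] by (intro sum.mono_neutral_cong_left) (auto intro: finite_PiE)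
    also have "\<dots> = (\<Sum>\<gamma>\<in>assigns q (scope C). of_bool (\<gamma> (?\<pi> i) = \<alpha> i) * mix (scope C) \<gamma>)"
      using sum_transport[OF inj, of "\<lambda>\<gamma>. of_bool (\<gamma> (?\<pi> i) = \<alpha> i) * mix (scope C) \<gamma>"] im by simp
    also have "\<dots> = (\<Sum>\<gamma> | \<gamma> \<in> assigns q (scope C) \<and> \<gamma> (?\<pi> i) = \<alpha> i. mix (scope C) \<gamma>)"
      using scope_bounds(2)[OF inst C] by (intro sum.mono_neutral_cong_right) (auto intro: finite_PiE)
    also have "\<dots> = base i (\<alpha> i)"
      using mix_marginal[OF C _ True, of "?\<pi> i"] im ie by (auto simp: base_def)
    finally have "integ (e - {i}) (edge_density e) \<beta> = 1"
      using m_pos[OF True, of i] by (simp add: \<beta>_def)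
    moreover have "depends_on (integ (e - {i}) (edge_density e)) (e - (e - {i}))"
      using edge_density_depends[OF inj] by (rule depends_on_integ)
    then have "integ (e - {i}) (edge_density e) \<alpha> = integ (e - {i}) (edge_density e) \<beta>"
      by (rule depends_onD) (auto simp: \<beta>_def)
    ultimately show ?thesis by simp
  qed
  then show "integ (scope (lift_constraint n0 h C) - {i}) (edge_density (scope (lift_constraint n0 h C))) \<alpha> = 1"
    by (simp add: e_def)
qed

text \<open>The three factors \<open>1 - \<epsilon>\<close> are paid for mixing with the uniform
  distribution, for percolation, and for the final mixing with the product measure.\<close>

theorem sa_solution_of_lift:
  assumes \<Phi>: "csp_instance k q \<Phi>"
    and lift: "\<And>C. C \<in> set (constrs \<Phi>) \<Longrightarrow> \<exists>C\<^sub>0\<in>set (constrs \<Phi>\<^sub>0). \<exists>h. C = lift_constraint n0 h C\<^sub>0"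
    and girth: "high_girth (scope ` set (constrs \<Phi>)) R"
    and err: "sa_error k \<epsilon> (real q / \<epsilon>) R t \<le> \<epsilon>" and kt: "k \<le> t"
  obtains z where "sa_feasible q t \<Phi> z"
    "\<And>C h. C \<in> set (constrs \<Phi>\<^sub>0) \<Longrightarrow> lift_constraint n0 h C \<in> set (constrs \<Phi>) \<Longrightarrow>
      (\<Sum>\<alpha>\<in>assigns q (scope (lift_constraint n0 h C)).
        of_bool (satisfies f q \<alpha> (lift_constraint n0 h C)) * z (scope (lift_constraint n0 h C)) \<alpha>)
      \<ge> (1 - \<epsilon>) ^ 3 * val C"
proof -
  define E where "E = scope ` set (constrs \<Phi>)"
  have E: "\<exists>C\<in>set (constrs \<Phi>\<^sub>0). \<exists>h. e = scope (lift_constraint n0 h C)" if "e \<in> E" for e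
    using that lift unfolding E_def by blast
  interpret high_girth E R using girth by (simp add: E_def)
  interpret csp_densities q base E R "{..<nvars \<Phi>}" edge_density k \<epsilon> "real q / \<epsilon>"
  proof
    fix e assume e: "e \<in> E"
    obtain C h where C: "C \<in> set (constrs \<Phi>\<^sub>0)" "e = scope (lift_constraint n0 h C)" using E[OF e] by blast
    show "e \<subseteq> {..<nvars \<Phi>}" using e scope_bounds[OF \<Phi>] by (auto simp: E_def)
    show "e \<noteq> {}" "card e \<le> k" using lift_scope[OF C(1)] C(2) by auto
    show "depends_on (edge_density e) e" using edge_density_depends lift_scope(1)[OF C(1)] C(2) by auto
    show "edge_density e \<alpha> \<ge> 0" for \<alpha> using edge_density_nonneg[OF C(1)] C(2) by auto
    show "integ (e - {i}) (edge_density e) = (\<lambda>_. 1)" if "i \<in> e" for i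
      using edge_density_marginal[OF C(1)] C(2) that by auto
  next
    fix b i assume "b < q"
    then have "\<epsilon> / real q \<le> base i b" by (simp add: base_def mix1_ge)
    then show "1 \<le> real q / \<epsilon> * base i b" using \<epsilon> q by (simp add: field_simps)
  next
    have "\<epsilon> \<le> real q" using \<epsilon> q by linarith
    then show "1 \<le> real q / \<epsilon>" using \<epsilon> by simp
  qed (use \<epsilon> in auto)
  show thesis
  proof (rule that)
    show "sa_feasible q t \<Phi> (sa_solution t)" using err by (intro sa_feasible_sa_solution) auto
    fix C h assume C: "C \<in> set (constrs \<Phi>\<^sub>0)" "lift_constraint n0 h C \<in> set (constrs \<Phi>)"
    define e where "e = scope (lift_constraint n0 h C)"
    let ?\<pi> = "\<lambda>i. i mod n0"
    have inj: "inj_on ?\<pi> e" and im: "?\<pi> ` e = scope C" and fin: "finite e" and ce: "card e \<le> k"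
      unfolding e_def using lift_scope[OF C(1)] by auto
    have eE: "e \<in> E" using C(2) by (auto simp: E_def e_def)
    have lt: "v < n0" if "v \<in> scope C" for v using scope_bounds[OF inst C(1)] that by auto
    have sat: "satisfies f q \<alpha> (lift_constraint n0 h C) = satisfies f q (transport ?\<pi> e \<alpha>) C" for \<alpha>
      unfolding satisfies_lift_constraint
    proof (rule satisfies_cong)
      fix v assume v: "v \<in> scope C"
      then have "h v * n0 + v \<in> e" by (simp add: e_def scope_lift_constraint)
      then show "\<alpha> (h v * n0 + v) = transport ?\<pi> e \<alpha> v"
        using transport_apply[OF inj, of "h v * n0 + v" \<alpha>] lt[OF v] by simp
    qed
    have "(1 - \<epsilon>) ^ 3 * val C = (1 - \<epsilon>) ^ 2 * ((1 - \<epsilon>) * val C)"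
      by (simp add: power3_eq_cube power2_eq_square)
    also have "(1 - \<epsilon>) * val C \<le> (\<Sum>\<gamma>\<in>assigns q (scope C). of_bool (satisfies f q \<gamma> C) * mix (scope C) \<gamma>)"
      unfolding val_def sum_distrib_left using \<epsilon> by (intro sum_mono) (auto simp: mix_def)
    also have "\<dots> = (\<Sum>\<alpha>\<in>assigns q e. of_bool (satisfies f q \<alpha> (lift_constraint n0 h C)) *
        ((\<Prod>i\<in>e. base i (\<alpha> i)) * edge_density e \<alpha>))"
      using sum_transport[OF inj, of "\<lambda>\<gamma>. of_bool (satisfies f q \<gamma> C) * mix (scope C) \<gamma>"] im
      by (simp add: sat edge_weight)
    finally have "(1 - \<epsilon>) ^ 3 * val C \<le> (1 - \<epsilon>) ^ 2 *
      (\<Sum>\<alpha>\<in>assigns q e. of_bool (satisfies f q \<alpha> (lift_constraint n0 h C)) *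
        ((\<Prod>i\<in>e. base i (\<alpha> i)) * edge_density e \<alpha>))"
      using \<epsilon> by (simp add: mult_left_mono)
    also have "\<dots> = (\<Sum>\<alpha>\<in>assigns q e. of_bool (satisfies f q \<alpha> (lift_constraint n0 h C)) *
        ((1 - \<epsilon>) ^ 2 * ((\<Prod>i\<in>e. base i (\<alpha> i)) * edge_density e \<alpha>)))"
      unfolding sum_distrib_left by (intro sum.cong refl) simp
    also have "\<dots> \<le> (\<Sum>\<alpha>\<in>assigns q e. of_bool (satisfies f q \<alpha> (lift_constraint n0 h C)) * sa_solution t e \<alpha>)"
      using ce kt err by (intro sum_mono mult_left_mono sa_solution_edge[OF eE]) auto
    finally show "(\<Sum>\<alpha>\<in>assigns q (scope (lift_constraint n0 h C)).
        of_bool (satisfies f q \<alpha> (lift_constraint n0 h C)) * sa_solution t (scope (lift_constraint n0 h C)) \<alpha>)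
      \<ge> (1 - \<epsilon>) ^ 3 * val C" by (simp add: e_def)
  qed
qed

end

section \<open>Random lifts\<close>

text \<open>The trace of a core on the indices of its constraints. Base variables outside the scopes
  are inspected too; this only enlarges the event.\<close>

definition colliding :: "nat \<Rightarrow> (nat \<Rightarrow> nat \<Rightarrow> nat) \<Rightarrow> nat set \<Rightarrow> bool" where
  "colliding n0 \<omega> J \<longleftrightarrow> (\<forall>j\<in>J. \<exists>v<n0. \<exists>v'<n0. v \<noteq> v' \<and>
     (\<exists>i\<in>J - {j}. \<omega> i v = \<omega> j v) \<and> (\<exists>i\<in>J - {j}. \<omega> i v' = \<omega> j v'))"

text \<open>Counting only coincidences with earlier indices avoids redundancy: given the earlier
  copies, each entry restricts a fresh random value to at most \<open>card J\<close>
  possibilities.\<close>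

definition repeats :: "nat \<Rightarrow> (nat \<Rightarrow> nat \<Rightarrow> nat) \<Rightarrow> nat set \<Rightarrow> (nat \<times> nat) set" where
  "repeats n0 \<omega> J = {(j, v). j \<in> J \<and> v < n0 \<and> (\<exists>i\<in>J. i < j \<and> \<omega> i v = \<omega> j v)}"

lemma mem_repeats: "p \<in> repeats n0 \<omega> J \<longleftrightarrow> fst p \<in> J \<and> snd p < n0 \<and>
    (\<exists>i\<in>J. i < fst p \<and> \<omega> i (snd p) = \<omega> (fst p) (snd p))"
  by (auto simp: repeats_def case_prod_beta)

text \<open>Collision gives at least \<open>2 * card J\<close> shared entries. A shared entry that
  is not a repeat is the first with its value and can be sent to a later entry with the same value,
  which is a repeat. Distinct first entries have distinct images, so at least half of the shared
  entries are repeats.\<close>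

lemma card_repeats:
  assumes J: "finite J" and col: "colliding n0 \<omega> J"
  shows "card J \<le> card (repeats n0 \<omega> J)"
proof -
  define K where "K j = {v. v < n0 \<and> (\<exists>i\<in>J - {j}. \<omega> i v = \<omega> j v)}" for j
  let ?Q = "repeats n0 \<omega> J" and ?K = "Sigma J K"
  have fin: "finite (K j)" for j unfolding K_def by simp
  then have fK: "finite ?K" using J by simp
  have QK: "?Q \<subseteq> ?K" by (auto simp: repeats_def K_def)
  then have fQ: "finite ?Q" using fK finite_subset by blast
  have "2 \<le> card (K j)" if j: "j \<in> J" for j
  proof -
    obtain v v' where "v < n0" "v' < n0" "v \<noteq> v'" "\<exists>i\<in>J - {j}. \<omega> i v = \<omega> j v" "\<exists>i\<in>J - {j}. \<omega> i v' = \<omega> j v'"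
      using bspec[OF col[unfolded colliding_def] j] by (elim exE conjE)
    then have "v \<noteq> v'" "{v, v'} \<subseteq> K j" unfolding K_def by simp_all
    then show ?thesis using card_mono[OF fin[of j], of "{v, v'}"] by simp
  qed
  then have "(\<Sum>j\<in>J. 2) \<le> (\<Sum>j\<in>J. card (K j))" by (intro sum_mono)
  then have K2: "2 * card J \<le> card ?K" using J fin by simp
  define \<phi> where "\<phi> p = (SOME i. i \<in> J \<and> fst p < i \<and> \<omega> i (snd p) = \<omega> (fst p) (snd p))" for p
  have \<phi>: "\<phi> p \<in> J \<and> fst p < \<phi> p \<and> \<omega> (\<phi> p) (snd p) = \<omega> (fst p) (snd p)" if p: "p \<in> ?K - ?Q" for p
    unfolding \<phi>_def
  proof (rule someI_ex)
    obtain j v where jv: "p = (j, v)" "j \<in> J" "v \<in> K j" using p by auto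
    then obtain i where i: "i \<in> J" "i \<noteq> j" "\<omega> i v = \<omega> j v" unfolding K_def by auto
    have "\<not> i < j" using p jv i by (auto simp: repeats_def K_def)
    then show "\<exists>i. i \<in> J \<and> fst p < i \<and> \<omega> i (snd p) = \<omega> (fst p) (snd p)"
      using i jv by auto
  qed
  have "card (?K - ?Q) \<le> card ?Q"
  proof (rule card_inj_on_le[OF _ _ fQ])
    show "(\<lambda>p. (\<phi> p, snd p)) ` (?K - ?Q) \<subseteq> ?Q"
    proof (rule image_subsetI)
      fix p assume p: "p \<in> ?K - ?Q"
      then have "fst p \<in> J" "snd p < n0" by (auto simp: K_def)
      then show "(\<phi> p, snd p) \<in> ?Q" using \<phi>[OF p] by (auto simp: repeats_def intro!: bexI[of _ "fst p"])
    qed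
    show "inj_on (\<lambda>p. (\<phi> p, snd p)) (?K - ?Q)"
    proof (rule inj_onI, rule ccontr)
      fix p p' assume p: "p \<in> ?K - ?Q" "p' \<in> ?K - ?Q" "(\<phi> p, snd p) = (\<phi> p', snd p')" "p \<noteq> p'"
      have eq: "\<omega> (fst p) (snd p) = \<omega> (fst p') (snd p)" "snd p = snd p'"
        using \<phi>[OF p(1)] \<phi>[OF p(2)] p(3) by auto
      have "fst p \<noteq> fst p'" using p(4) eq(2) by (simp add: prod_eq_iff)
      moreover have "fst p \<in> J" "fst p' \<in> J" "snd p < n0" using p by (auto simp: K_def)
      ultimately have "p \<in> ?Q \<or> p' \<in> ?Q"
        unfolding mem_repeats using eq by (metis nat_neq_iff)
      then show False using p by blast
    qed
  qed
  then have "card ?K \<le> 2 * card ?Q" using QK fK fQ by (simp add: card_Diff_subset)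
  then show ?thesis using K2 by simp
qed

lemma self_power_div_fact_le: "real s ^ s / fact s \<le> exp (real s)"
proof -
  have "(\<Sum>i\<in>{s}. real s ^ i /\<^sub>R fact i) \<le> (\<Sum>i. real s ^ i /\<^sub>R fact i)"
    using summable_exp_generic[of "real s"] by (intro sum_le_suminf) auto
  then show ?thesis by (simp add: exp_def divide_inverse mult.commute)
qed

text \<open>\<open>s ^ s\<close> will count the choices of earlier partners; it cancels against the
  \<open>fact s\<close> in the binomial coefficient up to \<open>exp s\<close>.\<close>

lemma choose_mult_power_le: "real (m choose s) * real s ^ s \<le> (exp 1 * real m) ^ s"
proof -
  have "real (m choose s) * real s ^ s = real ((m choose s) * fact s) * (real s ^ s / fact s)"
    by simp
  also have "\<dots> \<le> real (m ^ s) * exp (real s)"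
    by (intro mult_mono self_power_div_fact_le of_nat_mono binomial_fact_pow) auto
  finally show ?thesis by (simp add: power_mult_distrib exp_of_nat_mult[of s 1, simplified] mult.commute)
qed

section \<open>Random copies: concentration and small collisions\<close>

locale random_lift =
  fixes f :: "nat list \<Rightarrow> bool" and k q :: nat and \<Phi>\<^sub>0 :: csp and n rounds :: nat
  assumes inst: "csp_instance k q \<Phi>\<^sub>0" and k: "k \<ge> 1" and n: "n \<ge> 1"
begin

abbreviation "n0 \<equiv> nvars \<Phi>\<^sub>0"
abbreviation "m0 \<equiv> length (constrs \<Phi>\<^sub>0)"
abbreviation "m \<equiv> rounds * m0"

text \<open>Only the copies are random. Each original constraint is used exactly
  \<open>rounds\<close> times, so averages over original constraints carry over without sampling
  error.\<close>

definition origin :: "nat \<Rightarrow> csp_constraint" where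
  "origin j = constrs \<Phi>\<^sub>0 ! (j mod m0)"

definition lifted :: "(nat \<Rightarrow> nat \<Rightarrow> nat) \<Rightarrow> nat \<Rightarrow> csp_constraint" where
  "lifted \<omega> j = lift_constraint n0 (\<omega> j) (origin j)"

definition copies :: "(nat \<Rightarrow> nat) set" where
  "copies = assigns n {..<n0}"

definition samples :: "(nat \<Rightarrow> nat \<Rightarrow> nat) set" where
  "samples = {..<m} \<rightarrow>\<^sub>E copies"

lemma m0: "m0 > 0" using inst by (auto simp: csp_instance_def)

lemma origin: "origin j \<in> set (constrs \<Phi>\<^sub>0)"
  using m0 by (simp add: origin_def)

lemma q: "q > 0" using q_pos inst k by blast

lemma finite_copies: "finite copies" unfolding copies_def by (intro finite_PiE) auto
lemma finite_samples: "finite samples" unfolding samples_def by (intro finite_PiE finite_copies) auto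
lemma card_copies: "card copies = n ^ n0" unfolding copies_def by (simp add: card_PiE)
lemma card_samples: "card samples = n ^ (n0 * m)"
  unfolding samples_def by (simp add: card_PiE card_copies power_mult)
lemma card_samples_pos: "card samples > 0" using n by (simp add: card_samples)

lemma sum_origin: "(\<Sum>j<m. g (origin j)) = real rounds * sum_list (map g (constrs \<Phi>\<^sub>0))"
proof -
  have "(\<Sum>j<m. g (origin j)) = (\<Sum>r<rounds. \<Sum>j\<in>{r * m0..<r * m0 + m0}. g (origin j))"
    by (rule sum.nat_group[symmetric])
  also have "\<dots> = (\<Sum>r<rounds. \<Sum>j\<in>{0..<m0}. g (constrs \<Phi>\<^sub>0 ! j))"
  proof (rule sum.cong[OF refl])
    fix r
    have "(\<Sum>j\<in>{r * m0..<r * m0 + m0}. g (origin j)) = (\<Sum>j\<in>{0..<m0}. g (origin (j + r * m0)))"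
      using sum.shift_bounds_nat_ivl[of "\<lambda>j. g (origin j)" 0 "r * m0" m0] by (simp add: add.commute)
    then show "(\<Sum>j\<in>{r * m0..<r * m0 + m0}. g (origin j)) = (\<Sum>j\<in>{0..<m0}. g (constrs \<Phi>\<^sub>0 ! j))"
      by (simp add: origin_def)
  qed
  finally show ?thesis by (simp add: sum_list_sum_nth)
qed

lemma csp_opt_ge:
  assumes "\<And>i. i < n0 \<Longrightarrow> \<sigma> i < q"
  shows "avg_constrs \<Phi>\<^sub>0 (\<lambda>C. of_bool (satisfies f q \<sigma> C)) \<le> csp_opt f q \<Phi>\<^sub>0"
proof -
  have "avg_constrs \<Phi>\<^sub>0 (\<lambda>C. of_bool (satisfies f q \<sigma> C)) =
      avg_constrs \<Phi>\<^sub>0 (\<lambda>C. of_bool (satisfies f q (restrict \<sigma> {..<n0}) C))"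
  proof (rule antisym; rule avg_constrs_mono)
    fix C assume C: "C \<in> set (constrs \<Phi>\<^sub>0)"
    have "satisfies f q \<sigma> C = satisfies f q (restrict \<sigma> {..<n0}) C"
      using scope_bounds(1)[OF inst C] by (intro satisfies_cong) auto
    then show "(of_bool (satisfies f q \<sigma> C) :: real) \<le> of_bool (satisfies f q (restrict \<sigma> {..<n0}) C)"
      "(of_bool (satisfies f q (restrict \<sigma> {..<n0}) C) :: real) \<le> of_bool (satisfies f q \<sigma> C)" by auto
  qed
  also have "\<dots> \<le> csp_opt f q \<Phi>\<^sub>0"
    unfolding csp_opt_def
    by (intro Max_ge finite_imageI finite_PiE imageI restrict_PiE_iff[THEN iffD2]) (use assms in auto)
  finally show ?thesis .
qed

lemma csp_opt_bounds: "0 \<le> csp_opt f q \<Phi>\<^sub>0" "csp_opt f q \<Phi>\<^sub>0 \<le> 1"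
proof -
  have "0 \<le> avg_constrs \<Phi>\<^sub>0 (\<lambda>C. of_bool (satisfies f q (\<lambda>_. 0) C))"
    unfolding avg_constrs_def by (intro divide_nonneg_nonneg sum_list_nonneg) auto
  also have "\<dots> \<le> csp_opt f q \<Phi>\<^sub>0" using q by (intro csp_opt_ge)
  finally show "0 \<le> csp_opt f q \<Phi>\<^sub>0" .
  have "assigns q {..<n0} \<noteq> {}" using q by (auto simp: PiE_eq_empty_iff)
  moreover have "avg_constrs \<Phi>\<^sub>0 g \<le> 1" if "\<And>C. g C \<le> 1" for g
    using avg_constrs_mono[of \<Phi>\<^sub>0 g "\<lambda>_. 1"] avg_constrs_const[of \<Phi>\<^sub>0 1] m0 that by simp
  ultimately show "csp_opt f q \<Phi>\<^sub>0 \<le> 1"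
    unfolding csp_opt_def by (subst Max_le_iff) (auto intro!: finite_PiE)
qed

lemma enc_less:
  assumes "v < n0" "a < n" shows "a * n0 + v < n0 * n"
proof -
  have "a * n0 + v < Suc a * n0" using assms by simp
  also have "\<dots> \<le> n * n0" using assms by (intro mult_le_mono1) simp
  finally show ?thesis by (simp add: mult.commute)
qed

text \<open>Independence over \<open>j\<close> turns the sum into a product. For a 0/1 value
  \<open>exp (l * X)\<close> is affine in \<open>X\<close>, and
  \<open>exp l - 1 \<le> l + l ^ 2\<close> bounds each factor through its mean.\<close>

lemma mgf:
  assumes \<sigma>: "\<sigma> \<in> assigns q {..<n0 * n}" and l: "0 \<le> l" "l \<le> 1"
  shows "(\<Sum>\<omega>\<in>samples. exp (l * (\<Sum>j<m. of_bool (satisfies f q \<sigma> (lifted \<omega> j))))) \<le>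
    real (card samples) * exp (real m * (csp_opt f q \<Phi>\<^sub>0 * l + l ^ 2))"
proof -
  define X where "X C h = (of_bool (satisfies f q \<sigma> (lift_constraint n0 h C)) :: real)" for C h
  define p where "p C = (\<Sum>h\<in>copies. X C h) / real (card copies)" for C
  have cp: "real (card copies) > 0" using n by (simp add: card_copies)
  have p01: "0 \<le> p C" "p C \<le> 1" for C
  proof -
    show "0 \<le> p C" unfolding p_def X_def by (intro divide_nonneg_nonneg sum_nonneg) auto
    have "(\<Sum>h\<in>copies. X C h) \<le> (\<Sum>h\<in>copies. 1)" unfolding X_def by (intro sum_mono) auto
    then show "p C \<le> 1" using cp by (simp add: p_def)
  qed
  have one: "(\<Sum>h\<in>copies. exp (l * X C h)) \<le> real (card copies) * exp (p C * l + l ^ 2)" for C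
  proof -
    have "exp (l * X C h) = 1 + X C h * (exp l - 1)" for h by (simp add: X_def)
    then have "(\<Sum>h\<in>copies. exp (l * X C h)) = (\<Sum>h\<in>copies. 1 + X C h * (exp l - 1))" by simp
    also have "\<dots> = real (card copies) + (\<Sum>h\<in>copies. X C h) * (exp l - 1)"
      by (simp only: sum.distrib sum_distrib_right) simp
    also have "(\<Sum>h\<in>copies. X C h) = real (card copies) * p C" using cp by (simp add: p_def)
    also have "real (card copies) + real (card copies) * p C * (exp l - 1) =
        real (card copies) * (1 + p C * (exp l - 1))"
      by (simp add: distrib_left mult.assoc)
    also have "real (card copies) * (1 + p C * (exp l - 1)) \<le> real (card copies) * exp (p C * l + l ^ 2)"
    proof (rule mult_left_mono)
      have "exp l \<le> 1 + l + l ^ 2" using l by (rule exp_bound)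
      then have "p C * (exp l - 1) \<le> p C * (l + l ^ 2)" using p01 by (intro mult_left_mono) auto
      also have "\<dots> \<le> p C * l + l ^ 2" using p01[of C] by (simp add: distrib_left mult_left_le_one_le)
      finally show "1 + p C * (exp l - 1) \<le> exp (p C * l + l ^ 2)"
        using exp_ge_add_one_self[of "p C * l + l ^ 2"] by linarith
    qed (use cp in simp)
    finally show ?thesis .
  qed
  \<comment> \<open>By linearity only the means matter, so one common \<open>h\<close> may be used
    for all original constraints. For fixed \<open>h\<close>, reading \<open>\<sigma>\<close> on the
    chosen copies gives an assignment of the original instance, which satisfies at most the optimal
    fraction.\<close>
  have sum_p: "(\<Sum>j<m. p (origin j)) \<le> real m * csp_opt f q \<Phi>\<^sub>0"
  proof -
    have "sum_list (map p Cs) = (\<Sum>h\<in>copies. sum_list (map (\<lambda>C. X C h) Cs)) / real (card copies)" for Cs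
      by (induction Cs) (simp_all add: p_def sum.distrib add_divide_distrib)
    then have "sum_list (map p (constrs \<Phi>\<^sub>0)) =
        (\<Sum>h\<in>copies. sum_list (map (\<lambda>C. X C h) (constrs \<Phi>\<^sub>0))) / real (card copies)" .
    also have "\<dots> \<le> (\<Sum>h\<in>copies. real m0 * csp_opt f q \<Phi>\<^sub>0) / real (card copies)"
    proof (intro divide_right_mono sum_mono)
      fix h assume h: "h \<in> copies"
      have "\<sigma> (h v * n0 + v) < q" if "v < n0" for v
        using \<sigma> enc_less[OF that, of "h v"] h that by (auto simp: copies_def)
      then have "avg_constrs \<Phi>\<^sub>0 (\<lambda>C. of_bool (satisfies f q (\<lambda>v. \<sigma> (h v * n0 + v)) C)) \<le> csp_opt f q \<Phi>\<^sub>0"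
        by (rule csp_opt_ge)
      then show "sum_list (map (\<lambda>C. X C h) (constrs \<Phi>\<^sub>0)) \<le> real m0 * csp_opt f q \<Phi>\<^sub>0"
        using m0 by (simp add: X_def satisfies_lift_constraint avg_constrs_def field_simps)
    qed simp
    also have "\<dots> = real m0 * csp_opt f q \<Phi>\<^sub>0" using cp by simp
    finally have "real rounds * sum_list (map p (constrs \<Phi>\<^sub>0)) \<le> real rounds * (real m0 * csp_opt f q \<Phi>\<^sub>0)"
      by (intro mult_left_mono) auto
    then show ?thesis by (simp add: sum_origin mult.assoc)
  qed
  have "(\<Sum>\<omega>\<in>samples. exp (l * (\<Sum>j<m. of_bool (satisfies f q \<sigma> (lifted \<omega> j))))) =
      (\<Sum>\<omega>\<in>samples. \<Prod>j<m. exp (l * X (origin j) (\<omega> j)))"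
    by (simp only: X_def lifted_def sum_distrib_left exp_sum[OF finite_lessThan])
  also have "\<dots> = (\<Prod>j<m. \<Sum>h\<in>copies. exp (l * X (origin j) h))"
    unfolding samples_def by (rule prod_sum_PiE[symmetric]) (auto simp: finite_copies)
  also have "\<dots> \<le> (\<Prod>j<m. real (card copies) * exp (p (origin j) * l + l ^ 2))"
    by (intro prod_mono conjI one sum_nonneg) auto
  also have "\<dots> = real (card samples) * exp ((\<Sum>j<m. p (origin j)) * l + real m * l ^ 2)"
    by (simp add: prod.distrib exp_sum[symmetric] sum.distrib sum_distrib_right card_samples card_copies power_mult)
  also have "\<dots> \<le> real (card samples) * exp (real m * (csp_opt f q \<Phi>\<^sub>0 * l + l ^ 2))"
  proof (intro mult_left_mono iffD2[OF exp_le_cancel_iff])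
    have "(\<Sum>j<m. p (origin j)) * l \<le> real m * csp_opt f q \<Phi>\<^sub>0 * l" using sum_p l by (intro mult_right_mono)
    then show "(\<Sum>j<m. p (origin j)) * l + real m * l ^ 2 \<le> real m * (csp_opt f q \<Phi>\<^sub>0 * l + l ^ 2)"
      by (simp add: algebra_simps)
  qed simp
  finally show ?thesis .
qed

text \<open>
  A sample is determined by its values outside \<open>Q\<close> and, for each element of \<open>Q\<close>, a smaller index
  with the same value.
\<close>

lemma card_samples_repeats:
  assumes J: "J \<subseteq> {..<m}" and Q: "Q \<subseteq> J \<times> {..<n0}"
  shows "card {\<omega>\<in>samples. Q \<subseteq> repeats n0 \<omega> J} * n ^ card Q \<le> card J ^ card Q * card samples"
proof -
  let ?I = "{..<m} \<times> {..<n0}"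
  let ?A = "{\<omega>\<in>samples. Q \<subseteq> repeats n0 \<omega> J}"
  have QI: "Q \<subseteq> ?I" using J Q by auto
  have fin: "finite Q" "finite J" using QI J finite_subset[of Q ?I] finite_subset[of J "{..<m}"] by auto
  define partner where "partner \<omega> p = (SOME i. i \<in> J \<and> i < fst p \<and> \<omega> i (snd p) = \<omega> (fst p) (snd p))"
    for \<omega> :: "nat \<Rightarrow> nat \<Rightarrow> nat" and p
  have partner: "partner \<omega> p \<in> J \<and> partner \<omega> p < fst p \<and> \<omega> (partner \<omega> p) (snd p) = \<omega> (fst p) (snd p)"
    if "\<omega> \<in> ?A" "p \<in> Q" for \<omega> p
  proof -
    have "p \<in> repeats n0 \<omega> J" using that by blast
    then have "\<exists>i. i \<in> J \<and> i < fst p \<and> \<omega> i (snd p) = \<omega> (fst p) (snd p)"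
      unfolding mem_repeats by blast
    then show ?thesis unfolding partner_def by (rule someI_ex)
  qed
  define code where "code \<omega> = (restrict (partner \<omega>) Q, restrict (\<lambda>p. \<omega> (fst p) (snd p)) (?I - Q))"
    for \<omega> :: "nat \<Rightarrow> nat \<Rightarrow> nat"
  have "card ?A \<le> card ((Q \<rightarrow>\<^sub>E J) \<times> (?I - Q \<rightarrow>\<^sub>E {..<n}))"
  proof (rule card_inj_on_le)
    show "code ` ?A \<subseteq> (Q \<rightarrow>\<^sub>E J) \<times> (?I - Q \<rightarrow>\<^sub>E {..<n})"
    proof (rule image_subsetI)
      fix \<omega> assume \<omega>: "\<omega> \<in> ?A"
      have "\<omega> i v < n" if "i < m" "v < n0" for i v
        using \<omega> that by (force simp: samples_def copies_def PiE_iff)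
      then show "code \<omega> \<in> (Q \<rightarrow>\<^sub>E J) \<times> (?I - Q \<rightarrow>\<^sub>E {..<n})"
        using partner[OF \<omega>] by (auto simp: code_def)
    qed
    show "inj_on code ?A"
    proof (rule inj_onI)
      fix \<omega> \<omega>' assume \<omega>: "\<omega> \<in> ?A" "\<omega>' \<in> ?A" "code \<omega> = code \<omega>'"
      have c1: "restrict (partner \<omega>) Q = restrict (partner \<omega>') Q"
        and c2: "restrict (\<lambda>p. \<omega> (fst p) (snd p)) (?I - Q) = restrict (\<lambda>p. \<omega>' (fst p) (snd p)) (?I - Q)"
        using \<omega>(3) unfolding code_def by simp_all
      have p: "partner \<omega> p = partner \<omega>' p" if "p \<in> Q" for p
        using fun_cong[OF c1, of p] that by simp
      have r: "\<omega> i v = \<omega>' i v" if "(i, v) \<in> ?I - Q" for i v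
        using fun_cong[OF c2, of "(i, v)"] that by simp
      have eq: "\<omega> i v = \<omega>' i v" if "i < m" "v < n0" for i v
        using that
      proof (induction i rule: less_induct)
        case (less i)
        show ?case
        proof (cases "(i, v) \<in> Q")
          case True
          have "partner \<omega> (i, v) < i" "partner \<omega> (i, v) < m"
            using partner[OF \<omega>(1) True] less.prems by auto
          then have "\<omega> (partner \<omega> (i, v)) v = \<omega>' (partner \<omega> (i, v)) v" using less by blast
          then show ?thesis using partner[OF \<omega>(1) True] partner[OF \<omega>(2) True] p[OF True] by simp
        qed (use r less.prems in auto)
      qed
      show "\<omega> = \<omega>'"
      proof (rule PiE_ext[of _ "{..<m}" "\<lambda>_. copies"])
        fix i assume i: "i \<in> {..<m}"
        show "\<omega> i = \<omega>' i"
          by (rule PiE_ext[of _ "{..<n0}" "\<lambda>_. {..<n}"])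
            (use \<omega> i eq in \<open>auto simp: samples_def copies_def PiE_iff\<close>)
      qed (use \<omega> in \<open>auto simp: samples_def\<close>)
    qed
  qed (use fin in \<open>auto intro!: finite_PiE finite_cartesian_product\<close>)
  then have "card ?A \<le> card J ^ card Q * n ^ (m * n0 - card Q)"
    using fin QI by (simp add: card_PiE card_cartesian_product card_Diff_subset)
  then have "card ?A * n ^ card Q \<le> card J ^ card Q * n ^ (m * n0 - card Q) * n ^ card Q"
    by (rule mult_le_mono1)
  also have "\<dots> = card J ^ card Q * (n ^ (m * n0 - card Q + card Q))" by (simp add: power_add)
  also have "m * n0 - card Q + card Q = n0 * m"
    using card_mono[of ?I Q] QI by (simp add: card_cartesian_product mult.commute)
  finally show ?thesis by (simp add: card_samples)
qed

text \<open>Union bound over the sets of exactly \<open>card J\<close> repeats, of which there are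
  at most \<open>2 ^ (card J * n0)\<close>.\<close>

lemma card_colliding:
  assumes J: "J \<subseteq> {..<m}"
  shows "real (card {\<omega>\<in>samples. colliding n0 \<omega> J}) \<le>
    2 ^ (card J * n0) * (real (card J) / real n) ^ card J * real (card samples)"
proof -
  let ?s = "card J"
  have fJ: "finite J" using J finite_subset by blast
  define \<Q> where "\<Q> = {Q. Q \<subseteq> J \<times> {..<n0} \<and> card Q = ?s}"
  have f\<Q>: "finite \<Q>" unfolding \<Q>_def by (rule finite_subset[of _ "Pow (J \<times> {..<n0})"]) (use fJ in auto)
  have sub: "{\<omega>\<in>samples. colliding n0 \<omega> J} \<subseteq> (\<Union>Q\<in>\<Q>. {\<omega>\<in>samples. Q \<subseteq> repeats n0 \<omega> J})"
  proof
    fix \<omega> assume \<omega>: "\<omega> \<in> {\<omega>\<in>samples. colliding n0 \<omega> J}"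
    then have "?s \<le> card (repeats n0 \<omega> J)" using card_repeats[OF fJ] by blast
    then obtain Q where "Q \<subseteq> repeats n0 \<omega> J" "card Q = ?s" by (metis obtain_subset_with_card_n)
    moreover have "repeats n0 \<omega> J \<subseteq> J \<times> {..<n0}" by (auto simp: repeats_def)
    ultimately show "\<omega> \<in> (\<Union>Q\<in>\<Q>. {\<omega>\<in>samples. Q \<subseteq> repeats n0 \<omega> J})" using \<omega> by (auto simp: \<Q>_def)
  qed
  have each: "real (card {\<omega>\<in>samples. Q \<subseteq> repeats n0 \<omega> J}) \<le> (real ?s / real n) ^ ?s * real (card samples)"
    if "Q \<in> \<Q>" for Q
  proof -
    have Q: "Q \<subseteq> J \<times> {..<n0}" "card Q = ?s" using that by (auto simp: \<Q>_def)
    have "real (card {\<omega>\<in>samples. Q \<subseteq> repeats n0 \<omega> J} * n ^ ?s) \<le> real (?s ^ ?s * card samples)"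
      using card_samples_repeats[OF J Q(1)] Q(2) by (intro of_nat_mono) simp
    then show ?thesis using n by (simp add: power_divide field_simps)
  qed
  have "card \<Q> \<le> card (Pow (J \<times> {..<n0}))" using fJ by (intro card_mono) (auto simp: \<Q>_def)
  then have c\<Q>: "real (card \<Q>) \<le> 2 ^ (?s * n0)"
    using fJ by (simp add: card_Pow card_cartesian_product)
  have "card {\<omega>\<in>samples. colliding n0 \<omega> J} \<le> card (\<Union>Q\<in>\<Q>. {\<omega>\<in>samples. Q \<subseteq> repeats n0 \<omega> J})"
    by (intro card_mono sub finite_UN_I f\<Q>) (simp add: finite_samples)
  also have "\<dots> \<le> (\<Sum>Q\<in>\<Q>. card {\<omega>\<in>samples. Q \<subseteq> repeats n0 \<omega> J})" by (rule card_UN_le[OF f\<Q>])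
  finally have "real (card {\<omega>\<in>samples. colliding n0 \<omega> J}) \<le>
      (\<Sum>Q\<in>\<Q>. real (card {\<omega>\<in>samples. Q \<subseteq> repeats n0 \<omega> J}))" by (simp flip: of_nat_sum)
  also have "\<dots> \<le> (\<Sum>Q\<in>\<Q>. (real ?s / real n) ^ ?s * real (card samples))" by (intro sum_mono each)
  also have "\<dots> \<le> 2 ^ (?s * n0) * ((real ?s / real n) ^ ?s * real (card samples))"
    using c\<Q> by (simp add: mult_right_mono)
  finally show ?thesis by (simp add: mult.assoc)
qed

definition bad_sets :: "nat \<Rightarrow> (nat \<Rightarrow> nat \<Rightarrow> nat) \<Rightarrow> nat set set" where
  "bad_sets g \<omega> = {J. J \<subseteq> {..<m} \<and> J \<noteq> {} \<and> card J \<le> g \<and> colliding n0 \<omega> J}"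

text \<open>First moment over the index sets of each size \<open>s\<close>. For \<open>m\<close>
  linear in \<open>n\<close> the bound is a geometric sum with constant ratio.\<close>

lemma sum_bad_sets:
  "(\<Sum>\<omega>\<in>samples. real (card (bad_sets g \<omega>))) \<le>
    (\<Sum>s=1..g. (exp 1 * real m * 2 ^ n0 / real n) ^ s) * real (card samples)"
proof -
  define \<J> where "\<J> s = {J. J \<subseteq> {..<m} \<and> card J = s}" for s
  have f\<J>: "finite (\<J> s)" for s unfolding \<J>_def by (rule finite_subset[of _ "Pow {..<m}"]) auto
  have "(\<Sum>\<omega>\<in>samples. real (card (bad_sets g \<omega>))) \<le>
      (\<Sum>\<omega>\<in>samples. \<Sum>s=1..g. \<Sum>J\<in>\<J> s. of_bool (colliding n0 \<omega> J))"
  proof (rule sum_mono)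
    fix \<omega>
    have "bad_sets g \<omega> \<subseteq> (\<Union>s\<in>{1..g}. {J\<in>\<J> s. colliding n0 \<omega> J})"
    proof
      fix J assume J: "J \<in> bad_sets g \<omega>"
      then have "finite J" "J \<noteq> {}" using finite_subset[of J "{..<m}"] by (auto simp: bad_sets_def)
      then have "card J \<ge> 1" by (simp add: Suc_le_eq card_gt_0_iff)
      then show "J \<in> (\<Union>s\<in>{1..g}. {J\<in>\<J> s. colliding n0 \<omega> J})" using J by (auto simp: bad_sets_def \<J>_def)
    qed
    then have "card (bad_sets g \<omega>) \<le> card (\<Union>s\<in>{1..g}. {J\<in>\<J> s. colliding n0 \<omega> J})"
      using f\<J> by (intro card_mono) auto
    also have "\<dots> \<le> (\<Sum>s=1..g. card {J\<in>\<J> s. colliding n0 \<omega> J})" by (intro card_UN_le) simp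
    finally have "real (card (bad_sets g \<omega>)) \<le> (\<Sum>s=1..g. real (card {J\<in>\<J> s. colliding n0 \<omega> J}))"
      by (simp flip: of_nat_sum)
    also have "\<dots> = (\<Sum>s=1..g. \<Sum>J\<in>\<J> s. of_bool (colliding n0 \<omega> J))"
      using f\<J> by (simp add: of_bool_def sum.If_cases Int_def)
    finally show "real (card (bad_sets g \<omega>)) \<le> (\<Sum>s=1..g. \<Sum>J\<in>\<J> s. of_bool (colliding n0 \<omega> J))" .
  qed
  also have "\<dots> = (\<Sum>s=1..g. \<Sum>J\<in>\<J> s. \<Sum>\<omega>\<in>samples. of_bool (colliding n0 \<omega> J))"
    by (subst sum.swap, intro sum.cong refl, rule sum.swap)
  also have "\<dots> = (\<Sum>s=1..g. \<Sum>J\<in>\<J> s. real (card {\<omega>\<in>samples. colliding n0 \<omega> J}))"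
    using finite_samples by (simp add: of_bool_def sum.If_cases Int_def)
  also have "\<dots> \<le> (\<Sum>s=1..g. \<Sum>J\<in>\<J> s. 2 ^ (s * n0) * (real s / real n) ^ s * real (card samples))"
  proof (intro sum_mono)
    fix s J assume "J \<in> \<J> s"
    then show "real (card {\<omega>\<in>samples. colliding n0 \<omega> J}) \<le> 2 ^ (s * n0) * (real s / real n) ^ s * real (card samples)"
      using card_colliding[of J] by (auto simp: \<J>_def)
  qed
  also have "\<dots> = (\<Sum>s=1..g. (real (m choose s) * real s ^ s) * ((2 ^ n0 / real n) ^ s * real (card samples)))"
    by (intro sum.cong refl)
       (simp add: \<J>_def n_subsets power_divide power_mult[symmetric] mult.commute[of n0] mult_ac)
  also have "\<dots> \<le> (\<Sum>s=1..g. (exp 1 * real m) ^ s * ((2 ^ n0 / real n) ^ s * real (card samples)))"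
    by (intro sum_mono mult_right_mono choose_mult_power_le) auto
  also have "\<dots> = (\<Sum>s=1..g. (exp 1 * real m * 2 ^ n0 / real n) ^ s) * real (card samples)"
    by (simp add: sum_distrib_right power_divide power_mult_distrib mult.assoc)
  finally show ?thesis .
qed

end

section \<open>A good sample and the deletion of collisions\<close>

context random_lift
begin

text \<open>\<open>P\<close> adds a normalised term for every possible failure, each at least 1 if
  the failure occurs, and its mean is below 1. The choice \<open>l = \<epsilon> / 2\<close>
  minimises the Chernoff exponent \<open>l ^ 2 - l * \<epsilon>\<close>, which gives the 4.\<close>

lemma exists_sample:
  assumes \<epsilon>: "0 < \<epsilon>" "\<epsilon> \<le> 1" and rounds: "rounds \<ge> 1"
    and small: "real q ^ (n0 * n) * exp (- (real m * \<epsilon> ^ 2 / 4)) +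
      (\<Sum>s=1..g. (exp 1 * real m * 2 ^ n0 / real n) ^ s) / (\<epsilon> * real m) < 1"
  obtains \<omega> where "\<omega> \<in> samples"
    "\<And>\<sigma>. \<sigma> \<in> assigns q {..<n0 * n} \<Longrightarrow>
      (\<Sum>j<m. of_bool (satisfies f q \<sigma> (lifted \<omega> j))) \<le> (csp_opt f q \<Phi>\<^sub>0 + \<epsilon>) * real m"
    "real (card (bad_sets g \<omega>)) \<le> \<epsilon> * real m"
proof -
  let ?o = "csp_opt f q \<Phi>\<^sub>0" and ?N = "n0 * n" and ?l = "\<epsilon> / 2"
  define Y where "Y \<omega> \<sigma> = (\<Sum>j<m. of_bool (satisfies f q \<sigma> (lifted \<omega> j)) :: real)" for \<omega> \<sigma>
  define P where "P \<omega> = (\<Sum>\<sigma>\<in>assigns q {..<?N}. exp (?l * Y \<omega> \<sigma>) * exp (- ?l * ((?o + \<epsilon>) * real m))) +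
      real (card (bad_sets g \<omega>)) / (\<epsilon> * real m)" for \<omega>
  have "real m > 0" using rounds m0 by simp
  then have em: "\<epsilon> * real m > 0" using \<epsilon> by (intro mult_pos_pos)
  have cs: "real (card samples) > 0" using card_samples_pos by simp
  have fin: "finite (assigns q {..<?N})" by (intro finite_PiE) auto
  have "(\<Sum>\<omega>\<in>samples. \<Sum>\<sigma>\<in>assigns q {..<?N}. exp (?l * Y \<omega> \<sigma>) * exp (- ?l * ((?o + \<epsilon>) * real m))) =
      (\<Sum>\<sigma>\<in>assigns q {..<?N}. (\<Sum>\<omega>\<in>samples. exp (?l * Y \<omega> \<sigma>)) * exp (- ?l * ((?o + \<epsilon>) * real m)))"
    by (subst sum.swap) (simp add: sum_distrib_right)
  also have "\<dots> \<le> (\<Sum>\<sigma>\<in>assigns q {..<?N}. real (card samples) * exp (- (real m * \<epsilon> ^ 2 / 4)))"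
  proof (rule sum_mono)
    fix \<sigma> assume "\<sigma> \<in> assigns q {..<?N}"
    then have "(\<Sum>\<omega>\<in>samples. exp (?l * Y \<omega> \<sigma>)) \<le> real (card samples) * exp (real m * (?o * ?l + ?l ^ 2))"
      unfolding Y_def using \<epsilon> by (intro mgf) auto
    then have "(\<Sum>\<omega>\<in>samples. exp (?l * Y \<omega> \<sigma>)) * exp (- ?l * ((?o + \<epsilon>) * real m)) \<le>
        real (card samples) * exp (real m * (?o * ?l + ?l ^ 2)) * exp (- ?l * ((?o + \<epsilon>) * real m))"
      by (intro mult_right_mono) auto
    also have "\<dots> = real (card samples) * exp (- (real m * \<epsilon> ^ 2 / 4))"
      by (simp add: mult.assoc exp_add[symmetric]) (simp add: field_simps power2_eq_square)
    finally show "(\<Sum>\<omega>\<in>samples. exp (?l * Y \<omega> \<sigma>)) * exp (- ?l * ((?o + \<epsilon>) * real m)) \<le>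
      real (card samples) * exp (- (real m * \<epsilon> ^ 2 / 4))" .
  qed
  also have "\<dots> = real (card samples) * (real q ^ ?N * exp (- (real m * \<epsilon> ^ 2 / 4)))"
    by (simp add: card_PiE)
  finally have 1: "(\<Sum>\<omega>\<in>samples. \<Sum>\<sigma>\<in>assigns q {..<?N}. exp (?l * Y \<omega> \<sigma>) * exp (- ?l * ((?o + \<epsilon>) * real m)))
      \<le> real (card samples) * (real q ^ ?N * exp (- (real m * \<epsilon> ^ 2 / 4)))" .
  have 2: "(\<Sum>\<omega>\<in>samples. real (card (bad_sets g \<omega>)) / (\<epsilon> * real m)) \<le>
      real (card samples) * ((\<Sum>s=1..g. (exp 1 * real m * 2 ^ n0 / real n) ^ s) / (\<epsilon> * real m))"
    using sum_bad_sets[of g] em by (simp add: divide_right_mono mult.commute flip: sum_divide_distrib)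
  have "(\<Sum>\<omega>\<in>samples. P \<omega>) \<le> real (card samples) * (real q ^ ?N * exp (- (real m * \<epsilon> ^ 2 / 4)) +
      (\<Sum>s=1..g. (exp 1 * real m * 2 ^ n0 / real n) ^ s) / (\<epsilon> * real m))"
    unfolding P_def sum.distrib distrib_left by (rule add_mono[OF 1 2])
  also have "\<dots> < real (card samples) * 1" by (rule mult_strict_left_mono[OF small cs])
  finally have "(\<Sum>\<omega>\<in>samples. P \<omega>) < (\<Sum>\<omega>\<in>samples. 1)" by simp
  then obtain \<omega> where \<omega>: "\<omega> \<in> samples" "P \<omega> < 1"
    by (meson not_le sum_mono)
  have nn: "0 \<le> (\<Sum>\<sigma>\<in>assigns q {..<?N}. exp (?l * Y \<omega> \<sigma>) * exp (- ?l * ((?o + \<epsilon>) * real m)))"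
    by (intro sum_nonneg) auto
  have nn2: "0 \<le> real (card (bad_sets g \<omega>)) / (\<epsilon> * real m)" using em by simp
  show thesis
  proof (rule that[OF \<omega>(1)])
    fix \<sigma> assume \<sigma>: "\<sigma> \<in> assigns q {..<?N}"
    have "exp (?l * Y \<omega> \<sigma>) * exp (- ?l * ((?o + \<epsilon>) * real m)) \<le>
      (\<Sum>\<sigma>\<in>assigns q {..<?N}. exp (?l * Y \<omega> \<sigma>) * exp (- ?l * ((?o + \<epsilon>) * real m)))"
      by (rule member_le_sum[OF \<sigma>]) (use fin in auto)
    then have "exp (?l * Y \<omega> \<sigma>) * exp (- ?l * ((?o + \<epsilon>) * real m)) < 1"
      using \<omega>(2) nn2 unfolding P_def by linarith
    then have "exp (?l * Y \<omega> \<sigma> + - ?l * ((?o + \<epsilon>) * real m)) < exp 0" by (simp only: exp_add exp_zero)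
    then have "?l * Y \<omega> \<sigma> < ?l * ((?o + \<epsilon>) * real m)" unfolding exp_less_cancel_iff by linarith
    then have "Y \<omega> \<sigma> < (?o + \<epsilon>) * real m" using \<epsilon>(1) by (simp only: mult_less_cancel_left_pos half_gt_zero)
    then show "(\<Sum>j<m. of_bool (satisfies f q \<sigma> (lifted \<omega> j))) \<le> (?o + \<epsilon>) * real m"
      by (simp add: Y_def)
  next
    have "real (card (bad_sets g \<omega>)) / (\<epsilon> * real m) < 1" using \<omega>(2) nn unfolding P_def by linarith
    then show "real (card (bad_sets g \<omega>)) \<le> \<epsilon> * real m" using em by (simp add: divide_less_eq)
  qed
qed

lemma scope_lifted: "x \<in> scope (lifted \<omega> j) \<Longrightarrow> \<exists>v<n0. x = \<omega> j v * n0 + v"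
  using scope_bounds(1)[OF inst origin[of j]] by (auto simp: lifted_def scope_lift_constraint)

lemma encode_eq_iff:
  fixes v v' a a' :: nat
  assumes "v < n0" "v' < n0" shows "a * n0 + v = a' * n0 + v' \<longleftrightarrow> a = a' \<and> v = v'"
proof
  assume eq: "a * n0 + v = a' * n0 + v'"
  then have "(a * n0 + v) mod n0 = (a' * n0 + v') mod n0" by simp
  then have "v = v'" using assms by simp
  then show "a = a' \<and> v = v'" using eq assms by simp
qed simp

text \<open>Two distinct vertices of one lifted scope are copies of different base variables, and
  \<open>c\<close> sends distinct edges to distinct indices, so shared vertices become
  coincidences.\<close>

lemma core_colliding:
  assumes c: "\<And>e. e \<in> B \<Longrightarrow> scope (lifted \<omega> (c e)) = e" and B: "core {} B"
  shows "colliding n0 \<omega> (c ` B)"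
  unfolding colliding_def
proof
  fix j assume "j \<in> c ` B"
  then obtain e where e: "e \<in> B" "j = c e" by blast
  have hit: "\<exists>i\<in>c ` B - {j}. \<omega> i v = \<omega> j v" if v: "v < n0" "\<omega> j v * n0 + v \<in> \<Union>(B - {e})" for v
  proof -
    obtain e' where e': "e' \<in> B" "e' \<noteq> e" "\<omega> j v * n0 + v \<in> e'" using v(2) by blast
    then have "\<omega> j v * n0 + v \<in> scope (lifted \<omega> (c e'))" using c by simp
    then obtain v' where v': "v' < n0" "\<omega> j v * n0 + v = \<omega> (c e') v' * n0 + v'" using scope_lifted by blast
    then have "\<omega> (c e') v = \<omega> j v" using iffD1[OF encode_eq_iff[OF v(1) v'(1)] v'(2)] by simp
    moreover have "c e' \<noteq> j" using e' e c by metis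
    ultimately show ?thesis using e' by blast
  qed
  obtain x y where xy: "x \<in> e" "y \<in> e" "x \<noteq> y" "x \<in> \<Union>(B - {e})" "y \<in> \<Union>(B - {e})"
    using bspec[OF B[unfolded core_def] e(1)] by auto
  have ce: "scope (lifted \<omega> j) = e" using c e by simp
  obtain v where v: "v < n0" "x = \<omega> j v * n0 + v" using scope_lifted[of x \<omega> j] xy(1) ce by blast
  obtain v' where v': "v' < n0" "y = \<omega> j v' * n0 + v'" using scope_lifted[of y \<omega> j] xy(2) ce by blast
  have "v \<noteq> v'" using v v' xy(3) by blast
  then show "\<exists>v<n0. \<exists>v'<n0. v \<noteq> v' \<and> (\<exists>i\<in>c ` B - {j}. \<omega> i v = \<omega> j v) \<and> (\<exists>i\<in>c ` B - {j}. \<omega> i v' = \<omega> j v')"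
    using hit[OF v(1)] hit[OF v'(1)] v v' xy(4,5) by blast
qed

lemma lifted_instance: "csp_instance k q \<lparr>nvars = n0 * n, constrs = map (lifted \<omega>) js\<rparr>"
  if "\<omega> \<in> samples" "js \<noteq> []" "set js \<subseteq> {..<m}"
proof -
  have "length (fst (lifted \<omega> j)) = k" "length (snd (lifted \<omega> j)) = k"
    "set (fst (lifted \<omega> j)) \<subseteq> {..<n0 * n}" "set (snd (lifted \<omega> j)) \<subseteq> {..<q}"
    if "j \<in> set js" for j
  proof -
    have o: "length (fst (origin j)) = k" "length (snd (origin j)) = k"
      "set (fst (origin j)) \<subseteq> {..<n0}" "set (snd (origin j)) \<subseteq> {..<q}"
      using inst origin[of j] by (force simp: csp_instance_def)+
    have "j < m" using that \<open>set js \<subseteq> {..<m}\<close> by auto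
    then have "\<omega> j v < n" if "v < n0" for v
      using \<open>\<omega> \<in> samples\<close> that by (force simp: samples_def copies_def PiE_iff)
    then show "length (fst (lifted \<omega> j)) = k" "length (snd (lifted \<omega> j)) = k"
      "set (fst (lifted \<omega> j)) \<subseteq> {..<n0 * n}" "set (snd (lifted \<omega> j)) \<subseteq> {..<q}"
      using o enc_less by (auto simp: lifted_def lift_constraint_def)
  qed
  then show ?thesis using that(2) by (fastforce simp: csp_instance_def case_prod_beta)
qed

theorem high_girth_lift:
  assumes \<epsilon>: "0 < \<epsilon>" "\<epsilon> \<le> 1 / 4" and rounds: "rounds \<ge> 1" and R: "R \<ge> 2"
    and small: "real q ^ (n0 * n) * exp (- (real m * \<epsilon> ^ 2 / 4)) +
      (\<Sum>s=1..2 * R. (exp 1 * real m * 2 ^ n0 / real n) ^ s) / (\<epsilon> * real m) < 1"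
  obtains \<Phi> where "nvars \<Phi> = n0 * n" "csp_instance k q \<Phi>"
    "\<And>C. C \<in> set (constrs \<Phi>) \<Longrightarrow> \<exists>C\<^sub>0\<in>set (constrs \<Phi>\<^sub>0). \<exists>h. C = lift_constraint n0 h C\<^sub>0"
    "high_girth (scope ` set (constrs \<Phi>)) R"
    "csp_opt f q \<Phi> \<le> csp_opt f q \<Phi>\<^sub>0 + 4 * \<epsilon>"
    "\<And>F G. (\<And>C. C \<in> set (constrs \<Phi>\<^sub>0) \<Longrightarrow> 0 \<le> G C \<and> G C \<le> 1) \<Longrightarrow>
      (\<And>C h. C \<in> set (constrs \<Phi>\<^sub>0) \<Longrightarrow> lift_constraint n0 h C \<in> set (constrs \<Phi>) \<Longrightarrow> G C \<le> F (lift_constraint n0 h C)) \<Longrightarrow>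
      avg_constrs \<Phi>\<^sub>0 G - \<epsilon> \<le> avg_constrs \<Phi> F"
proof -
  let ?o = "csp_opt f q \<Phi>\<^sub>0"
  obtain \<omega> where \<omega>: "\<omega> \<in> samples"
    and sat: "\<And>\<sigma>. \<sigma> \<in> assigns q {..<n0 * n} \<Longrightarrow>
      (\<Sum>j<m. of_bool (satisfies f q \<sigma> (lifted \<omega> j))) \<le> (?o + \<epsilon>) * real m"
    and bad: "real (card (bad_sets (2 * R) \<omega>)) \<le> \<epsilon> * real m"
    using exists_sample[OF \<epsilon>(1) _ rounds small] \<epsilon>(2) by auto
  \<comment> \<open>One index is deleted from every bad set; which one is immaterial.\<close>
  define D where "D = (\<lambda>J. Min J) ` bad_sets (2 * R) \<omega>"
  define js where "js = filter (\<lambda>j. j \<notin> D) [0..<m]"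
  define \<Phi> where "\<Phi> = \<lparr>nvars = n0 * n, constrs = map (lifted \<omega>) js\<rparr>"
  have mpos: "real m > 0" using rounds m0 by simp
  have fb: "finite (bad_sets (2 * R) \<omega>)"
    by (rule finite_subset[of _ "Pow {..<m}"]) (auto simp: bad_sets_def)
  have Dm: "Min J \<in> J" "J \<subseteq> {..<m}" if "J \<in> bad_sets (2 * R) \<omega>" for J
    using that finite_subset[of J "{..<m}"] by (auto simp: bad_sets_def)
  then have DM: "D \<subseteq> {..<m}" unfolding D_def by blast
  have sjs: "set js = {..<m} - D" "distinct js" unfolding js_def by auto
  have cD: "real (card D) \<le> \<epsilon> * real m"
    using card_image_le[OF fb, of Min] bad unfolding D_def by linarith
  have "length js = card ({..<m} - D)" using sjs distinct_card by metis
  then have len: "length js = m - card D" using DM by (simp add: card_Diff_subset finite_subset)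
  have "card D \<le> m" using card_mono[OF _ DM] by simp
  then have len': "real (length js) = real m - real (card D)" using len by (simp add: of_nat_diff)
  have lenm: "real (length js) \<ge> (1 - \<epsilon>) * real m" using len' cD by (simp add: algebra_simps)
  moreover have "(1 - \<epsilon>) * real m > 0" using mpos \<epsilon> by simp
  ultimately have lpos: "real (length js) > 0" by linarith
  then have ne: "js \<noteq> []" by auto
  have avg: "avg_constrs \<Phi> F = (\<Sum>j\<in>{..<m} - D. F (lifted \<omega> j)) / real (length js)" for F
    using sjs by (simp add: avg_constrs_def \<Phi>_def o_def sum_list_distinct_conv_sum_set)
  have inst\<Phi>: "csp_instance k q \<Phi>"
    unfolding \<Phi>_def using sjs by (intro lifted_instance \<omega> ne) auto
  show thesis
  proof (rule that[of \<Phi>])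
    show "nvars \<Phi> = n0 * n" by (simp add: \<Phi>_def)
    show "csp_instance k q \<Phi>" by (rule inst\<Phi>)
    show "\<exists>C\<^sub>0\<in>set (constrs \<Phi>\<^sub>0). \<exists>h. C = lift_constraint n0 h C\<^sub>0" if "C \<in> set (constrs \<Phi>)" for C
      using that origin by (auto simp: \<Phi>_def lifted_def)
    show "high_girth (scope ` set (constrs \<Phi>)) R"
    proof
      fix B assume B: "B \<subseteq> scope ` set (constrs \<Phi>)" "B \<noteq> {}" "card B \<le> 2 * R"
      \<comment> \<open>Constraints with equal scopes form a single edge; \<open>c\<close> will
        select one index for each.\<close>
      have "\<exists>j. j \<in> set js \<and> scope (lifted \<omega> j) = e" if "e \<in> B" for e
        using that B(1) by (auto simp: \<Phi>_def)
      then obtain c where c: "\<And>e. e \<in> B \<Longrightarrow> c e \<in> set js \<and> scope (lifted \<omega> (c e)) = e" by metis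
      show "\<not> core {} B"
      proof
        assume "core {} B"
        then have "colliding n0 \<omega> (c ` B)" using c by (intro core_colliding) auto
        moreover have "finite B" using B(1) finite_subset by blast
        then have "card (c ` B) \<le> 2 * R" using card_image_le[of B c] B(3) by linarith
        moreover have cB: "c ` B \<subseteq> set js" using c by blast
        ultimately have "c ` B \<in> bad_sets (2 * R) \<omega>" using B(2) sjs by (auto simp: bad_sets_def)
        then have "Min (c ` B) \<in> D" "Min (c ` B) \<in> c ` B" using Dm(1) by (auto simp: D_def)
        then show False using cB sjs by blast
      qed
    qed (use R in auto)
    show "csp_opt f q \<Phi> \<le> ?o + 4 * \<epsilon>"
      unfolding csp_opt_def[of f q \<Phi>]
    proof (subst Max_le_iff)
      show "finite ((\<lambda>\<sigma>. avg_constrs \<Phi> (\<lambda>C. of_bool (satisfies f q \<sigma> C))) ` assigns q {..<nvars \<Phi>})"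
        by (intro finite_imageI finite_PiE) auto
      show "(\<lambda>\<sigma>. avg_constrs \<Phi> (\<lambda>C. of_bool (satisfies f q \<sigma> C))) ` assigns q {..<nvars \<Phi>} \<noteq> {}"
        using q by (auto simp: PiE_eq_empty_iff)
      show "\<forall>a\<in>(\<lambda>\<sigma>. avg_constrs \<Phi> (\<lambda>C. of_bool (satisfies f q \<sigma> C))) ` assigns q {..<nvars \<Phi>}. a \<le> ?o + 4 * \<epsilon>"
      proof
        fix a assume "a \<in> (\<lambda>\<sigma>. avg_constrs \<Phi> (\<lambda>C. of_bool (satisfies f q \<sigma> C))) ` assigns q {..<nvars \<Phi>}"
        then obtain \<sigma> where a: "a = avg_constrs \<Phi> (\<lambda>C. of_bool (satisfies f q \<sigma> C))"
          and \<sigma>: "\<sigma> \<in> assigns q {..<n0 * n}" by (auto simp: \<Phi>_def)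
        have "(\<Sum>j\<in>{..<m} - D. of_bool (satisfies f q \<sigma> (lifted \<omega> j))) \<le>
            (\<Sum>j<m. of_bool (satisfies f q \<sigma> (lifted \<omega> j)) :: real)"
          by (intro sum_mono2) auto
        also have "\<dots> \<le> (?o + \<epsilon>) * real m" by (rule sat[OF \<sigma>])
        \<comment> \<open>Deletion may shrink the denominator by a factor
          \<open>1 - \<epsilon>\<close>. As \<open>?o \<le> 1\<close> and
          \<open>\<epsilon> \<le> 1 / 4\<close>, the slack \<open>3 * \<epsilon>\<close> pays for
          this.\<close>
        also have "\<dots> \<le> (?o + 4 * \<epsilon>) * ((1 - \<epsilon>) * real m)"
        proof -
          have "?o * \<epsilon> \<le> 1 * \<epsilon>" "4 * \<epsilon> * \<epsilon> \<le> 1 * \<epsilon>"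
            using csp_opt_bounds \<epsilon> by (intro mult_right_mono; simp)+
          moreover have "(?o + 4 * \<epsilon>) * (1 - \<epsilon>) = ?o + 4 * \<epsilon> - ?o * \<epsilon> - 4 * \<epsilon> * \<epsilon>"
            by (simp add: algebra_simps)
          ultimately have "?o + \<epsilon> \<le> (?o + 4 * \<epsilon>) * (1 - \<epsilon>)" using \<epsilon>(1) by linarith
          then have "(?o + \<epsilon>) * real m \<le> (?o + 4 * \<epsilon>) * (1 - \<epsilon>) * real m" by (intro mult_right_mono) auto
          then show ?thesis by (simp add: mult.assoc)
        qed
        also have "\<dots> \<le> (?o + 4 * \<epsilon>) * real (length js)"
          using lenm csp_opt_bounds(1) \<epsilon> by (intro mult_left_mono) auto
        finally show "a \<le> ?o + 4 * \<epsilon>"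
          unfolding a avg using lpos by (simp add: divide_le_eq)
      qed
    qed
    fix F G :: "csp_constraint \<Rightarrow> real"
    assume G: "\<And>C. C \<in> set (constrs \<Phi>\<^sub>0) \<Longrightarrow> 0 \<le> G C \<and> G C \<le> 1"
      and F: "\<And>C h. C \<in> set (constrs \<Phi>\<^sub>0) \<Longrightarrow> lift_constraint n0 h C \<in> set (constrs \<Phi>) \<Longrightarrow> G C \<le> F (lift_constraint n0 h C)"
    have G01: "0 \<le> G (origin j)" "G (origin j) \<le> 1" for j using G[OF origin] by auto
    have "avg_constrs \<Phi>\<^sub>0 G = (\<Sum>j<m. G (origin j)) / real m"
      using rounds by (simp add: sum_origin avg_constrs_def)
    moreover have "(\<Sum>j<m. G (origin j)) = (\<Sum>j\<in>{..<m} - D. G (origin j)) + (\<Sum>j\<in>D. G (origin j))"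
      using DM by (intro sum.subset_diff) auto
    moreover have "(\<Sum>j\<in>D. G (origin j)) \<le> (\<Sum>j\<in>D. 1)" by (intro sum_mono G01)
    ultimately have "avg_constrs \<Phi>\<^sub>0 G \<le> ((\<Sum>j\<in>{..<m} - D. G (origin j)) + \<epsilon> * real m) / real m"
      using cD mpos by (simp add: divide_right_mono)
    also have "\<dots> = (\<Sum>j\<in>{..<m} - D. G (origin j)) / real m + \<epsilon>"
      unfolding add_divide_distrib using nonzero_mult_div_cancel_right[of "real m" \<epsilon>] mpos by linarith
    \<comment> \<open>The terms are nonnegative, so dividing by the possibly smaller number of
      remaining constraints only helps.\<close>
    also have "(\<Sum>j\<in>{..<m} - D. G (origin j)) / real m \<le> (\<Sum>j\<in>{..<m} - D. G (origin j)) / real (length js)"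
      using lpos len' by (intro divide_left_mono sum_nonneg G01 mult_pos_pos mpos) auto
    also have "\<dots> \<le> (\<Sum>j\<in>{..<m} - D. F (lifted \<omega> j)) / real (length js)"
    proof (intro divide_right_mono sum_mono)
      fix j assume "j \<in> {..<m} - D"
      then show "G (origin j) \<le> F (lifted \<omega> j)"
        using F[OF origin, of "\<omega> j" j] sjs by (simp add: lifted_def \<Phi>_def)
    qed simp
    finally show "avg_constrs \<Phi>\<^sub>0 G - \<epsilon> \<le> avg_constrs \<Phi> F" unfolding avg by linarith
  qed
qed

end

section \<open>The gap\<close>

text \<open>Shows that the set of feasible values is nonempty, as needed to extract a near-optimal
  solution from the supremum.\<close>

lemma basic_feasible_uniform:
  assumes \<Phi>: "csp_instance k q \<Phi>" and q: "q > 0"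
  shows "basic_feasible q \<Phi> (\<lambda>S _. 1 / real q ^ card S) (\<lambda>_ _. 1 / real q)"
  unfolding basic_feasible_def
proof (intro conjI ballI allI impI)
  fix C i b assume C: "C \<in> set (constrs \<Phi>)" "i \<in> scope C" and b: "b < q"
  have fin: "finite (scope C)" using scope_bounds[OF \<Phi> C(1)] by blast
  then have "card (scope C) > 0" using C(2) by (auto simp: card_gt_0_iff)
  then have "real q ^ card (scope C) = real q * real q ^ (card (scope C) - 1)"
    by (metis power_eq_if less_numeral_extra(3))
  then show "(\<Sum>\<alpha> | \<alpha> \<in> assigns q (scope C) \<and> \<alpha> i = b. 1 / real q ^ card (scope C)) = 1 / real q"
    using card_assigns_fixed[OF fin C(2) b] q by simp
qed (use q in auto)

context basic_solution
begin

lemma val_bounds: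
  assumes C: "C \<in> set (constrs \<Phi>\<^sub>0)" shows "0 \<le> val C" "val C \<le> 1"
proof -
  show "0 \<le> val C" unfolding val_def by (intro sum_nonneg) (simp add: x_nonneg[OF C])
  have fin: "finite (scope C)" using scope_bounds[OF inst C] by blast
  have "length (fst C) = k" using inst C by (force simp: csp_instance_def)
  then obtain i where i: "i \<in> scope C" using k by (cases "fst C") (auto simp: scope_def)
  then have "i < n0" using scope_bounds(1)[OF inst C] by auto
  have "val C \<le> (\<Sum>\<alpha>\<in>assigns q (scope C). x (scope C) \<alpha>)"
    unfolding val_def using x_nonneg[OF C] by (intro sum_mono) auto
  also have "\<dots> = (\<Sum>b<q. \<Sum>\<alpha> | \<alpha> \<in> assigns q (scope C) \<and> \<alpha> i = b. x (scope C) \<alpha>)"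
    using i fin by (intro sum.group[symmetric] finite_PiE) auto
  also have "\<dots> = (\<Sum>b<q. y i b)" using x_marginal[OF C i] by simp
  also have "\<dots> = 1" using feas \<open>i < n0\<close> by (simp add: basic_feasible_def)
  finally show "val C \<le> 1" .
qed

lemma lp_objective_val: "lp_objective f q \<Phi>\<^sub>0 x = avg_constrs \<Phi>\<^sub>0 val"
  unfolding lp_objective_def by (simp add: val_def[abs_def])

text \<open>In the LP value, \<open>3 * \<epsilon>\<close> is lost through
  \<open>(1 - \<epsilon>) ^ 3\<close> by Bernoulli's inequality, and one more
  \<open>\<epsilon>\<close> through the deleted constraints.\<close>

theorem gap_transfer:
  assumes \<epsilon>4: "\<epsilon> \<le> 1 / 4" and n: "n \<ge> 1" and rounds: "rounds \<ge> 1" and R: "R \<ge> 2" and kt: "k \<le> t"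
    and err: "sa_error k \<epsilon> (real q / \<epsilon>) R t \<le> \<epsilon>"
    and small: "real q ^ (n0 * n) * exp (- (real (rounds * length (constrs \<Phi>\<^sub>0)) * \<epsilon> ^ 2 / 4)) +
      (\<Sum>s=1..2 * R. (exp 1 * real (rounds * length (constrs \<Phi>\<^sub>0)) * 2 ^ n0 / real n) ^ s) /
        (\<epsilon> * real (rounds * length (constrs \<Phi>\<^sub>0))) < 1"
  obtains \<Phi> where "nvars \<Phi> = n0 * n" "csp_instance k q \<Phi>"
    "sa_lp_opt f q t \<Phi> \<ge> lp_objective f q \<Phi>\<^sub>0 x - 4 * \<epsilon>"
    "csp_opt f q \<Phi> \<le> csp_opt f q \<Phi>\<^sub>0 + 4 * \<epsilon>"
proof -
  interpret rl: random_lift f k q \<Phi>\<^sub>0 n rounds by unfold_locales (use inst k n in auto)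
  obtain \<Phi> where \<Phi>: "nvars \<Phi> = n0 * n" "csp_instance k q \<Phi>"
    and lift: "\<And>C. C \<in> set (constrs \<Phi>) \<Longrightarrow> \<exists>C\<^sub>0\<in>set (constrs \<Phi>\<^sub>0). \<exists>h. C = lift_constraint n0 h C\<^sub>0"
    and girth: "high_girth (scope ` set (constrs \<Phi>)) R"
    and opt: "csp_opt f q \<Phi> \<le> csp_opt f q \<Phi>\<^sub>0 + 4 * \<epsilon>"
    and avg: "\<And>F G. (\<And>C. C \<in> set (constrs \<Phi>\<^sub>0) \<Longrightarrow> 0 \<le> G C \<and> G C \<le> 1) \<Longrightarrow>
      (\<And>C h. C \<in> set (constrs \<Phi>\<^sub>0) \<Longrightarrow> lift_constraint n0 h C \<in> set (constrs \<Phi>) \<Longrightarrow> G C \<le> F (lift_constraint n0 h C)) \<Longrightarrow>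
      avg_constrs \<Phi>\<^sub>0 G - \<epsilon> \<le> avg_constrs \<Phi> F"
    using rl.high_girth_lift[OF \<epsilon>(1) \<epsilon>4 rounds R small] by blast
  obtain z where z: "sa_feasible q t \<Phi> z"
    and zval: "\<And>C h. C \<in> set (constrs \<Phi>\<^sub>0) \<Longrightarrow> lift_constraint n0 h C \<in> set (constrs \<Phi>) \<Longrightarrow>
      (\<Sum>\<alpha>\<in>assigns q (scope (lift_constraint n0 h C)).
        of_bool (satisfies f q \<alpha> (lift_constraint n0 h C)) * z (scope (lift_constraint n0 h C)) \<alpha>)
      \<ge> (1 - \<epsilon>) ^ 3 * val C"
    using sa_solution_of_lift[OF \<Phi>(2) lift girth err kt] by blast
  have p: "0 \<le> (1 - \<epsilon>) ^ 3" "(1 - \<epsilon>) ^ 3 \<le> 1" using \<epsilon> by (auto intro: power_le_one)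
  have "avg_constrs \<Phi>\<^sub>0 (\<lambda>C. (1 - \<epsilon>) ^ 3 * val C) - \<epsilon> \<le> lp_objective f q \<Phi> z"
    unfolding lp_objective_def
  proof (rule avg)
    fix C assume "C \<in> set (constrs \<Phi>\<^sub>0)"
    then show "0 \<le> (1 - \<epsilon>) ^ 3 * val C \<and> (1 - \<epsilon>) ^ 3 * val C \<le> 1"
      using val_bounds p by (simp add: mult_le_one)
  qed (rule zval)
  then have "(1 - \<epsilon>) ^ 3 * lp_objective f q \<Phi>\<^sub>0 x - \<epsilon> \<le> lp_objective f q \<Phi> z"
    by (simp add: avg_constrs_cmult lp_objective_val)
  also have "\<dots> \<le> sa_lp_opt f q t \<Phi>" by (rule sa_lp_opt_ge[OF \<Phi>(2) z kt])
  finally have 1: "(1 - \<epsilon>) ^ 3 * lp_objective f q \<Phi>\<^sub>0 x - \<epsilon> \<le> sa_lp_opt f q t \<Phi>" .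
  have "lp_objective f q \<Phi>\<^sub>0 x \<le> avg_constrs \<Phi>\<^sub>0 (\<lambda>_. 1)"
    unfolding lp_objective_val by (rule avg_constrs_mono) (rule val_bounds)
  then have le1: "lp_objective f q \<Phi>\<^sub>0 x \<le> 1"
    using avg_constrs_const[of \<Phi>\<^sub>0 1] rl.m0 by simp
  have "1 + real 3 * (- \<epsilon>) \<le> (1 + - \<epsilon>) ^ 3" using \<epsilon> by (intro Bernoulli_inequality) auto
  then have b: "1 - (1 - \<epsilon>) ^ 3 \<le> 3 * \<epsilon>" by simp
  have "(1 - (1 - \<epsilon>) ^ 3) * lp_objective f q \<Phi>\<^sub>0 x \<le> (1 - (1 - \<epsilon>) ^ 3) * 1"
    using le1 p by (intro mult_left_mono) auto
  then have "lp_objective f q \<Phi>\<^sub>0 x - 4 * \<epsilon> \<le> (1 - \<epsilon>) ^ 3 * lp_objective f q \<Phi>\<^sub>0 x - \<epsilon>"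
    using b by (simp add: left_diff_distrib)
  then show thesis using that[OF \<Phi> _ opt] 1 by linarith
qed

end

text \<open>Survival of a long trail is of order
  \<open>exp (- \<epsilon> * \<delta> * ln n)\<close>. The condition on \<open>c\<close> lets
  \<open>(4 * M) ^ t\<close> consume at most half of this exponent; the remaining half beats the
  polynomial factor, which is of order \<open>(ln n) ^ 6\<close>.\<close>

lemma sa_error_eventually_small:
  fixes k :: nat and \<epsilon> M \<delta> c :: real and R t :: "nat \<Rightarrow> nat"
  assumes \<epsilon>: "0 < \<epsilon>" "\<epsilon> < 1" and M: "M \<ge> 1" and \<delta>: "0 < \<delta>" "\<delta> \<le> 1"
    and c: "0 < c" "2 * c \<le> 1" "2 * c * ln (4 * M) \<le> \<epsilon> * \<delta> / 2"
    and t: "\<forall>\<^sub>F n in sequentially. real (t n) \<le> 2 * c * ln (real n)"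
  shows "\<forall>\<^sub>F n in sequentially. sa_error k \<epsilon> M (nat \<lfloor>\<delta> * ln (real n)\<rfloor>) (t n) \<le> \<epsilon>"
proof -
  define a where "a = \<epsilon> * \<delta> / 2"
  have a: "a > 0" using \<epsilon> \<delta> by (simp add: a_def)
  have "((\<lambda>n. ln (real n) ^ 6 * exp (- a * ln (real n))) \<longlongrightarrow> 0) sequentially"
    using a by real_asymp
  then have "((\<lambda>n. (real k ^ 2 * exp \<epsilon>) * (ln (real n) ^ 6 * exp (- a * ln (real n)))) \<longlongrightarrow> 0) sequentially"
    by (rule tendsto_mult_right_zero)
  also have "(\<lambda>n. (real k ^ 2 * exp \<epsilon>) * (ln (real n) ^ 6 * exp (- a * ln (real n)))) =
      (\<lambda>n. (real k * (ln (real n) ^ 2 * ln (real n))) ^ 2 * exp (\<epsilon> - a * ln (real n)))"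
    by (simp add: fun_eq_iff exp_diff exp_minus field_simps power2_eq_square eval_nat_numeral)
  finally have "\<forall>\<^sub>F n in sequentially. (real k * (ln (real n) ^ 2 * ln (real n))) ^ 2 * exp (\<epsilon> - a * ln (real n)) < \<epsilon>"
    using \<epsilon>(1) by (rule order_tendstoD(2))
  then show ?thesis
    using t eventually_ge_at_top[of 1]
  proof eventually_elim
    case (elim n)
    define u where "u = ln (real n)"
    define T where "T = t n"
    define r where "r = nat \<lfloor>\<delta> * u\<rfloor>"
    have u: "u \<ge> 0" using elim(3) by (simp add: u_def)
    have T: "real T \<le> 2 * c * u" using elim(2) by (simp add: T_def u_def)
    also have "2 * c * u \<le> 1 * u" using c u by (intro mult_right_mono)
    finally have Tu: "real T \<le> u" by simp
    have "\<delta> * u \<ge> 0" using \<delta> u by simp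
    then have r: "real r \<le> \<delta> * u" "real r \<ge> \<delta> * u - 1" unfolding r_def by linarith+
    have "\<delta> * u \<le> 1 * u" using \<delta> u by (intro mult_right_mono)
    then have ru: "real r \<le> u" using r by simp
    have f1: "(real k * real (T ^ 2 * r)) ^ 2 \<le> (real k * (u ^ 2 * u)) ^ 2"
    proof (intro power_mono mult_left_mono)
      have "real T ^ 2 * real r \<le> u ^ 2 * u" using Tu ru u by (intro mult_mono power_mono) auto
      then show "real (T ^ 2 * r) \<le> u ^ 2 * u" by simp
    qed auto
    have "(1 - \<epsilon>) ^ r \<le> exp (- \<epsilon>) ^ r"
      using \<epsilon> exp_ge_add_one_self[of "- \<epsilon>"] by (intro power_mono) auto
    also have "\<dots> = exp (- \<epsilon> * real r)" by (simp add: exp_of_nat_mult[symmetric] mult.commute)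
    \<comment> \<open>Rounding \<open>R\<close> down loses less than one edge, which accounts for
      the summand \<open>\<epsilon>\<close>.\<close>
    also have "\<dots> \<le> exp (\<epsilon> - 2 * a * u)"
    proof -
      have "\<epsilon> * (\<delta> * u - 1) \<le> \<epsilon> * real r" using r \<epsilon> by (intro mult_left_mono) auto
      then show ?thesis by (simp add: a_def algebra_simps)
    qed
    finally have f2: "(1 - \<epsilon>) ^ r \<le> exp (\<epsilon> - 2 * a * u)" .
    have "4 ^ T * M ^ T = (4 * M) ^ T" by (simp add: power_mult_distrib)
    also have "\<dots> = exp (ln (4 * M)) ^ T" using M by simp
    also have "\<dots> = exp (real T * ln (4 * M))" by (simp only: exp_of_nat_mult)
    also have "\<dots> \<le> exp (a * u)"
    proof -
      have "ln (4 * M) \<ge> 0" using M by simp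
      then have "real T * ln (4 * M) \<le> 2 * c * u * ln (4 * M)" using T by (intro mult_right_mono)
      also have "\<dots> = 2 * c * ln (4 * M) * u" by simp
      also have "\<dots> \<le> a * u" using c(3) u unfolding a_def by (intro mult_right_mono) 
      finally show ?thesis by simp
    qed
    finally have f3: "4 ^ T * M ^ T \<le> exp (a * u)" .
    have "sa_error k \<epsilon> M r T = (real k * real (T ^ 2 * r)) ^ 2 * ((1 - \<epsilon>) ^ r * (4 ^ T * M ^ T))"
      by (simp add: sa_error_def mult_ac)
    also have "\<dots> \<le> (real k * (u ^ 2 * u)) ^ 2 * (exp (\<epsilon> - 2 * a * u) * exp (a * u))"
      using \<epsilon> M by (intro mult_mono f1 f2 f3) auto
    also have "exp (\<epsilon> - 2 * a * u) * exp (a * u) = exp (\<epsilon> - a * u)"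
      by (simp add: exp_add[symmetric])
    also have "(real k * (u ^ 2 * u)) ^ 2 * exp (\<epsilon> - a * u) \<le> \<epsilon>" using elim(1) by (simp add: u_def)
    finally show ?case by (simp add: r_def T_def u_def)
  qed
qed

text \<open>The choice of \<open>\<Delta>\<close> makes the first term at most
  \<open>exp (- n)\<close>. The condition on \<open>\<delta>\<close> bounds
  \<open>K ^ (2 * R)\<close> by the square root of \<open>n\<close>, so the number of small
  collisions is sublinear in \<open>n\<close>.\<close>

lemma lift_parameters_eventually_small:
  fixes q n0 m0 \<Delta> :: nat and \<epsilon> \<delta> K :: real
  assumes \<epsilon>: "0 < \<epsilon>" and m0: "m0 \<ge> 1" and q: "q \<ge> 1" and \<Delta>: "\<Delta> \<ge> 1"
    and \<Delta>_ge: "real n0 * ln (real q) + 1 \<le> real \<Delta> * real m0 * \<epsilon> ^ 2 / 4"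
    and K: "K = exp 1 * real \<Delta> * real m0 * 2 ^ n0" and \<delta>: "0 < \<delta>" "\<delta> * ln K \<le> 1 / 4"
  shows "\<forall>\<^sub>F n in sequentially.
    real q ^ (n0 * n) * exp (- (real (\<Delta> * n * m0) * \<epsilon> ^ 2 / 4)) +
      (\<Sum>s=1..2 * nat \<lfloor>\<delta> * ln (real n)\<rfloor>. (exp 1 * real (\<Delta> * n * m0) * 2 ^ n0 / real n) ^ s) /
        (\<epsilon> * real (\<Delta> * n * m0)) < 1"
proof -
  have "((\<lambda>n. exp (- real n)) \<longlongrightarrow> 0) sequentially" by real_asymp
  then have 1: "\<forall>\<^sub>F n in sequentially. exp (- real n) < 1 / 2" by (rule order_tendstoD(2)) simp
  have "((\<lambda>n. 2 * (\<delta> * ln (real n)) * exp (ln (real n) / 2) / (\<epsilon> * real n)) \<longlongrightarrow> 0) sequentially"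
    using \<epsilon> \<delta> by real_asymp
  then have 2: "\<forall>\<^sub>F n in sequentially. 2 * (\<delta> * ln (real n)) * exp (ln (real n) / 2) / (\<epsilon> * real n) < 1 / 2"
    by (rule order_tendstoD(2)) simp
  have "1 \<le> exp (1::real)" by simp
  moreover have "1 \<le> real \<Delta> * real m0" using \<Delta> m0 by (simp flip: of_nat_mult)
  ultimately have "1 * 1 * 1 \<le> exp 1 * (real \<Delta> * real m0) * 2 ^ n0" by (intro mult_mono) auto
  then have K1: "K \<ge> 1" by (simp add: K mult.assoc)
  show ?thesis
    using 1 2 eventually_ge_at_top[of 1]
  proof eventually_elim
    case (elim n)
    define r where "r = nat \<lfloor>\<delta> * ln (real n)\<rfloor>"
    have n: "real n > 0" "ln (real n) \<ge> 0" using elim(3) by auto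
    then have "\<delta> * ln (real n) \<ge> 0" using \<delta> by simp
    then have r: "real r \<le> \<delta> * ln (real n)" unfolding r_def by linarith
    have Kn: "exp 1 * real (\<Delta> * n * m0) * 2 ^ n0 / real n = K" using n by (simp add: K)
    have "real q ^ (n0 * n) = exp (ln (real q)) ^ (n0 * n)" using q by simp
    also have "\<dots> = exp (real (n0 * n) * ln (real q))" by (simp only: exp_of_nat_mult)
    finally have "real q ^ (n0 * n) * exp (- (real (\<Delta> * n * m0) * \<epsilon> ^ 2 / 4)) =
        exp (real (n0 * n) * ln (real q) - real (\<Delta> * n * m0) * \<epsilon> ^ 2 / 4)"
      by (simp add: exp_add[symmetric])
    also have "\<dots> \<le> exp (- real n)"
    proof -
      have "(real n0 * ln (real q) + 1) * real n \<le> real \<Delta> * real m0 * \<epsilon> ^ 2 / 4 * real n"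
        using \<Delta>_ge by (intro mult_right_mono) auto
      then show ?thesis by (simp add: algebra_simps)
    qed
    finally have a: "real q ^ (n0 * n) * exp (- (real (\<Delta> * n * m0) * \<epsilon> ^ 2 / 4)) < 1 / 2"
      using elim(1) by linarith
    have "(\<Sum>s=1..2 * r. K ^ s) \<le> (\<Sum>s=1..2 * r. K ^ (2 * r))"
      using K1 by (intro sum_mono power_increasing) auto
    also have "\<dots> = 2 * real r * K ^ (2 * r)" by simp
    also have "K ^ (2 * r) = exp (ln K) ^ (2 * r)" using K1 by simp
    also have "\<dots> = exp (real (2 * r) * ln K)" by (simp only: exp_of_nat_mult)
    also have "2 * real r * \<dots> \<le> 2 * (\<delta> * ln (real n)) * exp (ln (real n) / 2)"
    proof (intro mult_mono iffD2[OF exp_le_cancel_iff])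
      have "real r * ln K \<le> \<delta> * ln (real n) * ln K" using r K1 by (intro mult_right_mono) auto
      also have "\<dots> = \<delta> * ln K * ln (real n)" by simp
      also have "\<dots> \<le> 1 / 4 * ln (real n)" using \<delta> n by (intro mult_right_mono) auto
      finally show "real (2 * r) * ln K \<le> ln (real n) / 2" by simp
    qed (use r \<delta> n in auto)
    finally have s: "(\<Sum>s=1..2 * r. K ^ s) \<le> 2 * (\<delta> * ln (real n)) * exp (ln (real n) / 2)" .
    have nm: "real n \<le> real (\<Delta> * n * m0)"
    proof -
      have "1 * real n \<le> real \<Delta> * real m0 * real n"
        using \<open>1 \<le> real \<Delta> * real m0\<close> by (intro mult_right_mono) auto
      then show ?thesis by (simp add: mult_ac)
    qed
    have "real (\<Delta> * n * m0) > 0" using nm n by linarith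
    then have "(\<Sum>s=1..2 * r. K ^ s) / (\<epsilon> * real (\<Delta> * n * m0)) \<le> (\<Sum>s=1..2 * r. K ^ s) / (\<epsilon> * real n)"
      using nm \<epsilon> n K1
      by (intro divide_left_mono mult_left_mono mult_pos_pos sum_nonneg) (auto simp del: of_nat_mult)
    also have "\<dots> \<le> 2 * (\<delta> * ln (real n)) * exp (ln (real n) / 2) / (\<epsilon> * real n)"
      using s \<epsilon> n by (intro divide_right_mono) auto
    finally show ?case unfolding Kn r_def[symmetric] using a elim(2) by linarith
  qed
qed

theorem mainTheorem1:
  fixes f :: "nat list \<Rightarrow> bool" and k q :: nat and c s :: real and \<Phi>\<^sub>0 :: csp
  assumes "k \<ge> 1"
    and "gap_instance (basic_lp_opt f q) f k q c s \<Phi>\<^sub>0"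
  shows "\<forall>\<epsilon>::real. \<epsilon> > 0 \<longrightarrow> (\<exists>c\<^sub>\<epsilon>::real. c\<^sub>\<epsilon> > 0 \<and>
    infinite {N::nat. \<exists>\<Phi>. nvars \<Phi> = N \<and>
      gap_instance (sa_lp_opt f q (nat \<lfloor>c\<^sub>\<epsilon> * (ln (real N) / ln (ln (real N)))\<rfloor>))
        f k q (c - \<epsilon>) (s + \<epsilon>) \<Phi>})"
proof (intro allI impI)
  fix \<epsilon>\<^sub>0 :: real assume \<epsilon>\<^sub>0: "\<epsilon>\<^sub>0 > 0"
  have inst: "csp_instance k q \<Phi>\<^sub>0" and lp: "basic_lp_opt f q \<Phi>\<^sub>0 \<ge> c" and opt: "csp_opt f q \<Phi>\<^sub>0 < s"
    using assms(2) by (auto simp: gap_instance_def)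
  have q: "q > 0" using q_pos[OF inst assms(1)] .
  \<comment> \<open>At most \<open>5 * \<epsilon>\<close> of the LP value is lost:
    \<open>\<epsilon>\<close> by taking a near-optimal basic solution and
    \<open>4 * \<epsilon>\<close> in the transfer. The factor 8 leaves slack.\<close>
  define \<epsilon> where "\<epsilon> = min (\<epsilon>\<^sub>0 / 8) (1 / 4)"
  have eps: "0 < \<epsilon>" "\<epsilon> \<le> 1 / 4" "8 * \<epsilon> \<le> \<epsilon>\<^sub>0" using \<epsilon>\<^sub>0 by (auto simp: \<epsilon>_def)
  let ?n0 = "nvars \<Phi>\<^sub>0" and ?m0 = "length (constrs \<Phi>\<^sub>0)"
  obtain x y where feas: "basic_feasible q \<Phi>\<^sub>0 x y" and obj: "lp_objective f q \<Phi>\<^sub>0 x > c - \<epsilon>"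
  proof -
    let ?X = "{lp_objective f q \<Phi>\<^sub>0 x |x y. basic_feasible q \<Phi>\<^sub>0 x y}"
    have "c - \<epsilon> < Sup ?X" using lp eps by (simp add: basic_lp_opt_def)
    moreover have "?X \<noteq> {}" using basic_feasible_uniform[OF inst q] by blast
    ultimately obtain w where "w \<in> ?X" "c - \<epsilon> < w" by (rule less_cSupE)
    then show thesis using that by blast
  qed
  interpret basic_solution f k q \<Phi>\<^sub>0 x y \<epsilon>
    by unfold_locales (use inst assms(1) feas eps in auto)
  have m0: "?m0 \<ge> 1" using inst by (simp add: csp_instance_def Suc_le_eq)
  have n0: "?n0 \<ge> 1"
  proof -
    obtain C where C: "C \<in> set (constrs \<Phi>\<^sub>0)" using m0 by (metis last_in_set list.size(3) not_one_le_zero)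
    have "length (fst C) = k" using inst C by (force simp: csp_instance_def)
    then obtain i where "i \<in> scope C" using assms(1) by (cases "fst C") (auto simp: scope_def)
    then show ?thesis using scope_bounds(1)[OF inst C] by force
  qed
  define M where "M = real q / \<epsilon>"
  have M: "M \<ge> 1" using q \<epsilon> by (simp add: M_def)
  \<comment> \<open>Enough constraints per copy for the Chernoff bound to beat all
    \<open>q ^ (n0 * n)\<close> assignments by a further factor \<open>exp n\<close>, whence the 1
    inside the rounding.\<close>
  define \<Delta> where "\<Delta> = nat \<lceil>4 * (real ?n0 * ln (real q) + 1) / \<epsilon> ^ 2\<rceil> + 1"
  have \<Delta>: "\<Delta> \<ge> 1" by (simp add: \<Delta>_def)
  have \<Delta>_ge: "real ?n0 * ln (real q) + 1 \<le> real \<Delta> * real ?m0 * \<epsilon> ^ 2 / 4"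
  proof -
    have "4 * (real ?n0 * ln (real q) + 1) / \<epsilon> ^ 2 \<le> real \<Delta>" unfolding \<Delta>_def by linarith
    also have "real \<Delta> * 1 \<le> real \<Delta> * real ?m0" using m0 by (intro mult_left_mono) auto
    finally show ?thesis using \<epsilon> by (simp add: field_simps)
  qed
  define K where "K = exp 1 * real \<Delta> * real ?m0 * 2 ^ ?n0"
  \<comment> \<open>Adding 1 to the absolute value keeps the denominator positive whatever the value
    of \<open>K\<close>.\<close>
  define \<delta> where "\<delta> = min 1 (1 / (4 * (\<bar>ln K\<bar> + 1)))"
  have \<delta>: "0 < \<delta>" "\<delta> \<le> 1" by (auto simp: \<delta>_def)
  have \<delta>K: "\<delta> * ln K \<le> 1 / 4"
  proof -
    have "\<delta> * ln K \<le> \<delta> * (\<bar>ln K\<bar> + 1)" using \<delta> by (intro mult_left_mono) auto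
    also have "\<dots> \<le> 1 / (4 * (\<bar>ln K\<bar> + 1)) * (\<bar>ln K\<bar> + 1)" by (intro mult_right_mono) (auto simp: \<delta>_def)
    also have "\<dots> = 1 / 4" by (simp add: field_simps)
    finally show ?thesis .
  qed
  \<comment> \<open>The first bound keeps the level below \<open>ln n\<close>; the second lets the
    level's cost use at most half of the decay exponent
    \<open>\<epsilon> * \<delta>\<close>.\<close>
  define c' where "c' = min (1 / 2) (\<epsilon> * \<delta> / (4 * (ln (4 * M) + 1)))"
  have l4M: "ln (4 * M) \<ge> 0" using M by simp
  have c': "0 < c'" "2 * c' \<le> 1" using \<epsilon> \<delta> l4M by (auto simp: c'_def)
  have c'M: "2 * c' * ln (4 * M) \<le> \<epsilon> * \<delta> / 2"
  proof -
    have "2 * c' * ln (4 * M) \<le> 2 * c' * (ln (4 * M) + 1)" using c' by (intro mult_left_mono) auto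
    also have "\<dots> \<le> 2 * (\<epsilon> * \<delta> / (4 * (ln (4 * M) + 1))) * (ln (4 * M) + 1)"
      using l4M by (intro mult_right_mono) (auto simp: c'_def)
    also have "\<dots> = \<epsilon> * \<delta> / 2" using l4M by (simp add: field_simps)
    finally show ?thesis .
  qed
  define t where "t N = nat \<lfloor>c' * (ln (real N) / ln (ln (real N)))\<rfloor>" for N
  define R where "R n = nat \<lfloor>\<delta> * ln (real n)\<rfloor>" for n
  have n0': "real ?n0 > 0" using n0 by simp
  have "filterlim (\<lambda>n. c' * (ln (real ?n0 * real n) / ln (ln (real ?n0 * real n)))) at_top sequentially"
    using c'(1) n0' by real_asymp
  then have "\<forall>\<^sub>F n in sequentially. c' * (ln (real ?n0 * real n) / ln (ln (real ?n0 * real n))) \<ge> real k"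
    by (simp add: filterlim_at_top)
  then have ev_t: "\<forall>\<^sub>F n in sequentially. k \<le> t (?n0 * n)"
    by eventually_elim (simp add: t_def le_nat_floor)
  have "filterlim (\<lambda>n. \<delta> * ln (real n)) at_top sequentially" using \<delta>(1) by real_asymp
  then have "\<forall>\<^sub>F n in sequentially. \<delta> * ln (real n) \<ge> 2" by (simp add: filterlim_at_top)
  then have ev_R: "\<forall>\<^sub>F n in sequentially. R n \<ge> 2"
    by eventually_elim (simp add: R_def le_nat_floor)
  \<comment> \<open>Once the iterated logarithm is at least 1, the level is at most
    \<open>c' * ln N\<close>, and \<open>n \<ge> n0\<close> gives \<open>ln N \<le> 2 * ln n\<close>
    for \<open>N = n0 * n\<close>.\<close>
  have "filterlim (\<lambda>n. ln (ln (real ?n0 * real n))) at_top sequentially" using n0' by real_asymp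
  then have "\<forall>\<^sub>F n in sequentially. ln (ln (real ?n0 * real n)) \<ge> 1" by (simp add: filterlim_at_top)
  then have "\<forall>\<^sub>F n in sequentially. real (t (?n0 * n)) \<le> 2 * c' * ln (real n)"
    using eventually_ge_at_top[of ?n0]
  proof eventually_elim
    case (elim n)
    have n: "real n \<ge> 1" using elim(2) n0 by simp
    have "ln (real ?n0 * real n) = ln (real ?n0) + ln (real n)" using n n0' by (simp add: ln_mult)
    also have "ln (real ?n0) \<le> ln (real n)" using elim(2) n0' by simp
    finally have l: "ln (real ?n0 * real n) \<le> 2 * ln (real n)" by simp
    have "1 \<le> real ?n0 * real n" using n n0 by (metis mult_ge1_I of_nat_1 of_nat_mono)
    then have l0: "ln (real ?n0 * real n) \<ge> 0" by simp
    have "ln (real ?n0 * real n) / ln (ln (real ?n0 * real n)) \<le> ln (real ?n0 * real n) / 1"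
      using elim(1) l0 by (intro divide_left_mono) auto
    then have "c' * (ln (real ?n0 * real n) / ln (ln (real ?n0 * real n))) \<le> c' * (2 * ln (real n))"
      using l c' by (intro mult_left_mono) auto
    moreover have "0 \<le> c' * (ln (real ?n0 * real n) / ln (ln (real ?n0 * real n)))"
      using c' l0 elim(1) by (intro mult_nonneg_nonneg divide_nonneg_nonneg) auto
    ultimately show ?case unfolding t_def by simp linarith
  qed
  then have ev_err: "\<forall>\<^sub>F n in sequentially. sa_error k \<epsilon> M (R n) (t (?n0 * n)) \<le> \<epsilon>"
    unfolding R_def using \<epsilon> M \<delta> c' c'M by (intro sa_error_eventually_small) auto
  have "q \<ge> 1" using q by simp
  from lift_parameters_eventually_small[OF \<epsilon>(1) m0 this \<Delta> \<Delta>_ge K_def \<delta>(1) \<delta>K]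
  have ev_small: "\<forall>\<^sub>F n in sequentially.
    real q ^ (?n0 * n) * exp (- (real (\<Delta> * n * ?m0) * \<epsilon> ^ 2 / 4)) +
      (\<Sum>s=1..2 * R n. (exp 1 * real (\<Delta> * n * ?m0) * 2 ^ ?n0 / real n) ^ s) /
        (\<epsilon> * real (\<Delta> * n * ?m0)) < 1"
    unfolding R_def .
  have "\<forall>\<^sub>F n in sequentially. \<exists>\<Phi>. nvars \<Phi> = ?n0 * n \<and>
      gap_instance (sa_lp_opt f q (t (?n0 * n))) f k q (c - \<epsilon>\<^sub>0) (s + \<epsilon>\<^sub>0) \<Phi>"
    using ev_t ev_R ev_err ev_small eventually_ge_at_top[of 1]
  proof eventually_elim
    case (elim n)
    have rounds: "\<Delta> * n \<ge> 1" using \<Delta> elim(5) by simp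
    obtain \<Phi> where \<Phi>: "nvars \<Phi> = ?n0 * n" "csp_instance k q \<Phi>"
      "sa_lp_opt f q (t (?n0 * n)) \<Phi> \<ge> lp_objective f q \<Phi>\<^sub>0 x - 4 * \<epsilon>"
      "csp_opt f q \<Phi> \<le> csp_opt f q \<Phi>\<^sub>0 + 4 * \<epsilon>"
      using gap_transfer[OF eps(2) elim(5) rounds elim(2) elim(1) elim(3)[unfolded M_def] elim(4)] by blast
    have "sa_lp_opt f q (t (?n0 * n)) \<Phi> \<ge> c - \<epsilon>\<^sub>0" using \<Phi>(3) obj eps by linarith
    moreover have "csp_opt f q \<Phi> < s + \<epsilon>\<^sub>0" using \<Phi>(4) opt eps by linarith
    ultimately show ?case using \<Phi>(1,2) by (auto simp: gap_instance_def)
  qed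
  then obtain n1 where n1: "\<And>n. n \<ge> n1 \<Longrightarrow> \<exists>\<Phi>. nvars \<Phi> = ?n0 * n \<and>
      gap_instance (sa_lp_opt f q (t (?n0 * n))) f k q (c - \<epsilon>\<^sub>0) (s + \<epsilon>\<^sub>0) \<Phi>"
    unfolding eventually_sequentially by blast
  \<comment> \<open>The construction yields every sufficiently large multiple of the number of
    original variables as a size.\<close>
  have "inj_on (\<lambda>n. ?n0 * n) {n1..}" using n0 by (intro inj_onI) simp
  then have "infinite ((\<lambda>n. ?n0 * n) ` {n1..})" using finite_imageD infinite_Ici by blast
  moreover have "(\<lambda>n. ?n0 * n) ` {n1..} \<subseteq> {N. \<exists>\<Phi>. nvars \<Phi> = N \<and>
      gap_instance (sa_lp_opt f q (t N)) f k q (c - \<epsilon>\<^sub>0) (s + \<epsilon>\<^sub>0) \<Phi>}"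
    using n1 by auto
  ultimately have "infinite {N. \<exists>\<Phi>. nvars \<Phi> = N \<and>
      gap_instance (sa_lp_opt f q (t N)) f k q (c - \<epsilon>\<^sub>0) (s + \<epsilon>\<^sub>0) \<Phi>}"
    using infinite_super by blast
  then show "\<exists>c\<^sub>\<epsilon>>0. infinite {N. \<exists>\<Phi>. nvars \<Phi> = N \<and>
      gap_instance (sa_lp_opt f q (nat \<lfloor>c\<^sub>\<epsilon> * (ln (real N) / ln (ln (real N)))\<rfloor>))
        f k q (c - \<epsilon>\<^sub>0) (s + \<epsilon>\<^sub>0) \<Phi>}"
    using c'(1) unfolding t_def by blast
qed

end
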